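(* Let $L\ge 2$, let $\kappa=(\kappa_1,\ldots,\kappa_L)$ be any sequence of positive integers, and put $n=\kappa_1+\cdots+\kappa_L$ and $\kappa_{\min}=\min\{\kappa_1,\ldots,\kappa_L\}$. Let $G$ be a regular graph on the vertex set $\{1,\ldots,n\}$, identified with the transition matrix $(G_{ij})_{1\le i,j\le n}$ of its simple random walk. Then the log-Sobolev constant $\tau_{\mathrm{LS}}(\kappa,G)$ of the $\kappa$-colored exclusion process on $G$ satisfies $$\max\left\{2\,\tau_{\mathrm{REL}}(G),\ \log\left(\frac{n}{\kappa_{\min}}\right)\right\}\ \le\ \tau_{\mathrm{LS}}(\kappa,G)\ \le\ \frac{4}{\log 2}\,c(G)\,\log\left(\frac{n}{\kappa_{\min}}\right),$$ where $\tau_{\mathrm{REL}}(G)$ is the Poincaré constant of the simple random walk on $G$ and $c(G)$ is the comparison constant of the interchange process on $G$.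
   Context: All logarithms are natural. For $\kappa=(\kappa_1,\ldots,\kappa_L)$ with $n=\sum_\ell\kappa_\ell$, the multislice is $\Omega_\kappa=\{\omega\in\{1,\ldots,L\}^n:\ \#\{i:\omega_i=\ell\}=\kappa_\ell\text{ for each }\ell\}$, with the uniform probability distribution, whose expectation is denoted $\mathbb{E}_\kappa$. For $1\le i<j\le n$, $\omega^{ij}$ denotes $\omega$ with its $i$-th and $j$-th coordinates swapped, and $(\nabla^{ij}f)(\omega)=f(\omega^{ij})-f(\omega)$. If $G$ is a (simple) $d$-regular graph, $d\ge1$, on $\{1,\ldots,n\}$, then $G_{ij}=1/d$ if $i,j$ are adjacent and $G_{ij}=0$ otherwise. Set $$\mathcal{E}_\kappa(f,g)=\frac{1}{2n}\sum_{1\le i<j\le n}\mathbb{E}_\kappa\left[(\nabla^{ij}f)(\nabla^{ij}g)\right],\qquad \mathcal{E}^G_\kappa(f,g)=\frac12\sum_{1\le i<j\le n}G_{ij}\,\mathbb{E}_\kappa\left[(\nabla^{ij}f)(\nabla^{ij}g)\right].$$ For $f:\Omega_\kappa\to[0,\infty)$, $\mathrm{Ent}_\kappa(f)=\mathbb{E}_\kappa[f\log f]-\mathbb{E}_\kappa[f]\log\mathbb{E}_\kappa[f]$ with $0\log0=0$. The following constants are taken to be $+\infty$ if no finite constant works. - $\tau_{\mathrm{LS}}(\kappa,G)$ is the smallest $\tau\ge0$ such that $\mathrm{Ent}_\kappa(f)\le\tau\,\mathcal{E}^G_\kappa(\sqrt f,\sqrt f)$ for all $f:\Omega_\kappa\to[0,\infty)$.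 - $\tau_{\mathrm{REL}}(G)$ is the smallest $\tau\ge0$ such that $\mathrm{Var}(h)\le\tau\,\frac{1}{2n}\sum_{i,j=1}^n G_{ij}(h(i)-h(j))^2$ for all $h:\{1,\ldots,n\}\to\mathbb{R}$, where $\mathrm{Var}(h)$ is the variance under the uniform distribution on $\{1,\ldots,n\}$. - $c(G)$ is the smallest number such that $\mathcal{E}_{(1,\ldots,1)}(f,f)\le c(G)\,\mathcal{E}^G_{(1,\ldots,1)}(f,f)$ for all $f:\Omega_{(1,\ldots,1)}\to\mathbb{R}$, where $(1,\ldots,1)$ has $n$ entries, so that $\Omega_{(1,\ldots,1)}$ is the set of permutations of $\{1,\ldots,n\}$. *)

theory Defs
  imports "HOL-Probability.Probability" "HOL-Combinatorics.Transposition"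
begin

definition regular_graph :: "nat \<Rightarrow> nat \<Rightarrow> (nat \<Rightarrow> nat \<Rightarrow> bool) \<Rightarrow> bool" where
  "regular_graph n d adj \<longleftrightarrow>
     {(i, j). adj i j} \<subseteq> {1..n} \<times> {1..n} \<and> symp adj \<and> irreflp adj \<and>
     (\<forall>i\<in>{1..n}. card {j. adj i j} = d)"

definition walk_matrix :: "nat \<Rightarrow> (nat \<Rightarrow> nat \<Rightarrow> bool) \<Rightarrow> nat \<Rightarrow> nat \<Rightarrow> real" where
  "walk_matrix d adj i j = (if adj i j then 1 / real d else 0)"

text \<open>
  The sequence of colour multiplicities is a number \<open>L\<close> of colours together with a
  function \<open>\<kappa>\<close>, of which only the values on \<open>{1..L}\<close> matter.
\<close>

definition num_sites :: "nat \<Rightarrow> (nat \<Rightarrow> nat) \<Rightarrow> nat" where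
  "num_sites L \<kappa> = (\<Sum>l = 1..L. \<kappa> l)"

definition multislice :: "nat \<Rightarrow> (nat \<Rightarrow> nat) \<Rightarrow> (nat \<Rightarrow> nat) set" where
  "multislice L \<kappa> =
     {\<omega> \<in> {1..num_sites L \<kappa>} \<rightarrow>\<^sub>E {1..L}.
        \<forall>l\<in>{1..L}. card {i \<in> {1..num_sites L \<kappa>}. \<omega> i = l} = \<kappa> l}"

definition expect :: "nat \<Rightarrow> (nat \<Rightarrow> nat) \<Rightarrow> ((nat \<Rightarrow> nat) \<Rightarrow> real) \<Rightarrow> real" where
  "expect L \<kappa> f = measure_pmf.expectation (pmf_of_set (multislice L \<kappa>)) f"

definition grad :: "nat \<Rightarrow> nat \<Rightarrow> ((nat \<Rightarrow> nat) \<Rightarrow> real) \<Rightarrow> (nat \<Rightarrow> nat) \<Rightarrow> real" where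
  "grad i j f \<omega> = f (\<omega> \<circ> Transposition.transpose i j) - f \<omega>"

definition dirichlet ::
    "nat \<Rightarrow> (nat \<Rightarrow> nat) \<Rightarrow> ((nat \<Rightarrow> nat) \<Rightarrow> real) \<Rightarrow> ((nat \<Rightarrow> nat) \<Rightarrow> real) \<Rightarrow> real" where
  "dirichlet L \<kappa> f g =
     1 / (2 * real (num_sites L \<kappa>)) *
     (\<Sum>i = 1..num_sites L \<kappa>. \<Sum>j = i+1..num_sites L \<kappa>.
        expect L \<kappa> (\<lambda>\<omega>. grad i j f \<omega> * grad i j g \<omega>))"

definition dirichlet_on ::
    "nat \<Rightarrow> (nat \<Rightarrow> nat) \<Rightarrow> (nat \<Rightarrow> nat \<Rightarrow> real) \<Rightarrow>
     ((nat \<Rightarrow> nat) \<Rightarrow> real) \<Rightarrow> ((nat \<Rightarrow> nat) \<Rightarrow> real) \<Rightarrow> real" where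
  "dirichlet_on L \<kappa> G f g =
     1 / 2 *
     (\<Sum>i = 1..num_sites L \<kappa>. \<Sum>j = i+1..num_sites L \<kappa>.
        G i j * expect L \<kappa> (\<lambda>\<omega>. grad i j f \<omega> * grad i j g \<omega>))"

definition Ent :: "nat \<Rightarrow> (nat \<Rightarrow> nat) \<Rightarrow> ((nat \<Rightarrow> nat) \<Rightarrow> real) \<Rightarrow> real" where
  "Ent L \<kappa> f = expect L \<kappa> (\<lambda>\<omega>. f \<omega> * ln (f \<omega>)) - expect L \<kappa> f * ln (expect L \<kappa> f)"

text \<open>
  The optimal constants live in \<^typ>\<open>ereal\<close>, where the infimum of the empty set is \<open>\<infinity>\<close>.
  The constraints are closed conditions on the constant, so a finite infimum is attained.
  Functions on the multislice are total functions, of which only the values on the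
  multislice enter: it is stable under swapping two sites.
\<close>

definition tau_LS :: "nat \<Rightarrow> (nat \<Rightarrow> nat) \<Rightarrow> (nat \<Rightarrow> nat \<Rightarrow> real) \<Rightarrow> ereal" where
  "tau_LS L \<kappa> G =
     Inf {ereal \<tau> |\<tau>. 0 \<le> \<tau> \<and>
       (\<forall>f. (\<forall>\<omega>\<in>multislice L \<kappa>. 0 \<le> f \<omega>) \<longrightarrow>
          Ent L \<kappa> f \<le> \<tau> * dirichlet_on L \<kappa> G (\<lambda>\<omega>. sqrt (f \<omega>)) (\<lambda>\<omega>. sqrt (f \<omega>)))}"

definition tau_REL :: "nat \<Rightarrow> (nat \<Rightarrow> nat \<Rightarrow> real) \<Rightarrow> ereal" where
  "tau_REL n G =
     Inf {ereal \<tau> |\<tau>. 0 \<le> \<tau> \<and>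
       (\<forall>h :: nat \<Rightarrow> real. measure_pmf.variance (pmf_of_set {1..n}) h
          \<le> \<tau> * (1 / (2 * real n) * (\<Sum>i = 1..n. \<Sum>j = 1..n. G i j * (h i - h j)\<^sup>2)))}"

definition comparison_const :: "nat \<Rightarrow> (nat \<Rightarrow> nat \<Rightarrow> real) \<Rightarrow> ereal" where
  "comparison_const n G =
     Inf {ereal c |c.
       \<forall>f. dirichlet n (\<lambda>_. 1) f f \<le> c * dirichlet_on n (\<lambda>_. 1) G f f}"

end

theory Submission imports Defs begin

text \<open>
  Upper bound on the complete graph. One proves the stronger inequality in which the swap of sites
  \<open>j\<close>, \<open>k\<close> carries the weight \<open>ln (n\<^sup>2 / (\<kappa> a * \<kappa> b)) \<le> 2 * ln (n / \<kappa>min)\<close>, where \<open>a\<close>, \<open>b\<close> are the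
  colours at \<open>j\<close>, \<open>k\<close>. One reveals the colour of a uniformly chosen site. Given that colour, the law
  is uniform on a smaller multislice, so induction applies, and the entropy of the revealed colour is
  bounded by a weighted log-Sobolev inequality on one site together with a swap coupling.
  For the single site, write the function as \<open>1 + t * h\<close> with \<open>h\<close> centred and normalised under \<open>p\<close>;
  since \<open>p a * (1 + (h a)\<^sup>2) \<le> 1\<close>, the weights dominate a function of \<open>h\<close>, and the second derivative
  in \<open>t\<close> of the difference of the two sides is controlled pointwise in \<open>h\<close>.
  A general graph follows by definition of \<open>c(G)\<close>, lifting functions to permutations.

  Lower bounds. The indicator of a rare colour at one site gives the logarithm; linear statistics
  of the set of sites of one colour, in the linearised inequality, give \<open>2 * \<tau>_REL\<close>.
\<close>

section \<open>One-dimensional inequalities\<close>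

text \<open>The uniform weight ln (n / \<kappa>min) does not survive conditioning: revealing a site
  of the rarest colour lowers its count, and the conditional constant can exceed the original one.
  With weights depending on the two swapped colours, a revealed site does harm only if it is a
  further site of one of these colours. Averaged over the revealed site, this harm is paid for by
  the drop from ln n to ln (n - 1) and by a slack of order 1 / n^2.

  The constant 1 / ln 2 is the smallest that the single-site inequality allows: for two equally
  likely colours all weights equal ln 4, and small perturbations of a constant give equality to
  second order. There h = 1 or h = -1, so the one-dimensional estimates may lose nothing at these
  two points. Away from them the kernel \<open>w * ln w - w + 1\<close> with
  \<open>w = (1 + h\<^sup>2) / 2\<close> is positive, and crude rational bounds on 1 / ln 2
  suffice.\<close>

lemma ln_le_diff_div:
  fixes z :: real
  assumes "z \<ge> 1"
  shows "ln z \<le> (z\<^sup>2 - 1) / (2 * z)"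
proof -
  define f where "f x = (x\<^sup>2 - 1) / (2 * x) - ln x" for x :: real
  have "f 1 \<le> f z"
  proof (rule DERIV_nonneg_imp_nondecreasing[OF assms])
    fix x :: real assume x: "1 \<le> x" "x \<le> z"
    have "(f has_real_derivative ((2 * x) * (2 * x) - (x\<^sup>2 - 1) * 2) / (2 * x * (2 * x)) - 1 / x) (at x)"
      unfolding f_def using x by (auto intro!: derivative_eq_intros simp: power2_eq_square)
    moreover have "((2 * x) * (2 * x) - (x\<^sup>2 - 1) * 2) / (2 * x * (2 * x)) - 1 / x = (x - 1)\<^sup>2 / (2 * x\<^sup>2)"
      using x by (simp add: divide_simps power2_eq_square) (simp add: algebra_simps)
    ultimately show "\<exists>y. (f has_real_derivative y) (at x) \<and> 0 \<le> y"
      by (metis divide_nonneg_nonneg mult_nonneg_nonneg zero_le_numeral zero_le_power2)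
  qed
  thus ?thesis by (simp add: f_def)
qed

text \<open>With \<open>z = exp u\<close> this is \<open>2 * tanh (u / 2) \<le> u\<close>, just as
  the preceding bound is \<open>u \<le> sinh u\<close>. Both are exact to second order at 1.\<close>

lemma ln_ge_diff_div_sum:
  fixes z :: real
  assumes "z \<ge> 1"
  shows "2 * (z - 1) / (z + 1) \<le> ln z"
proof -
  define f where "f x = ln x - 2 * (x - 1) / (x + 1)" for x :: real
  have "f 1 \<le> f z"
  proof (rule DERIV_nonneg_imp_nondecreasing[OF assms])
    fix x :: real assume x: "1 \<le> x" "x \<le> z"
    have "(f has_real_derivative 1 / x - (2 * (x + 1) - 2 * (x - 1)) / ((x + 1) * (x + 1))) (at x)"
      unfolding f_def using x by (auto intro!: derivative_eq_intros)
    moreover have "1 / x - (2 * (x + 1) - 2 * (x - 1)) / ((x + 1) * (x + 1)) = (x - 1)\<^sup>2 / (x * (x + 1)\<^sup>2)"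
      using x by (simp add: divide_simps power2_eq_square) (simp add: algebra_simps)
    moreover have "0 \<le> (x - 1)\<^sup>2 / (x * (x + 1)\<^sup>2)" using x by simp
    ultimately show "\<exists>y. (f has_real_derivative y) (at x) \<and> 0 \<le> y" by metis
  qed
  thus ?thesis by (simp add: f_def)
qed

text \<open>The kernel vanishes to first order at 1, and its second derivative 1 / w is at least 1
  on (0, 1].\<close>

lemma entropy_kernel_ge:
  fixes w :: real
  assumes "0 < w" "w \<le> 1"
  shows "(1 - w)\<^sup>2 / 2 \<le> w * ln w - w + 1"
proof -
  define f where "f x = x * ln x - x + 1 - (1 - x)\<^sup>2 / 2" for x :: real
  have "f 1 \<le> f w"
  proof (rule DERIV_nonpos_imp_nonincreasing[OF assms(2)])
    fix x :: real assume x: "w \<le> x" "x \<le> 1"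
    have "(f has_real_derivative ln x + (1 - x)) (at x)"
      unfolding f_def using x assms by (auto intro!: derivative_eq_intros simp: field_simps)
    moreover have "ln x + (1 - x) \<le> 0" using ln_le_minus_one[of x] x assms by linarith
    ultimately show "\<exists>y. (f has_real_derivative y) (at x) \<and> y \<le> 0" by blast
  qed
  thus ?thesis by (simp add: f_def)
qed

lemma entropy_kernel_nonneg:
  fixes w :: real
  assumes "0 < w"
  shows "0 \<le> w * ln w - w + 1"
proof -
  have "- ln w \<le> 1 / w - 1" using ln_le_minus_one[of "1/w"] assms by (simp add: ln_div)
  hence "w * (- ln w) \<le> w * (1 / w - 1)" using assms by (intro mult_left_mono) auto
  thus ?thesis using assms by (simp add: algebra_simps)
qed

text \<open>This is the second derivative needed for \<open>one_dim_ineq\<close> on [1, 2], with its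
  logarithms replaced by rational bounds. The coefficient 28 / 25 = 4 - 72 / 25 is what remains of
  ln h after ln ((1 + h^2) / 2) has been compared with ln h.\<close>

lemma rational_part_nonneg:
  fixes h :: real
  assumes "1 \<le> h" "h \<le> 2"
  shows "0 \<le> 72 / 25 * (h - 1)\<^sup>2 / (1 + h\<^sup>2) - 28 / 25 * ((h\<^sup>2 - 1) / (2 * h))
             + 144 / 25 * h\<^sup>2 / (1 + h\<^sup>2) - 4 + 18 * h * (h + 1) / (1 + h + h\<^sup>2) ^ 3"
proof -
  define e where "e = h - 1"
  have h: "h = 1 + e" and e: "0 \<le> e" "e \<le> 1" using assms by (auto simp: e_def)
  define g q where "g = 1 + h + h\<^sup>2" and "q = 1 + h\<^sup>2"
  have pos: "g > 0" "q > 0" "h > 0" using assms by (auto simp: g_def q_def add_pos_nonneg)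
  \<comment> \<open>After clearing denominators with h = 1 + e only the coefficients of e^9 and e^10
    are negative; on [0, 1] the term in e^8 absorbs them.\<close>
  have "e ^ 8 * (66 * e + 14 * e ^ 2) \<le> e ^ 8 * 156"
    using e power_le_one[of e 2] by (intro mult_left_mono) auto
  hence "66 * e ^ 9 + 14 * e ^ 10 \<le> 156 * e ^ 8"
    by (simp add: eval_nat_numeral algebra_simps)
  hence "0 \<le> 288 + 1116 * e + 4248 * e ^ 2 + 10962 * e ^ 3 + 16182 * e ^ 4 + 14148 * e ^ 5 + 7396 * e ^ 6
      + 2082 * e ^ 7 + 156 * e ^ 8 - 66 * e ^ 9 - 14 * e ^ 10"
    using zero_le_power[OF e(1), of 2] zero_le_power[OF e(1), of 3] zero_le_power[OF e(1), of 4]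
      zero_le_power[OF e(1), of 5] zero_le_power[OF e(1), of 6] zero_le_power[OF e(1), of 7] e(1)
    by linarith
  also have "\<dots> = 72 * (h - 1)\<^sup>2 * h * g ^ 3 - 14 * (h\<^sup>2 - 1) * q * g ^ 3
      + 144 * h\<^sup>2 * h * g ^ 3 - 100 * q * h * g ^ 3 + 450 * h * (h + 1) * h * q" (is "_ = ?num")
    unfolding g_def q_def h by algebra
  finally have "0 \<le> ?num / (25 * (q * h * g ^ 3))" 
    using pos by (intro divide_nonneg_pos mult_pos_pos zero_less_power) auto
  also have "\<dots> = 72 / 25 * (h - 1)\<^sup>2 / q - 28 / 25 * ((h\<^sup>2 - 1) / (2 * h)) + 144 / 25 * h\<^sup>2 / q - 4
             + 18 * h * (h + 1) / g ^ 3"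
  proof -
    have "(72 * a * h * G - 14 * k * q * G + 144 * d * h * G - 100 * q * h * G + 450 * m * h * q)
        / (25 * (q * h * G)) = 72 / 25 * a / q - 28 / 25 * (k / (2 * h)) + 144 / 25 * d / q - 4 + 18 * m / G" 
      if "G > 0" for a k d m G :: real
      using that pos by (simp add: add_divide_distrib diff_divide_distrib)
    from this[of "g ^ 3" "(h - 1)\<^sup>2" "h\<^sup>2 - 1" "h\<^sup>2" "h * (h + 1)"] pos(1) show ?thesis
      by (simp only: mult.assoc zero_less_power)
  qed
  finally show ?thesis unfolding g_def q_def .
qed

text \<open>
  The left-hand side minus the right-hand side vanishes to first order at \<open>h = 1\<close> and is convex
  on \<open>[1, \<infinity>)\<close>.
\<close>
lemma one_dim_ineq:
  fixes h :: real
  assumes h: "1 \<le> h"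
  defines "w \<equiv> (1 + h\<^sup>2) / 2"
  shows "h\<^sup>2 - 3 * h + 3 - 3 / (1 + h + h\<^sup>2)
           \<le> 36 / 25 * (2 * (w * ln w - w + 1)) + 2 * h\<^sup>2 - 2 * h - 2 * h\<^sup>2 * ln h"
proof -
  define W where "W x = (1 + x\<^sup>2) / 2" for x :: real
  define g where "g x = 1 + x + x\<^sup>2" for x :: real
  define F where "F x = 36 / 25 * (2 * (W x * ln (W x) - W x + 1)) + 2 * x\<^sup>2 - 2 * x - 2 * x\<^sup>2 * ln x
      - (x\<^sup>2 - 3 * x + 3 - 3 / g x)" for x
  define F1 where "F1 x = 72 / 25 * x * ln (W x) - 4 * x * ln x + 1 - 3 * (2 * x + 1) / (g x)\<^sup>2" for x
  \<comment> \<open>\<open>R1\<close> is the second derivative \<open>F2\<close> without its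
    positive last fraction. Since \<open>R1 1\<close> = -28 / 25, the fraction is indispensable near
    1; from 2 on \<open>R1\<close> alone is nonnegative, being increasing there.\<close>
  define R1 where "R1 x = 72 / 25 * ln (W x) + 144 / 25 * x\<^sup>2 / (1 + x\<^sup>2) - 4 - 4 * ln x" for x
  define F2 where "F2 x = R1 x + 18 * x * (x + 1) / (g x) ^ 3" for x
  have Wp: "W x > 0" for x by (simp add: W_def add_pos_nonneg)
  have gp: "g x > 0" if "x \<ge> 1" for x using that by (simp add: g_def add_pos_nonneg)
  have dW: "(W has_real_derivative x) (at x)" for x
    unfolding W_def by (auto intro!: derivative_eq_intros)
  have dg: "(g has_real_derivative 1 + 2 * x) (at x)" for x
    unfolding g_def by (auto intro!: derivative_eq_intros)
  have dF: "(F has_real_derivative F1 x) (at x)" if "x \<ge> 1" for x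
    unfolding F_def F1_def using that gp[OF that] Wp[of x]
    by (auto intro!: derivative_eq_intros dW dg simp: power2_eq_square field_simps)
  have x2: "2 * W x = 1 + x\<^sup>2" for x by (simp add: W_def)
  have dF1: "(F1 has_real_derivative F2 x) (at x)" if "x \<ge> 1" for x
  proof -
    have D: "(F1 has_real_derivative (72 / 25 * ln (W x) + 72 / 25 * x * (x / W x)) - (4 * ln x + 4)
        - (6 * (g x)\<^sup>2 - 3 * (2 * x + 1) * (2 * g x * (1 + 2 * x))) / ((g x)\<^sup>2 * (g x)\<^sup>2)) (at x)"
      unfolding F1_def using that gp[OF that] Wp[of x]
      by (auto intro!: derivative_eq_intros dW dg) (simp add: field_simps)
    moreover have "72 / 25 * x * (x / W x) = 144 / 25 * x\<^sup>2 / (1 + x\<^sup>2)"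
      using Wp[of x] unfolding x2[symmetric] by (simp add: power2_eq_square)
    moreover have "(6 * (g x)\<^sup>2 - 3 * (2 * x + 1) * (2 * g x * (1 + 2 * x))) / ((g x)\<^sup>2 * (g x)\<^sup>2)
        = - (18 * x * (x + 1) / (g x) ^ 3)"
    proof -
      have "6 * (g x)\<^sup>2 - 3 * (2 * x + 1) * (2 * g x * (1 + 2 * x)) = - (18 * x * (x + 1)) * g x"
        by (simp add: g_def power2_eq_square algebra_simps)
      moreover have "(g x)\<^sup>2 * (g x)\<^sup>2 = g x ^ 3 * g x" by (simp add: eval_nat_numeral)
      ultimately show ?thesis using gp[OF that] by simp
    qed
    ultimately have "(72 / 25 * ln (W x) + 72 / 25 * x * (x / W x)) - (4 * ln x + 4)
        - (6 * (g x)\<^sup>2 - 3 * (2 * x + 1) * (2 * g x * (1 + 2 * x))) / ((g x)\<^sup>2 * (g x)\<^sup>2) = F2 x" 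
      unfolding F2_def R1_def by linarith
    with D show ?thesis by (rule DERIV_cong)
  qed
  have R1mono: "R1 2 \<le> R1 x" if "x \<ge> 2" for x
  proof (rule DERIV_nonneg_imp_nondecreasing[OF that])
    fix y :: real assume y: "2 \<le> y" "y \<le> x"
    have q: "0 < 1 + y\<^sup>2" by (simp add: add_pos_nonneg)
    have "(R1 has_real_derivative 72 / 25 * (y / W y)
       + (288 / 25 * y * (1 + y\<^sup>2) - 144 / 25 * y\<^sup>2 * (2 * y)) / ((1 + y\<^sup>2) * (1 + y\<^sup>2)) - 4 / y) (at y)"
      unfolding R1_def using y Wp[of y] q
      by (auto intro!: derivative_eq_intros dW) (simp add: divide_simps, simp add: algebra_simps)
    moreover have "72 / 25 * (y / W y)
       + (288 / 25 * y * (1 + y\<^sup>2) - 144 / 25 * y\<^sup>2 * (2 * y)) / ((1 + y\<^sup>2) * (1 + y\<^sup>2)) - 4 / y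
       = (44 * y ^ 4 + 232 * y\<^sup>2 - 100) / (25 * y * (1 + y\<^sup>2)\<^sup>2)"
      using y q unfolding W_def by (simp add: divide_simps) (simp add: algebra_simps eval_nat_numeral)
    moreover have "0 \<le> (44 * y ^ 4 + 232 * y\<^sup>2 - 100) / (25 * y * (1 + y\<^sup>2)\<^sup>2)"
    proof -
      have "2\<^sup>2 \<le> y\<^sup>2" using y by (intro power_mono) auto
      moreover have "0 \<le> y ^ 4" using y by simp
      ultimately have "0 \<le> 44 * y ^ 4 + 232 * y\<^sup>2 - 100" by (simp only: power2_eq_square)
      thus ?thesis using y by simp
    qed
    ultimately show "\<exists>d. (R1 has_real_derivative d) (at y) \<and> 0 \<le> d" by metis
  qed
  \<comment> \<open>\<open>W\<close> is tangent to the identity at 1. Comparing the two leaves a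
    single multiple of ln x, which can then be bounded on its own.\<close>
  have lnW: "ln (W x) \<ge> ln x + (x - 1)\<^sup>2 / (1 + x\<^sup>2)" if "x \<ge> 1" for x
  proof -
    have "ln (x / W x) \<le> x / W x - 1" using that Wp[of x] by (intro ln_le_minus_one) auto
    moreover have "1 - x / W x = (x - 1)\<^sup>2 / (1 + x\<^sup>2)"
      unfolding x2[symmetric] using Wp[of x] 
      by (simp add: divide_simps) (simp add: W_def power2_eq_square algebra_simps)
    ultimately show ?thesis using that Wp[of x] by (simp add: ln_div)
  qed
  have F2: "0 \<le> F2 x" if "x \<ge> 1" for x
  proof (cases "x \<le> 2")
    case True
    have "72 / 25 * (ln x + (x - 1)\<^sup>2 / (1 + x\<^sup>2)) \<le> 72 / 25 * ln (W x)"
      using lnW[OF that] by simp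
    moreover have "28 / 25 * ln x \<le> 28 / 25 * ((x\<^sup>2 - 1) / (2 * x))"
      using ln_le_diff_div[OF that] by (intro mult_left_mono) auto
    ultimately show ?thesis
      using rational_part_nonneg[OF that True] unfolding F2_def R1_def g_def
        distrib_left by linarith
  next
    case False
    have "ln 2 + 1 / 5 \<le> ln (W 2)" using lnW[of 2] by simp
    hence "0 \<le> R1 2" using ln2_le_25_over_36 unfolding R1_def by simp
    moreover have "0 \<le> 18 * x * (x + 1) / (g x) ^ 3" using that gp[OF that] by simp
    ultimately show ?thesis using R1mono[of x] False unfolding F2_def by simp
  qed
  have F1: "0 \<le> F1 x" if "x \<ge> 1" for x
  proof -
    have "F1 1 \<le> F1 x"
      by (rule DERIV_nonneg_imp_nondecreasing[OF that]) (use dF1 F2 in blast)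
    thus ?thesis by (simp add: F1_def W_def g_def)
  qed
  have "F 1 \<le> F h"
    by (rule DERIV_nonneg_imp_nondecreasing[OF h]) (use dF F1 in blast)
  thus ?thesis by (simp add: F_def W_def g_def w_def)
qed

text \<open>The value 36 / 25 serves the range h > 1. The value 4 / 3 serves -1 < h < 0, where it is
  what completes a square.\<close>

lemma inv_ln2_bounds: "36 / 25 \<le> 1 / ln (2::real)" "4 / 3 \<le> 1 / ln (2::real)" "1 / ln (2::real) > 0"
  using ln2_le_25_over_36 by (auto simp: divide_simps)

text \<open>This controls the second derivative in \<open>single_site_normalized\<close>, with the
  vector (1, t) scaled to the unit vector (c, s). For h centred and normalised the first two terms
  on the right average to 2 s^2 and 0; they absorb the error of bounding the logarithm by a tangent
  line, taken at 1 if h \<le> 1 and at h if h > 1.\<close>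

lemma pointwise_ineq:
  fixes s c h :: real
  assumes s: "0 \<le> s" and c: "0 \<le> c" "c\<^sup>2 + s\<^sup>2 = 1" and x: "0 < c + s * h"
  defines "w \<equiv> (1 + h\<^sup>2) / 2"
  shows "2 * h\<^sup>2 * ln (c + s * h)
           \<le> s\<^sup>2 * (1 + h\<^sup>2) + 2 * s * h + 1 / ln 2 * (2 * (w * ln w - w + 1))"
proof -
  define N where "N = 2 * (w * ln w - w + 1)"
  have w: "w > 0" by (simp add: w_def add_pos_nonneg)
  have N: "N \<ge> 0" using entropy_kernel_nonneg[OF w] by (simp add: N_def)
  \<comment> \<open>Eliminating c in this way makes everything that follows quadratic in s.\<close>
  have "c\<^sup>2 \<le> (1 - s\<^sup>2 / 2)\<^sup>2"
  proof -
    have "(1 - s\<^sup>2 / 2)\<^sup>2 = 1 - s\<^sup>2 + (s\<^sup>2 / 2)\<^sup>2" by (simp add: power2_diff)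
    moreover have "0 \<le> (s\<^sup>2 / 2)\<^sup>2" by simp
    ultimately show ?thesis using c(2) by linarith
  qed
  moreover have "s\<^sup>2 \<le> 1" using c zero_le_power2[of c] by linarith
  ultimately have cs: "c \<le> 1 - s\<^sup>2 / 2" using power2_le_imp_le[of c "1 - s\<^sup>2 / 2"] by simp
  have "2 * h\<^sup>2 * ln (c + s * h) \<le> s\<^sup>2 * (1 + h\<^sup>2) + 2 * s * h + 1 / ln 2 * N"
  proof (cases "h \<le> 1")
    case True
    have "ln (c + s * h) \<le> s * h - s\<^sup>2 / 2" using ln_le_minus_one[OF x] cs by linarith
    hence "2 * h\<^sup>2 * ln (c + s * h) \<le> 2 * h\<^sup>2 * (s * h - s\<^sup>2 / 2)" by (intro mult_left_mono) auto
    moreover have "0 \<le> s\<^sup>2 * (1 + 2 * h\<^sup>2) + 2 * s * h * (1 - h\<^sup>2) + 1 / ln 2 * N"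
    \<comment> \<open>For h \<le> 1 the term linear in s is harmful only if -1 < h < 0. There 3 h^2
      \<le> 1 + 2 h^2, and the kernel with factor 4 / 3 supplies (1 - h^2)^2 / 3, which completes
      the square.\<close>
    proof (cases "0 \<le> h * (1 - h\<^sup>2)")
      case True
      hence "0 \<le> 2 * (s * (h * (1 - h\<^sup>2)))" using s by simp
      moreover have "0 \<le> s\<^sup>2 * (1 + 2 * h\<^sup>2)" by simp
      moreover have "0 \<le> 1 / ln 2 * N"
        by (rule mult_nonneg_nonneg[OF less_imp_le[OF inv_ln2_bounds(3)] N])
      ultimately show ?thesis unfolding mult.assoc by (intro add_nonneg_nonneg)
    next
      case False
      have h: "h < 0"
      proof (rule ccontr)
        assume "\<not> h < 0"
        hence "0 \<le> h" "h\<^sup>2 \<le> 1" using \<open>h \<le> 1\<close> by (auto intro: power_le_one)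
        thus False using False by simp
      qed
      have "h\<^sup>2 \<le> 1"
      proof (rule ccontr)
        assume "\<not> h\<^sup>2 \<le> 1"
        thus False using False h by (simp add: mult_nonpos_nonpos)
      qed
      note h = h this
      hence "w \<le> 1" by (simp add: w_def)
      hence "(1 - w)\<^sup>2 \<le> N" using entropy_kernel_ge[OF w] by (simp add: N_def)
      hence "4 / 3 * (1 - w)\<^sup>2 \<le> 1 / ln 2 * N" 
        using inv_ln2_bounds by (intro mult_mono) auto
      moreover have "4 / 3 * (1 - w)\<^sup>2 = (1 - h\<^sup>2)\<^sup>2 / 3" by (simp add: w_def power2_eq_square algebra_simps)
      ultimately have 1: "(1 - h\<^sup>2)\<^sup>2 / 3 \<le> 1 / ln 2 * N" by simp
      have 2: "s\<^sup>2 * (3 * h\<^sup>2) \<le> s\<^sup>2 * (1 + 2 * h\<^sup>2)" using h by (intro mult_left_mono) auto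
      have "(3 * (s * h) + b)\<^sup>2 / 3 = s\<^sup>2 * (3 * h\<^sup>2) + 2 * s * h * b + b\<^sup>2 / 3" for b
        by (simp add: power2_sum power_mult_distrib add_divide_distrib)
      from this[of "1 - h\<^sup>2"]
      have "0 \<le> s\<^sup>2 * (3 * h\<^sup>2) + 2 * s * h * (1 - h\<^sup>2) + (1 - h\<^sup>2)\<^sup>2 / 3"
        by (metis divide_nonneg_nonneg zero_le_numeral zero_le_power2)
      thus ?thesis using 1 2 by linarith
    qed
    ultimately show ?thesis by (simp add: power2_eq_square algebra_simps)
  next
    case False
    hence h: "h > 1" by simp
    have "ln ((c + s * h) / h) \<le> (c + s * h) / h - 1" using x h by (intro ln_le_minus_one) auto
    hence "ln (c + s * h) \<le> (c + s * h) / h - 1 + ln h" using x h by (simp add: ln_div)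
    also have "\<dots> \<le> (1 - s\<^sup>2 / 2 + s * h) / h - 1 + ln h" using cs h by (simp add: divide_right_mono)
    finally have le: "2 * h\<^sup>2 * ln (c + s * h) \<le> 2 * h\<^sup>2 * ((1 - s\<^sup>2 / 2 + s * h) / h - 1 + ln h)" 
      by (intro mult_left_mono) auto
    have eq: "2 * h\<^sup>2 * (z / h - 1 + ln h) = 2 * h * z - 2 * h\<^sup>2 + 2 * h\<^sup>2 * ln h" for z
      using h by (simp add: power2_eq_square algebra_simps)
    note le
    also note eq[of "1 - s\<^sup>2 / 2 + s * h"]
    finally have 1: "2 * h\<^sup>2 * ln (c + s * h) \<le> 2 * h * (1 - s\<^sup>2 / 2 + s * h) - 2 * h\<^sup>2 + 2 * h\<^sup>2 * ln h" .
    let ?P = "1 + h + h\<^sup>2"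
    have P: "?P > 0" using h by (simp add: add_pos_nonneg)
    \<comment> \<open>The claim is a quadratic in s with leading coefficient \<open>?P\<close> and
      linear coefficient -2 h (h - 1). Completing the square leaves the condition on h alone that
      \<open>one_dim_ineq\<close> supplies.\<close>
    have "0 \<le> (s * ?P - h * (h - 1))\<^sup>2 / ?P" using P by simp
    also have "\<dots> = s\<^sup>2 * ?P - 2 * s * (h * (h - 1)) + (h * (h - 1))\<^sup>2 / ?P"
      using P by (simp add: field_simps power2_eq_square)
    also have "(h * (h - 1))\<^sup>2 / ?P = h\<^sup>2 - 3 * h + 3 - 3 / ?P"
      using P by (simp add: field_simps) (simp add: algebra_simps eval_nat_numeral)
    also have "\<dots> \<le> 36 / 25 * N + 2 * h\<^sup>2 - 2 * h - 2 * h\<^sup>2 * ln h"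
      using one_dim_ineq[of h] h by (simp add: w_def N_def)
    also have "36 / 25 * N \<le> 1 / ln 2 * N" using N inv_ln2_bounds by (intro mult_right_mono) auto
    finally show ?thesis using 1 by (simp add: power2_eq_square algebra_simps)
  qed
  thus ?thesis by (simp only: N_def)
qed


section \<open>A weighted single-site log-Sobolev inequality\<close>

text \<open>At 0 the convention \<open>ln 0 = 0\<close> agrees with the limit. The point 0 is
  reached when the function on the single site has a zero.\<close>

lemma continuous_on_sq_ln_sq: "continuous_on {0..} (\<lambda>x::real. x\<^sup>2 * ln (x\<^sup>2))"
unfolding continuous_on_eq_continuous_within
proof
  fix x :: real assume x: "x \<in> {0..}"
  show "continuous (at x within {0..}) (\<lambda>x::real. x\<^sup>2 * ln (x\<^sup>2))"
  proof (cases "x = 0")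
    case True
    have "((\<lambda>x::real. x\<^sup>2 * ln (x\<^sup>2)) \<longlongrightarrow> 0) (at_right 0)" by real_asymp
    hence "((\<lambda>x::real. x\<^sup>2 * ln (x\<^sup>2)) \<longlongrightarrow> 0) (at 0 within {0..})"
      by (simp only: at_within_Ici_at_right)
    thus ?thesis unfolding True continuous_within by simp
  next
    case False
    hence "x > 0" using x by simp
    hence "((\<lambda>x::real. x\<^sup>2 * ln (x\<^sup>2)) has_real_derivative 2 * x * ln (x\<^sup>2) + 2 * x) (at x)"
      by (auto intro!: derivative_eq_intros simp: power2_eq_square)
    hence "isCont (\<lambda>x::real. x\<^sup>2 * ln (x\<^sup>2)) x" by (rule DERIV_isCont)
    thus ?thesis by (rule continuous_at_imp_continuous_within)
  qed
qed

text \<open>Derivatives are required on [0, t) only: in the application some factor 1 + t * h a may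
  vanish at the right end, where continuity is all that remains.\<close>

lemma nonpos_by_second_deriv:
  fixes f f1 f2 :: "real \<Rightarrow> real"
  assumes t: "0 \<le> t" and cont: "continuous_on {0..t} f"
    and d1: "\<And>x. 0 \<le> x \<Longrightarrow> x < t \<Longrightarrow> (f has_real_derivative f1 x) (at x)"
    and d2: "\<And>x. 0 \<le> x \<Longrightarrow> x < t \<Longrightarrow> (f1 has_real_derivative f2 x) (at x)"
    and "f 0 = 0" "f1 0 = 0" and f2: "\<And>x. 0 \<le> x \<Longrightarrow> x < t \<Longrightarrow> f2 x \<le> 0"
  shows "f t \<le> 0"
proof -
  have f1: "f1 x \<le> 0" if "0 \<le> x" "x < t" for x
  proof -
    have "f1 x \<le> f1 0"
    proof (rule DERIV_nonpos_imp_nonincreasing[OF that(1)])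
      fix y assume "0 \<le> y" "y \<le> x"
      with that have "0 \<le> y" "y < t" by auto
      thus "\<exists>d. (f1 has_real_derivative d) (at y) \<and> d \<le> 0" using d2 f2 by blast
    qed
    thus ?thesis using assms by simp
  qed
  have "f t \<le> f 0"
  proof (rule DERIV_nonpos_imp_decreasing_open[OF t _ cont])
    fix x assume "0 < x" "x < t"
    thus "\<exists>y. (f has_real_derivative y) (at x) \<and> y \<le> 0" using d1 f1 less_imp_le by blast
  qed
  thus ?thesis using assms by simp
qed

lemma single_site_normalized:
  fixes p h :: "'a \<Rightarrow> real"
  assumes fin: "finite A" and p: "\<And>a. a \<in> A \<Longrightarrow> 0 < p a" and p1: "(\<Sum>a\<in>A. p a) = 1"
    and h0: "(\<Sum>a\<in>A. p a * h a) = 0" and h1: "(\<Sum>a\<in>A. p a * (h a)\<^sup>2) = 1"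
    and t: "0 \<le> t" and pos: "\<And>a. a \<in> A \<Longrightarrow> 0 \<le> 1 + t * h a"
  shows "(\<Sum>a\<in>A. p a * ((1 + t * h a)\<^sup>2 * ln ((1 + t * h a)\<^sup>2))) - (1 + t\<^sup>2) * ln (1 + t\<^sup>2)
           \<le> t\<^sup>2 * (1 / ln 2 * (\<Sum>a\<in>A. p a * ((1 + (h a)\<^sup>2) * ln (1 / p a))))"
proof -
  define K where "K = 1 / ln 2 * (\<Sum>a\<in>A. p a * ((1 + (h a)\<^sup>2) * ln (1 / p a)))"
  define w where "w a = (1 + (h a)\<^sup>2) / 2" for a
  define N where "N a = 2 * (w a * ln (w a) - w a + 1)" for a
  \<comment> \<open>At t = 0 the second derivative alone forces \<open>2 \<le> K\<close>. The
    surplus in \<open>N\<close> is what pays for t > 0.\<close>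
  have K: "2 + 1 / ln 2 * (\<Sum>a\<in>A. p a * N a) \<le> K"
  proof -
    have pa: "p a * (1 + (h a)\<^sup>2) \<le> 1" if a: "a \<in> A" for a
    proof -
      let ?B = "A - {a}"
      have split: "(\<Sum>b\<in>A. u b) = u a + (\<Sum>b\<in>?B. u b)" for u :: "'a \<Rightarrow> real"
        using fin a by (rule sum.remove)
      \<comment> \<open>By centring, the points other than a contribute -p a * h a to the mean.
        Cauchy-Schwarz on these points bounds its square by their mass times their share of the
        second moment.\<close>
      have "(\<Sum>b\<in>?B. sqrt (p b) * (sqrt (p b) * h b))\<^sup>2
          \<le> (\<Sum>b\<in>?B. (sqrt (p b))\<^sup>2) * (\<Sum>b\<in>?B. (sqrt (p b) * h b)\<^sup>2)"
        by (rule Cauchy_Schwarz_ineq_sum)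
      moreover have "(\<Sum>b\<in>?B. sqrt (p b) * (sqrt (p b) * h b)) = (\<Sum>b\<in>?B. p b * h b)"
        by (intro sum.cong refl) (use p in \<open>force simp flip: mult.assoc intro: less_imp_le\<close>)
      moreover have "(\<Sum>b\<in>?B. (sqrt (p b))\<^sup>2) = (\<Sum>b\<in>?B. p b)"
        by (intro sum.cong refl) (use p in \<open>force intro: less_imp_le\<close>)
      moreover have "(\<Sum>b\<in>?B. (sqrt (p b) * h b)\<^sup>2) = (\<Sum>b\<in>?B. p b * (h b)\<^sup>2)"
        by (intro sum.cong refl) (use p in \<open>force simp: power_mult_distrib intro: less_imp_le\<close>)
      moreover have "(\<Sum>b\<in>?B. p b * h b) = - (p a * h a)" using h0 split[of "\<lambda>b. p b * h b"] by simp
      moreover have "(\<Sum>b\<in>?B. p b) = 1 - p a" using p1 split[of p] by simp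
      moreover have "(\<Sum>b\<in>?B. p b * (h b)\<^sup>2) = 1 - p a * (h a)\<^sup>2"
        using h1 split[of "\<lambda>b. p b * (h b)\<^sup>2"] by simp
      ultimately have "(p a * h a)\<^sup>2 \<le> (1 - p a) * (1 - p a * (h a)\<^sup>2)" by simp
      thus ?thesis by (simp add: power2_eq_square algebra_simps)
    qed
    have "p a * ((1 + (h a)\<^sup>2) * ln (1 + (h a)\<^sup>2)) \<le> p a * ((1 + (h a)\<^sup>2) * ln (1 / p a))" if a: "a \<in> A" for a
    proof -
      have "1 + (h a)\<^sup>2 \<le> 1 / p a" using pa[OF a] p[OF a] by (simp add: field_simps)
      moreover have "0 < 1 + (h a)\<^sup>2" by (simp add: add_pos_nonneg)
      ultimately have "ln (1 + (h a)\<^sup>2) \<le> ln (1 / p a)" using p[OF a] by (subst ln_le_cancel_iff) auto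
      thus ?thesis using p[OF a] by (intro mult_left_mono) auto
    qed
    hence "(\<Sum>a\<in>A. p a * ((1 + (h a)\<^sup>2) * ln (1 + (h a)\<^sup>2))) \<le> ln 2 * K"
      by (simp add: K_def sum_mono)
    \<comment> \<open>Since \<open>w\<close> has mean 1, subtracting from \<open>w * ln w\<close>
      its tangent at 1 does not change the average. The factor 2 in 1 + h^2 = 2 w produces the
      additional 2 ln 2.\<close>
    also have "(\<Sum>a\<in>A. p a * ((1 + (h a)\<^sup>2) * ln (1 + (h a)\<^sup>2)))
       = (\<Sum>a\<in>A. p a * N a + (1 + ln 2) * (p a + p a * (h a)\<^sup>2) - 2 * p a)"
    proof (intro sum.cong refl)
      fix a
      have "0 < 1 + (h a)\<^sup>2" by (simp add: add_pos_nonneg)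
      hence "ln (w a) = ln (1 + (h a)\<^sup>2) - ln 2" unfolding w_def by (simp add: ln_div)
      moreover have "N a = (1 + (h a)\<^sup>2) * ln (w a) - (1 + (h a)\<^sup>2) + 2" 
        unfolding N_def w_def by (simp add: field_simps)
      ultimately have NE: "N a = (1 + (h a)\<^sup>2) * (ln (1 + (h a)\<^sup>2) - ln 2) - (1 + (h a)\<^sup>2) + 2" by simp
      show "p a * ((1 + (h a)\<^sup>2) * ln (1 + (h a)\<^sup>2)) = p a * N a + (1 + ln 2) * (p a + p a * (h a)\<^sup>2) - 2 * p a"
        unfolding NE by (simp add: algebra_simps)
    qed
    also have "\<dots> = (\<Sum>a\<in>A. p a * N a) + 2 * ln 2"
      using p1 h1 by (simp add: sum.distrib sum_subtractf flip: sum_distrib_left)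
    finally show ?thesis by (simp add: field_simps)
  qed
  define G where "G x = (\<Sum>a\<in>A. p a * ((1 + x * h a)\<^sup>2 * ln ((1 + x * h a)\<^sup>2)))
    - (1 + x\<^sup>2) * ln (1 + x\<^sup>2) - K * x\<^sup>2" for x
  define G1 where "G1 x = (\<Sum>a\<in>A. p a * (h a * (2 * (1 + x * h a) * ln ((1 + x * h a)\<^sup>2) + 2 * (1 + x * h a))))
    - 2 * x * ln (1 + x\<^sup>2) - 2 * x - 2 * K * x" for x
  define G2 where "G2 x = (\<Sum>a\<in>A. p a * ((h a)\<^sup>2 * (2 * ln ((1 + x * h a)\<^sup>2) + 6)))
    - 2 * ln (1 + x\<^sup>2) - 4 * x\<^sup>2 / (1 + x\<^sup>2) - 2 - 2 * K" for x
  have sp: "0 < 1 + x * h a" if "0 \<le> x" "x < t" "a \<in> A" for x a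
  proof (cases "h a \<ge> 0")
    case True
    thus ?thesis using that by (simp add: add_pos_nonneg)
  next
    case False
    hence "t * h a < x * h a" using that by (simp add: mult_strict_right_mono_neg)
    thus ?thesis using pos[OF that(3)] by simp
  qed
  have q: "0 < 1 + x\<^sup>2" for x :: real by (simp add: add_pos_nonneg)
  have h02: "(\<Sum>a\<in>A. p a * (h a * 2)) = 0"
    using h0 by (simp add: mult.assoc[symmetric] flip: sum_distrib_right)
  have "G t \<le> 0"
  proof (rule nonpos_by_second_deriv[OF t])
    have c1: "continuous_on {0..t} (\<lambda>x. (1 + x * h a)\<^sup>2 * ln ((1 + x * h a)\<^sup>2))" if "a \<in> A" for a
    proof -
      have cont: "continuous_on {0..t} (\<lambda>x. 1 + x * h a)" by (intro continuous_intros)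
      have "(\<lambda>x. 1 + x * h a) ` {0..t} \<subseteq> {0..}"
      proof safe
        fix x assume x: "x \<in> {0..t}"
        show "1 + x * h a \<ge> 0" using sp[of x a] pos[OF that] x that by (cases "x < t") (auto simp: less_imp_le)
      qed
      from continuous_on_compose2[OF continuous_on_sq_ln_sq cont this] show ?thesis .
    qed
    have c2: "continuous_on {0..t} (\<lambda>x. (1 + x\<^sup>2) * ln (1 + x\<^sup>2))"
      by (intro continuous_intros) (simp add: less_imp_neq[OF q, symmetric])
    have c3: "continuous_on {0..t} (\<lambda>x. K * x\<^sup>2)" by (intro continuous_intros)
    show "continuous_on {0..t} G" unfolding G_def
      by (intro continuous_on_diff[OF continuous_on_diff[OF continuous_on_sum c2] c3]
            continuous_on_mult_left c1)
  next
    fix x assume x: "0 \<le> x" "x < t"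
    note [simp] = q[of x] less_imp_neq[OF q[of x], symmetric]
    have "((\<lambda>x. p a * ((1 + x * h a)\<^sup>2 * ln ((1 + x * h a)\<^sup>2))) has_real_derivative
       p a * (h a * (2 * (1 + x * h a) * ln ((1 + x * h a)\<^sup>2) + 2 * (1 + x * h a)))) (at x)" if "a \<in> A" for a
      using sp[OF x that]
      by (auto intro!: derivative_eq_intros simp: power2_eq_square) (simp add: algebra_simps)
    moreover have "((\<lambda>x. (1 + x\<^sup>2) * ln (1 + x\<^sup>2)) has_real_derivative 2 * x * ln (1 + x\<^sup>2) + 2 * x) (at x)"
      by (auto intro!: derivative_eq_intros)
    moreover have "((\<lambda>x. K * x\<^sup>2) has_real_derivative 2 * K * x) (at x)"
      by (auto intro!: derivative_eq_intros)
    ultimately show "(G has_real_derivative G1 x) (at x)" unfolding G_def G1_def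
      by (intro DERIV_cong[OF DERIV_diff[OF DERIV_diff[OF DERIV_sum]]]) auto
    have "((\<lambda>x. p a * (h a * (2 * (1 + x * h a) * ln ((1 + x * h a)\<^sup>2) + 2 * (1 + x * h a)))) has_real_derivative
       p a * ((h a)\<^sup>2 * (2 * ln ((1 + x * h a)\<^sup>2) + 6))) (at x)" if "a \<in> A" for a
    proof -
      have "((\<lambda>y. 2 * y * ln (y\<^sup>2) + 2 * y) has_real_derivative 2 * ln (y\<^sup>2) + 6) (at y)" if "y > 0" for y :: real
        using that by (auto intro!: derivative_eq_intros simp: power2_eq_square)
      moreover have "((\<lambda>x. 1 + x * h a) has_real_derivative h a) (at x)"
        by (auto intro!: derivative_eq_intros)
      ultimately have "((\<lambda>x. p a * (h a * (2 * (1 + x * h a) * ln ((1 + x * h a)\<^sup>2) + 2 * (1 + x * h a)))) has_real_derivative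
          p a * (h a * ((2 * ln ((1 + x * h a)\<^sup>2) + 6) * h a))) (at x)"
        using sp[OF x that] by (intro DERIV_cmult DERIV_chain2[where g = "\<lambda>x. 1 + x * h a"])
      thus ?thesis by (simp add: power2_eq_square mult_ac)
    qed
    moreover have "((\<lambda>x. 2 * x * ln (1 + x\<^sup>2)) has_real_derivative
        2 * ln (1 + x\<^sup>2) + 4 * x\<^sup>2 / (1 + x\<^sup>2)) (at x)"
      using q[of x] unfolding power2_eq_square by (auto intro!: derivative_eq_intros)
    moreover have "((\<lambda>x. 2 * x) has_real_derivative 2) (at x)" "((\<lambda>x. 2 * K * x) has_real_derivative 2 * K) (at x)"
      by (auto intro!: derivative_eq_intros)
    ultimately show "(G1 has_real_derivative G2 x) (at x)" unfolding G1_def G2_def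
      by (intro DERIV_cong[OF DERIV_diff[OF DERIV_diff[OF DERIV_diff[OF DERIV_sum]]]]) auto
    \<comment> \<open>Scaling to the unit circle splits off ln (1 + x^2), which cancels because h^2
      has mean 1. The fraction in \<open>G2\<close> is 4 s^2 and cancels against the average of the
      first term of \<open>pointwise_ineq\<close>.\<close>
    define s c where "s = x / sqrt (1 + x\<^sup>2)" and "c = 1 / sqrt (1 + x\<^sup>2)"
    have sc: "s \<ge> 0" "c \<ge> 0" "c\<^sup>2 + s\<^sup>2 = 1" using x
      by (auto simp: s_def c_def power_divide add_divide_distrib[symmetric])
    have s2: "s\<^sup>2 = x\<^sup>2 / (1 + x\<^sup>2)" by (simp add: s_def power_divide)
    have "p a * ((h a)\<^sup>2 * (2 * ln ((1 + x * h a)\<^sup>2) + 6))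
        \<le> 2 * s\<^sup>2 * (p a + p a * (h a)\<^sup>2) + 4 * s * (p a * h a) + 2 * (1 / ln 2) * (p a * N a)
          + 2 * ln (1 + x\<^sup>2) * (p a * (h a)\<^sup>2) + 6 * (p a * (h a)\<^sup>2)" if a: "a \<in> A" for a
    proof -
      have e: "c + s * h a = (1 + x * h a) / sqrt (1 + x\<^sup>2)" by (simp add: s_def c_def add_divide_distrib)
      hence cs: "0 < c + s * h a" using sp[OF x a] by simp
      have "ln (c + s * h a) = ln (1 + x * h a) - ln (1 + x\<^sup>2) / 2"
        unfolding e using sp[OF x a] by (simp add: ln_div ln_sqrt)
      moreover have "ln ((1 + x * h a)\<^sup>2) = 2 * ln (1 + x * h a)" using sp[OF x a] by (simp add: ln_realpow)
      ultimately have l: "2 * ln ((1 + x * h a)\<^sup>2) = 4 * ln (c + s * h a) + 2 * ln (1 + x\<^sup>2)" by simp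
      have "2 * (h a)\<^sup>2 * ln (c + s * h a) \<le> s\<^sup>2 * (1 + (h a)\<^sup>2) + 2 * s * h a + 1 / ln 2 * N a"
        using pointwise_ineq[OF sc cs] by (simp add: N_def w_def)
      hence "p a * (2 * (2 * (h a)\<^sup>2 * ln (c + s * h a)))
          \<le> p a * (2 * (s\<^sup>2 * (1 + (h a)\<^sup>2) + 2 * s * h a + 1 / ln 2 * N a))"
        using p[OF a] by (intro mult_left_mono) auto
      thus ?thesis unfolding l by (simp add: algebra_simps)
    qed
    hence "(\<Sum>a\<in>A. p a * ((h a)\<^sup>2 * (2 * ln ((1 + x * h a)\<^sup>2) + 6)))
      \<le> (\<Sum>a\<in>A. 2 * s\<^sup>2 * (p a + p a * (h a)\<^sup>2) + 4 * s * (p a * h a) + 2 * (1 / ln 2) * (p a * N a)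
          + 2 * ln (1 + x\<^sup>2) * (p a * (h a)\<^sup>2) + 6 * (p a * (h a)\<^sup>2))"
      by (rule sum_mono)
    also have "\<dots> = 4 * s\<^sup>2 + 2 * (1 / ln 2 * (\<Sum>a\<in>A. p a * N a)) + 2 * ln (1 + x\<^sup>2) + 6"
      using p1 h0 h1 by (simp add: sum.distrib flip: sum_distrib_left sum_divide_distrib)
    finally have "G2 x \<le> 4 * s\<^sup>2 + 2 * (1 / ln 2 * (\<Sum>a\<in>A. p a * N a)) + 4 - 4 * x\<^sup>2 / (1 + x\<^sup>2) - 2 * K"
      unfolding G2_def by linarith
    also have "\<dots> = 2 * (2 + 1 / ln 2 * (\<Sum>a\<in>A. p a * N a)) - 2 * K" unfolding s2 by simp
    finally have G2: "G2 x \<le> 2 * (2 + 1 / ln 2 * (\<Sum>a\<in>A. p a * N a)) - 2 * K" .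
    define Q where "Q = 1 / ln 2 * (\<Sum>a\<in>A. p a * N a)"
    have "2 * (2 + Q) - 2 * K \<le> 0" using K[folded Q_def] by simp
    with G2[folded Q_def] show "G2 x \<le> 0" by (rule order_trans)
  qed (simp_all add: G_def G1_def h02)
  thus ?thesis unfolding G_def K_def by (simp add: mult.commute)
qed

text \<open>By homogeneity one may write f = m (1 + t h), with m the mean and t the standard
  deviation divided by m. Averaging (f a - f b)^2 over b gives v (1 + h(a)^2), the factor of the
  normalised form. Symmetrising ln (1 / p a) in a and b accounts for the 2 in 1 / (2 ln 2).\<close>

lemma single_site_log_sobolev:
  fixes p f :: "'a \<Rightarrow> real"
  assumes fin: "finite A" and p: "\<And>a. a \<in> A \<Longrightarrow> 0 < p a" and p1: "(\<Sum>a\<in>A. p a) = 1"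
    and f: "\<And>a. a \<in> A \<Longrightarrow> 0 \<le> f a"
  defines "M \<equiv> \<Sum>a\<in>A. p a * (f a)\<^sup>2"
  shows "(\<Sum>a\<in>A. p a * ((f a)\<^sup>2 * ln ((f a)\<^sup>2))) - M * ln M
           \<le> 1 / (2 * ln 2) * (\<Sum>a\<in>A. \<Sum>b\<in>A. p a * p b * ln (1 / (p a * p b)) * (f a - f b)\<^sup>2)"
proof -
  define m v where "m = (\<Sum>a\<in>A. p a * f a)" and "v = (\<Sum>a\<in>A. p a * (f a - m)\<^sup>2)"
  have v_ge: "v \<ge> 0" unfolding v_def by (intro sum_nonneg mult_nonneg_nonneg) (auto simp: p less_imp_le)
  have cent: "(\<Sum>a\<in>A. p a * (f a - m)) = 0"
    using p1 by (simp add: m_def right_diff_distrib sum_subtractf flip: sum_distrib_right)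
  have Mv: "M = m\<^sup>2 + v"
  proof -
    have "v = (\<Sum>a\<in>A. p a * (f a)\<^sup>2 - 2 * m * (p a * f a) + m\<^sup>2 * p a)"
      unfolding v_def by (intro sum.cong refl) (simp add: power2_eq_square algebra_simps)
    also have "\<dots> = M - 2 * m * m + m\<^sup>2"
      by (simp add: sum.distrib sum_subtractf M_def p1 m_def[symmetric] flip: sum_distrib_left)
    finally show ?thesis by (simp add: power2_eq_square)
  qed
  have p_le: "p a \<le> 1" if "a \<in> A" for a
    using member_le_sum[of a A p] fin p p1 that by (auto simp: less_imp_le)
  have ln_nonneg: "ln (1 / (p a * p b)) \<ge> 0" if "a \<in> A" "b \<in> A" for a b
  proof -
    have "p a * p b \<le> 1" using p_le that p by (intro mult_le_one) (auto simp: less_imp_le)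
    thus ?thesis using p that by (intro ln_ge_zero) (simp add: field_simps)
  qed
  let ?rhs = "1 / (2 * ln 2) * (\<Sum>a\<in>A. \<Sum>b\<in>A. p a * p b * ln (1 / (p a * p b)) * (f a - f b)\<^sup>2)"
  have rhs_nonneg: "?rhs \<ge> 0"
    using ln_nonneg p by (intro mult_nonneg_nonneg sum_nonneg) (auto simp: less_imp_le)
  show ?thesis
  proof (cases "v = 0")
    case True
    hence "p a * (f a - m)\<^sup>2 = 0" if "a \<in> A" for a
      using that sum_nonneg_eq_0_iff[OF fin, of "\<lambda>a. p a * (f a - m)\<^sup>2"] p unfolding v_def
      by (force simp: less_imp_le)
    hence fm: "f a = m" if "a \<in> A" for a using that p[OF that] by force
    have "(\<Sum>a\<in>A. p a * ((f a)\<^sup>2 * ln ((f a)\<^sup>2))) = (\<Sum>a\<in>A. p a * (m\<^sup>2 * ln (m\<^sup>2)))"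
      by (intro sum.cong refl) (simp add: fm)
    also have "\<dots> = M * ln M" using True p1 by (simp add: Mv flip: sum_distrib_right)
    finally show ?thesis using rhs_nonneg by simp
  next
    case False
    hence v: "v > 0" using v_ge by simp
    have m: "m > 0"
    proof (rule ccontr)
      assume "\<not> m > 0"
      moreover have "m \<ge> 0" unfolding m_def using p f by (intro sum_nonneg mult_nonneg_nonneg) (auto simp: less_imp_le)
      ultimately have "m = 0" by simp
      hence "p a * f a = 0" if "a \<in> A" for a
        using that sum_nonneg_eq_0_iff[OF fin, of "\<lambda>a. p a * f a"] p f unfolding m_def
        by (force simp: less_imp_le)
      hence "f a = 0" if "a \<in> A" for a using that p[OF that] by force
      thus False using v \<open>m = 0\<close> unfolding v_def by simp
    qed
    define r where "r = sqrt v"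
    have r: "r > 0" "r\<^sup>2 = v" using v by (auto simp: r_def)
    define h where "h a = (f a - m) / r" for a
    define t where "t = r / m"
    have t: "t > 0" using r m by (simp add: t_def)
    have fh: "f a = m * (1 + t * h a)" for a using m r by (simp add: t_def h_def field_simps)
    have h0: "(\<Sum>a\<in>A. p a * h a) = 0"
      using cent by (simp add: h_def flip: sum_divide_distrib)
    have h1: "(\<Sum>a\<in>A. p a * (h a)\<^sup>2) = 1"
      using v r by (simp add: h_def power_divide v_def flip: sum_divide_distrib)
    have pos: "0 \<le> 1 + t * h a" if "a \<in> A" for a
      using f[OF that] m by (simp add: fh zero_le_mult_iff)
    have tM: "M = m\<^sup>2 * (1 + t\<^sup>2)" using m r by (simp add: Mv t_def power_divide algebra_simps)
    have t1: "1 + t\<^sup>2 > 0" by (simp add: add_pos_nonneg)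
    define S where "S = (\<Sum>a\<in>A. p a * ((1 + t * h a)\<^sup>2 * ln ((1 + t * h a)\<^sup>2)))"
    have "(\<Sum>a\<in>A. p a * ((f a)\<^sup>2 * ln ((f a)\<^sup>2)))
        = (\<Sum>a\<in>A. m\<^sup>2 * (p a * ((1 + t * h a)\<^sup>2 * ln ((1 + t * h a)\<^sup>2))) + ln (m\<^sup>2) * (p a * (f a)\<^sup>2))"
    proof (intro sum.cong refl)
      fix a assume "a \<in> A"
      show "p a * ((f a)\<^sup>2 * ln ((f a)\<^sup>2))
          = m\<^sup>2 * (p a * ((1 + t * h a)\<^sup>2 * ln ((1 + t * h a)\<^sup>2))) + ln (m\<^sup>2) * (p a * (f a)\<^sup>2)"
      proof (cases "1 + t * h a = 0")
        case True
        thus ?thesis by (simp add: fh)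
      next
        case False
        hence "ln ((f a)\<^sup>2) = ln (m\<^sup>2) + ln ((1 + t * h a)\<^sup>2)"
          using m by (simp add: fh power_mult_distrib ln_mult)
        moreover have "(f a)\<^sup>2 = m\<^sup>2 * (1 + t * h a)\<^sup>2" by (simp add: fh power_mult_distrib)
        ultimately show ?thesis by (simp add: algebra_simps)
      qed
    qed
    also have "\<dots> = m\<^sup>2 * S + ln (m\<^sup>2) * M"
      by (simp add: sum.distrib S_def M_def flip: sum_distrib_left)
    also have "ln (m\<^sup>2) * M = M * ln M - m\<^sup>2 * ((1 + t\<^sup>2) * ln (1 + t\<^sup>2))"
    proof -
      have "ln M = ln (m\<^sup>2) + ln (1 + t\<^sup>2)" unfolding tM using m t1 by (simp add: ln_mult)
      thus ?thesis by (simp add: tM algebra_simps)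
    qed
    finally have "(\<Sum>a\<in>A. p a * ((f a)\<^sup>2 * ln ((f a)\<^sup>2))) - M * ln M = m\<^sup>2 * (S - (1 + t\<^sup>2) * ln (1 + t\<^sup>2))"
      by (simp add: algebra_simps)
    also have "\<dots> \<le> m\<^sup>2 * (t\<^sup>2 * (1 / ln 2 * (\<Sum>a\<in>A. p a * ((1 + (h a)\<^sup>2) * ln (1 / p a)))))"
      unfolding S_def using t
      by (intro mult_left_mono single_site_normalized fin p p1 h0 h1 pos) auto
    also have "\<dots> = 1 / ln 2 * (v * (\<Sum>a\<in>A. p a * ((1 + (h a)\<^sup>2) * ln (1 / p a))))"
      using m r by (simp add: t_def power_divide)
    also have "v * (\<Sum>a\<in>A. p a * ((1 + (h a)\<^sup>2) * ln (1 / p a)))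
        = (\<Sum>a\<in>A. \<Sum>b\<in>A. p a * p b * ln (1 / p a) * (f a - f b)\<^sup>2)"
    proof -
      have "(\<Sum>b\<in>A. p a * p b * ln (1 / p a) * (f a - f b)\<^sup>2) = v * (p a * ((1 + (h a)\<^sup>2) * ln (1 / p a)))"
        if "a \<in> A" for a
      proof -
        have "(\<Sum>b\<in>A. p b * (f a - f b)\<^sup>2)
          = (\<Sum>b\<in>A. (f a - m)\<^sup>2 * p b - 2 * (f a - m) * (p b * (f b - m)) + p b * (f b - m)\<^sup>2)"
          by (intro sum.cong refl) (simp add: power2_eq_square algebra_simps)
        also have "\<dots> = (f a - m)\<^sup>2 + v"
          using p1 cent by (simp add: sum.distrib sum_subtractf v_def flip: sum_distrib_left)
        also have "\<dots> = v * (1 + (h a)\<^sup>2)"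
          using r v by (simp add: h_def power_divide algebra_simps)
        finally have "(\<Sum>b\<in>A. p b * (f a - f b)\<^sup>2) = v * (1 + (h a)\<^sup>2)" .
        moreover have "(\<Sum>b\<in>A. p a * p b * ln (1 / p a) * (f a - f b)\<^sup>2)
          = p a * ln (1 / p a) * (\<Sum>b\<in>A. p b * (f a - f b)\<^sup>2)"
          unfolding sum_distrib_left by (intro sum.cong refl) (simp only: mult_ac)
        ultimately show ?thesis by (simp only: mult_ac)
      qed
      thus ?thesis by (simp add: sum_distrib_left)
    qed
    finally have le: "(\<Sum>a\<in>A. p a * ((f a)\<^sup>2 * ln ((f a)\<^sup>2))) - M * ln M
        \<le> 1 / ln 2 * (\<Sum>a\<in>A. \<Sum>b\<in>A. p a * p b * ln (1 / p a) * (f a - f b)\<^sup>2)" .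
    have "(\<Sum>a\<in>A. \<Sum>b\<in>A. p a * p b * ln (1 / (p a * p b)) * (f a - f b)\<^sup>2)
        = (\<Sum>a\<in>A. \<Sum>b\<in>A. p a * p b * ln (1 / p a) * (f a - f b)\<^sup>2
             + p b * p a * ln (1 / p b) * (f b - f a)\<^sup>2)"
    proof (intro sum.cong refl)
      fix a b assume "a \<in> A" "b \<in> A"
      hence "ln (1 / (p a * p b)) = ln (1 / p a) + ln (1 / p b)" using p[of a] p[of b] by (simp add: ln_div ln_mult)
      thus "p a * p b * ln (1 / (p a * p b)) * (f a - f b)\<^sup>2 = p a * p b * ln (1 / p a) * (f a - f b)\<^sup>2
             + p b * p a * ln (1 / p b) * (f b - f a)\<^sup>2"
        by (simp add: power2_commute[of "f b"] algebra_simps)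
    qed
    also have "\<dots> = (\<Sum>a\<in>A. \<Sum>b\<in>A. p a * p b * ln (1 / p a) * (f a - f b)\<^sup>2)
        + (\<Sum>b\<in>A. \<Sum>a\<in>A. p b * p a * ln (1 / p b) * (f b - f a)\<^sup>2)"
      by (subst (2) sum.swap) (simp add: sum.distrib)
    finally show ?thesis using le by simp
  qed
qed


section \<open>Recursion for the logarithmic pair weights\<close>

lemma diff_ln_pred_le:
  fixes k :: nat
  assumes "k \<ge> 1"
  shows "real (k - 1) * (ln (real k) - ln (real (k - 1))) \<le> 1 - 1 / (2 * real k)"
\<comment> \<open>For k = 1 the factor k - 1 removes the default value of ln at 0.\<close>
proof (cases "k = 1")
  case False
  define x where "x = real (k - 1)"
  have x: "x \<ge> 1" "real k = x + 1" using assms False by (auto simp: x_def)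
  have "ln ((x + 1) / x) \<le> (((x + 1) / x)\<^sup>2 - 1) / (2 * ((x + 1) / x))"
    using x by (intro ln_le_diff_div) simp
  also have "\<dots> = (2 * x + 1) / (2 * x * (x + 1))"
    using x by (simp add: divide_simps power2_eq_square) (simp add: algebra_simps)
  finally have "x * ln ((x + 1) / x) \<le> x * ((2 * x + 1) / (2 * x * (x + 1)))" 
    using x by (intro mult_left_mono) auto
  also have "\<dots> = 1 - 1 / (2 * (x + 1))" using x by (simp add: divide_simps)
  finally show ?thesis using x by (simp add: ln_div flip: x_def)
qed auto

text \<open>The left side is the total increase of the weight over the removal of further sites of
  the two colours; the right side is the gain from replacing n by n - 1 plus a slack. Both sides are
  close to 2 when k and l are large, so the corrections of order 1 / k + 1 / l \<ge> 4 / n have to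
  be kept.\<close>

lemma weight_recursion_err:
  fixes n k l :: nat
  assumes n: "n \<ge> 2" and k: "k \<ge> 1" and l: "l \<ge> 1" and kl: "k + l \<le> n"
  shows "real (k - 1) * (ln (real k) - ln (real (k - 1))) + real (l - 1) * (ln (real l) - ln (real (l - 1)))
    \<le> 2 * (real n - 2) * (ln (real n) - ln (real (n - 1))) + (2 * ln (real n) - ln (real k) - ln (real l)) / real n"
    (is "?u k + ?u l \<le> _")
proof -
  define W where "W = 2 * ln (real n) - ln (real k) - ln (real l)"
  \<comment> \<open>The extremal case is k = l = n / 2, by the inequality between arithmetic and
    geometric mean.\<close>
  have W: "2 * ln 2 \<le> W"
  proof -
    have "0 \<le> (real k - real l)\<^sup>2" by simp
    hence "4 * (real k * real l) \<le> (real k + real l)\<^sup>2" by (simp add: power2_eq_square algebra_simps)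
    also have "\<dots> \<le> (real n)\<^sup>2" using kl by (intro power_mono) auto
    finally have "ln (4 * (real k * real l)) \<le> ln ((real n)\<^sup>2)" 
      using n k l by (subst ln_le_cancel_iff) auto
    moreover have "ln (4::real) = 2 * ln 2" using ln_realpow[of 2 2] by simp
    ultimately show ?thesis using n k l by (simp add: ln_mult ln_realpow W_def)
  qed
  consider "n = 2" | "n = 3" | "n = 4" | "n \<ge> 5" using n by linarith
  hence "?u k + ?u l \<le> 2 * (real n - 2) * (ln (real n) - ln (real (n - 1))) + W / real n"
  proof cases
    case 1
    hence "k = 1" "l = 1" using k l kl by auto
    moreover have "0 \<le> W" using W ln2_ge_two_thirds by linarith
    ultimately show ?thesis using 1 by simp
  next
    case 2
    have l32: "2 / 5 \<le> ln (3::real) - ln 2" using ln_ge_diff_div_sum[of "3/2"] by (simp add: ln_div)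
    have "(k = 1 \<and> l = 1) \<or> (k = 1 \<and> l = 2) \<or> (k = 2 \<and> l = 1)" using 2 k l kl by auto
    hence "?u k + ?u l \<le> ln 2" by auto
    moreover have "2 * ln 2 / 3 \<le> W / 3" using W by simp
    ultimately show ?thesis using 2 l32 ln2_le_25_over_36 by simp
  next
    case 3
    have l43: "2 / 7 \<le> ln (4::real) - ln 3" using ln_ge_diff_div_sum[of "4/3"] by (simp add: ln_div)
    have l32: "ln (3::real) - ln 2 \<le> 5 / 12" using ln_le_diff_div[of "3/2"] by (simp add: ln_div power2_eq_square)
    have "(k = 1 \<and> l = 1) \<or> (k = 1 \<and> l = 2) \<or> (k = 2 \<and> l = 1) \<or> (k = 2 \<and> l = 2)
        \<or> (k = 1 \<and> l = 3) \<or> (k = 3 \<and> l = 1)" using 3 k l kl by auto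
    hence "?u k + ?u l \<le> 25 / 18" using l32 ln2_le_25_over_36 by auto
    moreover have "2 * ln 2 / 4 \<le> W / 4" using W by simp
    ultimately show ?thesis using 3 l43 ln2_ge_two_thirds by simp
  next
    case 4
    have "4 / real n \<le> 1 / real k + 1 / real l"
    proof -
      have "0 \<le> (real k - real l)\<^sup>2" by simp
      hence "4 * (real k * real l) \<le> (real k + real l) * (real k + real l)" by (simp add: power2_eq_square algebra_simps)
      also have "\<dots> \<le> (real k + real l) * real n" using kl by (intro mult_left_mono) auto
      finally show ?thesis using n k l by (simp add: field_simps)
    qed
    hence "?u k + ?u l \<le> 2 - 2 / real n" using diff_ln_pred_le[OF k] diff_ln_pred_le[OF l] by simp
    \<comment> \<open>This is an equality at n = 5 and fails at n = 4, hence the separate numerical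
      treatment of n = 2, 3, 4.\<close>
    also have "\<dots> \<le> 2 * (real n - 2) * (2 / (2 * real n - 1)) + (4 / 3) / real n"
      using 4 by (simp add: field_simps)
    also have "2 / (2 * real n - 1) \<le> ln (real n) - ln (real (n - 1))"
    proof -
      have "2 * (real n / real (n - 1) - 1) / (real n / real (n - 1) + 1) \<le> ln (real n / real (n - 1))"
        using 4 by (intro ln_ge_diff_div_sum) simp
      moreover have "2 * (real n / real (n - 1) - 1) / (real n / real (n - 1) + 1) = 2 / (2 * real n - 1)"
        using 4 by (simp add: of_nat_diff divide_simps) 
      ultimately show ?thesis using 4 by (simp add: ln_div)
    qed
    also have "4 / 3 \<le> W" using W ln2_ge_two_thirds by simp
    finally show ?thesis using 4 by (simp add: mult_left_mono divide_right_mono)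
  qed
  thus ?thesis by (simp add: W_def)
qed

text \<open>The first term is the share of the revealed site. The second adds up the weights on n -
  1 sites over the n - 2 revealed sites outside the swapped pair, of which k - 1 and l - 1 carry one
  of its colours. The identity ((n - 2) + 1 / n) / (n - 1) = 1 - 1 / n shows that the slack W / n in
  \<open>weight_recursion_err\<close> is exactly what is available.\<close>

lemma weight_recursion:
  fixes n k l :: nat
  assumes n: "n \<ge> 2" and k: "k \<ge> 1" and l: "l \<ge> 1" and kl: "k + l \<le> n"
  shows "(2 * ln (real n) - ln (real k) - ln (real l)) / real n
      + ((real n - 2) * (2 * ln (real (n - 1)) - ln (real k) - ln (real l))
         + real (k - 1) * (ln (real k) - ln (real (k - 1))) + real (l - 1) * (ln (real l) - ln (real (l - 1))))
        / (real n - 1)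
    \<le> 2 * ln (real n) - ln (real k) - ln (real l)"
proof -
  define W where "W = 2 * ln (real n) - ln (real k) - ln (real l)"
  define E where "E = real (k - 1) * (ln (real k) - ln (real (k - 1))) + real (l - 1) * (ln (real l) - ln (real (l - 1)))"
  define d where "d = ln (real n) - ln (real (n - 1))"
  have "E \<le> 2 * (real n - 2) * d + W / real n"
    using weight_recursion_err[OF assms] unfolding E_def d_def W_def .
  hence "(real n - 2) * (W - 2 * d) + E \<le> (real n - 2) * W + W / real n" by (simp add: algebra_simps)
  hence "((real n - 2) * (W - 2 * d) + E) / (real n - 1) \<le> ((real n - 2) * W + W / real n) / (real n - 1)"
    using n by (intro divide_right_mono) auto
  also have "\<dots> = W - W / real n" using n by (simp add: field_simps)
  finally have "W / real n + ((real n - 2) * (W - 2 * d) + E) / (real n - 1) \<le> W" by simp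
  moreover have "W - 2 * d = 2 * ln (real (n - 1)) - ln (real k) - ln (real l)" by (simp add: W_def d_def)
  ultimately show ?thesis unfolding W_def E_def by (simp only: add.assoc)
qed

section \<open>Rearrangements of a configuration\<close>

definition color_count :: "'a set \<Rightarrow> ('a \<Rightarrow> 'b) \<Rightarrow> 'b \<Rightarrow> nat" where
  "color_count S w c = card {i \<in> S. w i = c}"

text \<open>Values off \<open>S\<close> are frozen, so that fixing the colour at i gives a set of
  the same form for \<open>S - {i}\<close>, without renaming sites. This lets the induction run over
  subsets of one fixed type.\<close>

definition rearrangements :: "'a set \<Rightarrow> ('a \<Rightarrow> 'b) \<Rightarrow> ('a \<Rightarrow> 'b) set" where
  "rearrangements S w = {u. (\<forall>i. i \<notin> S \<longrightarrow> u i = w i) \<and> (\<forall>c. color_count S u c = color_count S w c)}"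

lemma rearrangements_refl [simp]: "w \<in> rearrangements S w"
  by (simp add: rearrangements_def)

lemma rearrangements_eq: "u \<in> rearrangements S w \<Longrightarrow> rearrangements S u = rearrangements S w"
  by (auto simp: rearrangements_def)

lemma color_count_rearrangement: "u \<in> rearrangements S w \<Longrightarrow> color_count S u = color_count S w"
  by (auto simp: rearrangements_def)

lemma color_count_pos: "finite S \<Longrightarrow> i \<in> S \<Longrightarrow> color_count S w (w i) > 0"
  unfolding color_count_def by (subst card_gt_0_iff) auto

lemma color_count_pos_iff: "finite S \<Longrightarrow> color_count S w c > 0 \<longleftrightarrow> c \<in> w ` S"
  unfolding color_count_def by (subst card_gt_0_iff) auto

lemma rearrangement_image:
  assumes "finite S" "u \<in> rearrangements S w"
  shows "u ` S = w ` S"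
  using color_count_pos_iff[OF assms(1)] color_count_rearrangement[OF assms(2)] by (metis subsetI subset_antisym)

lemma finite_rearrangements:
  assumes "finite S"
  shows "finite (rearrangements S w)"
proof (rule finite_subset)
  show "rearrangements S w \<subseteq> (\<lambda>g i. if i \<in> S then g i else w i) ` (S \<rightarrow>\<^sub>E w ` S)"
  proof
    fix u assume u: "u \<in> rearrangements S w"
    have "u = (\<lambda>i. if i \<in> S then restrict u S i else w i)"
      using u by (auto simp: rearrangements_def)
    moreover have "restrict u S \<in> S \<rightarrow>\<^sub>E w ` S" using rearrangement_image[OF assms u] by auto
    ultimately show "u \<in> (\<lambda>g i. if i \<in> S then g i else w i) ` (S \<rightarrow>\<^sub>E w ` S)" by blast
  qed
  show "finite ((\<lambda>g i. if i \<in> S then g i else w i) ` (S \<rightarrow>\<^sub>E w ` S))"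
    using assms by (intro finite_imageI finite_PiE) auto
qed

lemma color_count_permute:
  assumes "\<sigma> permutes S"
  shows "color_count S (w \<circ> \<sigma>) c = color_count S w c"
proof -
  have "bij_betw \<sigma> {i \<in> S. (w \<circ> \<sigma>) i = c} {i \<in> S. w i = c}"
    using assms by (intro bij_betw_byWitness[where f' = "inv \<sigma>"])
      (auto simp: permutes_inverses permutes_in_image permutes_inv)
  thus ?thesis unfolding color_count_def by (rule bij_betw_same_card)
qed

lemma rearrangements_permute:
  assumes "\<sigma> permutes S" "u \<in> rearrangements S w"
  shows "u \<circ> \<sigma> \<in> rearrangements S w"
  using assms(2) color_count_permute[OF assms(1), of u] permutes_not_in[OF assms(1)]
  by (simp add: rearrangements_def)

lemma sum_rearrangements_permute:
  assumes "\<sigma> permutes S"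
  shows "(\<Sum>u\<in>rearrangements S w. F (u \<circ> \<sigma>)) = (\<Sum>u\<in>rearrangements S w. F u)"
  using assms permutes_inv[OF assms] rearrangements_permute
  by (intro sum.reindex_bij_witness[where i = "\<lambda>u. u \<circ> inv \<sigma>" and j = "\<lambda>u. u \<circ> \<sigma>"])
     (auto simp: comp_assoc permutes_inv_o)

lemma transpose_permutes: "i \<in> S \<Longrightarrow> j \<in> S \<Longrightarrow> Transposition.transpose i j permutes S"
  by (rule permutes_swap_id)

lemma color_count_remove:
  assumes "finite S" "i \<in> S"
  shows "color_count S w c = color_count (S - {i}) w c + (if w i = c then 1 else 0)"
proof -
  have "{j \<in> S. w j = c} = (if w i = c then insert i {j \<in> S - {i}. w j = c} else {j \<in> S - {i}. w j = c})"
    using assms by auto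
  thus ?thesis unfolding color_count_def using assms by auto
qed

lemma rearrangements_remove:
  assumes "finite S" "i \<in> S"
  shows "{u \<in> rearrangements S w. u i = w i} = rearrangements (S - {i}) w"
proof -
  have "(\<forall>c. color_count S u c = color_count S w c) \<longleftrightarrow>
      (\<forall>c. color_count (S - {i}) u c = color_count (S - {i}) w c)" if "u i = w i" for u
    using color_count_remove[OF assms, of u] color_count_remove[OF assms, of w] that by simp
  moreover have "(\<forall>j. j \<notin> S - {i} \<longrightarrow> u j = w j) \<longleftrightarrow> (\<forall>j. j \<notin> S \<longrightarrow> u j = w j) \<and> u i = w i" for u
    using assms(2) by auto
  ultimately show ?thesis by (auto simp: rearrangements_def)
qed

lemma card_filter_eq_sum: "finite B \<Longrightarrow> card {u \<in> B. P u} = (\<Sum>u\<in>B. if P u then 1 else 0)"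
  by (simp flip: sum.inter_filter)

text \<open>Double counting: swapping sites shows that all sites give the same number, and summed
  over the sites each rearrangement is counted \<open>color_count S w c\<close> times.\<close>

lemma card_rearrangements_site:
  assumes S: "finite S" "i \<in> S"
  shows "card {u \<in> rearrangements S w. u i = c} * card S = card (rearrangements S w) * color_count S w c"
proof -
  let ?B = "rearrangements S w"
  note fin = finite_rearrangements[OF S(1), of w]
  have eq: "card {u \<in> ?B. u j = c} = card {u \<in> ?B. u i = c}" if j: "j \<in> S" for j
  proof -
    have "(\<Sum>u\<in>?B. if (u \<circ> Transposition.transpose i j) j = c then 1 else 0 :: nat) = (\<Sum>u\<in>?B. if u j = c then 1 else 0)"
      by (rule sum_rearrangements_permute[OF transpose_permutes[OF S(2) j]])
    thus ?thesis by (simp add: card_filter_eq_sum[OF fin])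
  qed
  have "card {u \<in> ?B. u i = c} * card S = (\<Sum>j\<in>S. card {u \<in> ?B. u j = c})"
    using eq by simp
  also have "\<dots> = (\<Sum>j\<in>S. \<Sum>u\<in>?B. if u j = c then 1 else 0)"
    by (simp add: card_filter_eq_sum[OF fin])
  also have "\<dots> = (\<Sum>u\<in>?B. \<Sum>j\<in>S. if u j = c then 1 else 0)" by (rule sum.swap)
  also have "\<dots> = (\<Sum>u\<in>?B. color_count S u c)"
    by (simp add: color_count_def card_filter_eq_sum[OF S(1)])
  also have "\<dots> = card ?B * color_count S w c"
    by (simp add: color_count_rearrangement)
  finally show ?thesis .
qed


section \<open>Weighted log-Sobolev inequality on the multislice\<close>

text \<open>For nonempty \<open>X\<close> this is \<open>card X\<close> times the entropy of the
  square of g under the uniform law. Without the normalisation the entropies of the fibres of a map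
  add up with no weights.\<close>

definition sq_entropy :: "'a set \<Rightarrow> ('a \<Rightarrow> real) \<Rightarrow> real" where
  "sq_entropy X g = (\<Sum>x\<in>X. (g x)\<^sup>2 * ln ((g x)\<^sup>2))
     - (\<Sum>x\<in>X. (g x)\<^sup>2) * ln ((\<Sum>x\<in>X. (g x)\<^sup>2) / real (card X))"

lemma sq_entropy_singleton [simp]: "sq_entropy {x} g = 0"
  by (simp add: sq_entropy_def)

lemma sum_fibres:
  fixes F :: "'a \<Rightarrow> 'c :: comm_monoid_add"
  assumes "finite X" "finite C" "h ` X \<subseteq> C"
  shows "(\<Sum>c\<in>C. \<Sum>x\<in>{x \<in> X. h x = c}. F x) = (\<Sum>x\<in>X. F x)"
  using sum.group[OF assms] .

text \<open>The chain rule of entropy: what the fibres leave over is the entropy of the conditional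
  expectation of the square of g, a function of one colour with law \<open>p\<close>. The
  single-site inequality applies to its root \<open>f\<close>.\<close>

lemma sq_entropy_chain:
  fixes h :: "'a \<Rightarrow> 'c" and g :: "'a \<Rightarrow> real"
  assumes X: "finite X" "finite C" "h ` X = C" "X \<noteq> {}"
  defines "F \<equiv> \<lambda>c. {x \<in> X. h x = c}"
  defines "p \<equiv> \<lambda>c. real (card (F c)) / real (card X)"
  defines "f \<equiv> \<lambda>c. sqrt ((\<Sum>x\<in>F c. (g x)\<^sup>2) / real (card (F c)))"
  shows "sq_entropy X g \<le> (\<Sum>c\<in>C. sq_entropy (F c) g)
     + real (card X) / (2 * ln 2) * (\<Sum>a\<in>C. \<Sum>b\<in>C. p a * p b * ln (1 / (p a * p b)) * (f a - f b)\<^sup>2)"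
proof -
  define T where "T c = (\<Sum>x\<in>F c. (g x)\<^sup>2)" for c
  define N where "N = real (card X)"
  define M where "M = (\<Sum>c\<in>C. p c * (f c)\<^sup>2)"
  have N: "N > 0" using X by (simp add: N_def card_gt_0_iff)
  have finF: "finite (F c)" for c using X by (simp add: F_def)
  have Fpos: "card (F c) > 0" if "c \<in> C" for c
    using that X(3) finF[of c] unfolding card_gt_0_iff by (auto simp: F_def)
  have T_nonneg: "T c \<ge> 0" for c unfolding T_def by (intro sum_nonneg) auto
  have p: "p c > 0" if "c \<in> C" for c using Fpos[OF that] N by (simp add: p_def N_def)
  have sumF: "(\<Sum>c\<in>C. \<Sum>x\<in>F c. u x) = (\<Sum>x\<in>X. u x)" for u :: "'a \<Rightarrow> real"
    unfolding F_def using X by (intro sum_fibres) auto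
  have "(\<Sum>c\<in>C. real (card (F c))) = N" using sumF[of "\<lambda>_. 1"] by (simp add: N_def)
  hence p1: "(\<Sum>c\<in>C. p c) = 1" using N by (simp add: p_def N_def flip: sum_divide_distrib)
  have f_nonneg: "f c \<ge> 0" for c by (simp add: f_def sum_nonneg)
  have f2: "(f c)\<^sup>2 = T c / real (card (F c))" for c using T_nonneg[of c] by (simp add: f_def T_def)
  have pf: "p c * (f c)\<^sup>2 = T c / N" if "c \<in> C" for c 
    using Fpos[OF that] by (simp add: f2 p_def N_def)
  have TX: "(\<Sum>c\<in>C. T c) = (\<Sum>x\<in>X. (g x)\<^sup>2)" unfolding T_def by (rule sumF)
  have NM: "N * M = (\<Sum>x\<in>X. (g x)\<^sup>2)" "M = (\<Sum>x\<in>X. (g x)\<^sup>2) / N" unfolding M_def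
    using N by (simp_all add: pf sum_divide_distrib[symmetric] TX)
  have "(\<Sum>c\<in>C. p c * ((f c)\<^sup>2 * ln ((f c)\<^sup>2))) - M * ln M
      \<le> 1 / (2 * ln 2) * (\<Sum>a\<in>C. \<Sum>b\<in>C. p a * p b * ln (1 / (p a * p b)) * (f a - f b)\<^sup>2)"
    unfolding M_def by (intro single_site_log_sobolev X p p1 f_nonneg)
  hence "N * ((\<Sum>c\<in>C. p c * ((f c)\<^sup>2 * ln ((f c)\<^sup>2))) - M * ln M)
      \<le> N * (1 / (2 * ln 2) * (\<Sum>a\<in>C. \<Sum>b\<in>C. p a * p b * ln (1 / (p a * p b)) * (f a - f b)\<^sup>2))"
    using N by (intro mult_left_mono) auto
  moreover have "N * (\<Sum>c\<in>C. p c * ((f c)\<^sup>2 * ln ((f c)\<^sup>2))) = (\<Sum>c\<in>C. T c * ln (T c / real (card (F c))))"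
    unfolding sum_distrib_left
  proof (intro sum.cong refl)
    fix c assume "c \<in> C"
    have "N * (p c * ((f c)\<^sup>2 * ln ((f c)\<^sup>2))) = N * (p c * (f c)\<^sup>2) * ln ((f c)\<^sup>2)" by simp
    also have "N * (p c * (f c)\<^sup>2) = T c" unfolding pf[OF \<open>c \<in> C\<close>] using N by simp
    finally show "N * (p c * ((f c)\<^sup>2 * ln ((f c)\<^sup>2))) = T c * ln (T c / real (card (F c)))"
      by (simp only: f2)
  qed
  moreover have "N * (M * ln M) = (\<Sum>x\<in>X. (g x)\<^sup>2) * ln ((\<Sum>x\<in>X. (g x)\<^sup>2) / N)"
    using NM by (metis mult.assoc)
  moreover have "(\<Sum>c\<in>C. sq_entropy (F c) g) = (\<Sum>x\<in>X. (g x)\<^sup>2 * ln ((g x)\<^sup>2))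
      - (\<Sum>c\<in>C. T c * ln (T c / real (card (F c))))"
    unfolding sq_entropy_def sum_subtractf sumF T_def ..
  ultimately show ?thesis unfolding sq_entropy_def by (simp add: right_diff_distrib N_def)
qed

text \<open>
  Swapping site \<open>i\<close> with a uniformly chosen site of colour \<open>b\<close> couples the conditional laws given
  colour \<open>a\<close> and colour \<open>b\<close> at \<open>i\<close>.
\<close>
lemma swap_coupling:
  fixes g :: "('a \<Rightarrow> 'b) \<Rightarrow> real"
  assumes S: "finite S" "i \<in> S" and ab: "a \<noteq> b" "a \<in> w ` S" "b \<in> w ` S" and g: "\<And>u. 0 \<le> g u"
  defines "B \<equiv> rearrangements S w"
  defines "f \<equiv> \<lambda>c. sqrt ((\<Sum>u\<in>{u \<in> B. u i = c}. (g u)\<^sup>2) / real (card {u \<in> B. u i = c}))"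
  shows "real (card B) * (real (color_count S w a) / real (card S)) * real (color_count S w b) * (f a - f b)\<^sup>2
    \<le> (\<Sum>j\<in>S. \<Sum>u\<in>{u \<in> B. u i = a \<and> u j = b}. (g (u \<circ> Transposition.transpose i j) - g u)\<^sup>2)"
proof -
  let ?n = "real (card S)" and ?k = "\<lambda>c. real (color_count S w c)"
  define q where "q = real (card B) * (?k a / ?n) * ?k b"
  have finB: "finite B" unfolding B_def using S by (intro finite_rearrangements)
  have Bne: "B \<noteq> {}" unfolding B_def using rearrangements_refl by blast
  have n: "?n > 0" using S by (auto simp: card_gt_0_iff)
  have k: "?k c > 0" if "c \<in> w ` S" for c using that color_count_pos_iff[OF S(1), of w c] by simp
  have card_site: "real (card {u \<in> B. u i = c}) = real (card B) * ?k c / ?n" for c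
  proof -
    have "real (card {u \<in> B. u i = c} * card S) = real (card B * color_count S w c)"
      unfolding B_def card_rearrangements_site[OF S] ..
    thus ?thesis using n by (simp add: field_simps)
  qed
  have total: "(\<Sum>j\<in>S. \<Sum>u\<in>{u \<in> B. u i = c \<and> u j = c'}. (g u)\<^sup>2)
      = real (card B) * (?k c / ?n) * ?k c' * (f c)\<^sup>2" if c: "c \<in> w ` S" for c c'
  proof -
    have "(\<Sum>j\<in>S. \<Sum>u\<in>{u \<in> B. u i = c \<and> u j = c'}. (g u)\<^sup>2)
      = (\<Sum>j\<in>S. \<Sum>u\<in>{u \<in> B. u i = c}. if u j = c' then (g u)\<^sup>2 else 0)"
      using finB by (simp add: sum.inter_filter[symmetric] conj_assoc)
    also have "\<dots> = (\<Sum>u\<in>{u \<in> B. u i = c}. \<Sum>j\<in>S. if u j = c' then (g u)\<^sup>2 else 0)"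
      by (rule sum.swap)
    also have "\<dots> = (\<Sum>u\<in>{u \<in> B. u i = c}. ?k c' * (g u)\<^sup>2)"
    proof (intro sum.cong refl)
      fix u assume "u \<in> {u \<in> B. u i = c}"
      hence "color_count S u c' = color_count S w c'" 
        using color_count_rearrangement[of u S w] by (simp add: B_def)
      moreover have "(\<Sum>j\<in>S. if u j = c' then (g u)\<^sup>2 else 0) = real (color_count S u c') * (g u)\<^sup>2"
        unfolding color_count_def using S by (subst sum.inter_filter[symmetric]) auto
      ultimately show "(\<Sum>j\<in>S. if u j = c' then (g u)\<^sup>2 else 0) = ?k c' * (g u)\<^sup>2" by simp
    qed
    also have "\<dots> = ?k c' * (\<Sum>u\<in>{u \<in> B. u i = c}. (g u)\<^sup>2)" by (simp add: sum_distrib_left)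
    also have "(\<Sum>u\<in>{u \<in> B. u i = c}. (g u)\<^sup>2) = real (card {u \<in> B. u i = c}) * (f c)\<^sup>2"
    proof -
      have "real (card {u \<in> B. u i = c}) > 0"
        unfolding card_site using k[OF c] n Bne finB by (simp add: card_gt_0_iff)
      thus ?thesis by (simp add: f_def sum_nonneg)
    qed
    finally show ?thesis unfolding card_site by simp
  qed
  \<comment> \<open>\<open>Z\<close> is the space of the coupling, with \<open>q\<close> elements: a
    configuration with colour a at i together with a site j of colour b. Swapping i and j maps it
    onto the same space with a and b exchanged.\<close>
  define Z where "Z = (SIGMA j:S. {u \<in> B. u i = a \<and> u j = b})"
  let ?sw = "\<lambda>z. snd z \<circ> Transposition.transpose i (fst z)"
  have sumZ: "(\<Sum>j\<in>S. \<Sum>u\<in>{u \<in> B. u i = a \<and> u j = b}. F j u) = (\<Sum>z\<in>Z. F (fst z) (snd z))"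
    for F :: "'a \<Rightarrow> ('a \<Rightarrow> 'b) \<Rightarrow> real"
    unfolding Z_def by (subst sum.Sigma) (use S finB in \<open>auto simp: case_prod_beta\<close>)
  have Z1: "(\<Sum>z\<in>Z. (g (snd z))\<^sup>2) = q * (f a)\<^sup>2"
    using total[OF ab(2), of b] unfolding sumZ q_def .
  have Z2: "(\<Sum>z\<in>Z. (g (?sw z))\<^sup>2) = q * (f b)\<^sup>2"
  proof -
    have "(\<Sum>z\<in>Z. (g (?sw z))\<^sup>2)
       = (\<Sum>j\<in>S. \<Sum>u\<in>{u \<in> B. u i = a \<and> u j = b}. (g (u \<circ> Transposition.transpose i j))\<^sup>2)"
      unfolding sumZ ..
    also have "\<dots> = (\<Sum>j\<in>S. \<Sum>u\<in>{u \<in> B. u i = b \<and> u j = a}. (g u)\<^sup>2)"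
    proof (rule sum.cong[OF refl])
      fix j assume j: "j \<in> S"
      have "(\<Sum>u\<in>B. (\<lambda>v. if v i = b \<and> v j = a then (g v)\<^sup>2 else 0) (u \<circ> Transposition.transpose i j))
          = (\<Sum>u\<in>B. if u i = b \<and> u j = a then (g u)\<^sup>2 else 0)"
        unfolding B_def by (rule sum_rearrangements_permute[OF transpose_permutes[OF S(2) j]])
      thus "(\<Sum>u\<in>{u \<in> B. u i = a \<and> u j = b}. (g (u \<circ> Transposition.transpose i j))\<^sup>2)
          = (\<Sum>u\<in>{u \<in> B. u i = b \<and> u j = a}. (g u)\<^sup>2)"
        using finB by (simp add: sum.inter_filter conj_commute)
    qed
    also have "\<dots> = q * (f b)\<^sup>2" using total[OF ab(3), of a] by (simp add: q_def)
    finally show ?thesis .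
  qed
  have q: "q \<ge> 0" unfolding q_def by simp
  have f: "f c \<ge> 0" for c unfolding f_def by (simp add: sum_nonneg)
  \<comment> \<open>The claim is the reverse triangle inequality in l2 on \<open>Z\<close>, where g
    and its swapped version have norms sqrt q * f a and sqrt q * f b.\<close>
  have "(\<Sum>z\<in>Z. g (?sw z) * g (snd z))\<^sup>2 \<le> (q * (f a * f b))\<^sup>2"
    using Cauchy_Schwarz_ineq_sum[of "\<lambda>z. g (?sw z)" "\<lambda>z. g (snd z)" Z] unfolding Z1 Z2
    by (simp add: power2_eq_square mult_ac)
  hence cs: "(\<Sum>z\<in>Z. g (?sw z) * g (snd z)) \<le> q * (f a * f b)"
    by (rule power2_le_imp_le) (use q f in simp)
  have "q * (f a - f b)\<^sup>2 = q * (f b)\<^sup>2 - 2 * (q * (f a * f b)) + q * (f a)\<^sup>2"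
    by (simp add: power2_eq_square algebra_simps)
  also have "\<dots> \<le> (\<Sum>z\<in>Z. (g (?sw z))\<^sup>2) - 2 * (\<Sum>z\<in>Z. g (?sw z) * g (snd z)) + (\<Sum>z\<in>Z. (g (snd z))\<^sup>2)"
    using cs unfolding Z1 Z2 by simp
  also have "\<dots> = (\<Sum>z\<in>Z. (g (?sw z) - g (snd z))\<^sup>2)"
    by (simp add: power2_diff sum.distrib sum_subtractf sum_distrib_left mult.assoc)
  finally show ?thesis unfolding sumZ q_def .
qed

definition pair_weight :: "'a set \<Rightarrow> ('a \<Rightarrow> 'b) \<Rightarrow> 'b \<Rightarrow> 'b \<Rightarrow> real" where
  "pair_weight S w a b = 2 * ln (real (card S)) - ln (real (color_count S w a)) - ln (real (color_count S w b))"

lemma pair_weight_rearrangement: "u \<in> rearrangements S w \<Longrightarrow> pair_weight S u = pair_weight S w"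
  by (simp add: pair_weight_def color_count_rearrangement fun_eq_iff)

text \<open>Among the sites other than j and k, exactly \<open>color_count S w a - 1\<close> have
  colour a, because j has it and k does not; only their removal lowers the count.\<close>

lemma sum_ln_color_count_remove:
  assumes S: "finite S" and jk: "j \<in> S" "k \<in> S" "w j = a" "w k \<noteq> a"
  shows "(\<Sum>i\<in>S - {j, k}. ln (real (color_count (S - {i}) w a)))
    = (real (card S) - 2) * ln (real (color_count S w a))
      - real (color_count S w a - 1) * (ln (real (color_count S w a)) - ln (real (color_count S w a - 1)))"
proof -
  let ?m = "color_count S w a"
  define R where "R = {i \<in> S - {j, k}. w i = a}"
  have "{i \<in> S. w i = a} = insert j R" using jk by (auto simp: R_def)
  moreover have "j \<notin> R" "finite R" using S by (auto simp: R_def)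
  ultimately have m: "?m = Suc (card R)" by (simp add: color_count_def)
  have "j \<noteq> k" using jk by auto
  hence "card (S - {j, k}) = card S - 2" using S jk by (simp add: card_Diff_subset)
  moreover have "card S \<ge> 2" using card_mono[of S "{j, k}"] \<open>j \<noteq> k\<close> S jk by simp
  ultimately have cS: "real (card (S - {j, k})) = real (card S) - 2" by simp
  have "(\<Sum>i\<in>S - {j, k}. ln (real (color_count (S - {i}) w a)))
      = (\<Sum>i\<in>S - {j, k}. ln (real ?m) - (if w i = a then ln (real ?m) - ln (real (?m - 1)) else 0))"
  proof (intro sum.cong refl)
    fix i assume "i \<in> S - {j, k}"
    thus "ln (real (color_count (S - {i}) w a))
        = ln (real ?m) - (if w i = a then ln (real ?m) - ln (real (?m - 1)) else 0)"
      using color_count_remove[OF S, of i w a] by auto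
  qed
  also have "\<dots> = real (card (S - {j, k})) * ln (real ?m)
      - (\<Sum>i\<in>S - {j, k}. if w i = a then ln (real ?m) - ln (real (?m - 1)) else 0)"
    by (simp add: sum_subtractf)
  also have "(\<Sum>i\<in>S - {j, k}. if w i = a then ln (real ?m) - ln (real (?m - 1)) else 0)
      = (\<Sum>i\<in>R. ln (real ?m) - ln (real (?m - 1)))"
    unfolding R_def using S by (subst sum.inter_filter) auto
  finally show ?thesis unfolding cS using m by simp
qed

text \<open>The form of \<open>weight_recursion\<close> that closes the induction: once the removals
  are summed for both colours, the two left-hand sides agree.\<close>

lemma sum_pair_weight_remove:
  assumes S: "finite S" and jk: "j \<in> S" "k \<in> S" "w j \<noteq> w k"
  shows "pair_weight S w (w j) (w k) / real (card S)
     + (\<Sum>i\<in>S - {j, k}. pair_weight (S - {i}) w (w j) (w k)) / (real (card S) - 1)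
     \<le> pair_weight S w (w j) (w k)"
proof -
  let ?n = "card S" and ?k = "color_count S w (w j)" and ?l = "color_count S w (w k)"
  have "j \<noteq> k" using jk by auto
  hence n: "?n \<ge> 2" using card_mono[of S "{j, k}"] S jk by simp
  have cS: "real (card (S - {j, k})) = real ?n - 2" using S jk n \<open>j \<noteq> k\<close> by (simp add: card_Diff_subset)
  have "?k + ?l = card ({i \<in> S. w i = w j} \<union> {i \<in> S. w i = w k})"
    unfolding color_count_def using S jk by (subst card_Un_disjoint) auto
  also have "\<dots> \<le> ?n" using S by (intro card_mono) auto
  finally have kl: "?k + ?l \<le> ?n" .
  have "?k > 0" "?l > 0" using jk S by (auto intro: color_count_pos)
  hence k1: "?k \<ge> 1" "?l \<ge> 1" by linarith+
  have "(\<Sum>i\<in>S - {j, k}. pair_weight (S - {i}) w (w j) (w k))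
      = (\<Sum>i\<in>S - {j, k}. 2 * ln (real (?n - 1)) - ln (real (color_count (S - {i}) w (w j)))
          - ln (real (color_count (S - {i}) w (w k))))"
    using S by (intro sum.cong refl) (simp add: pair_weight_def)
  also have "\<dots> = (real ?n - 2) * (2 * ln (real (?n - 1)))
      - (\<Sum>i\<in>S - {j, k}. ln (real (color_count (S - {i}) w (w j))))
      - (\<Sum>i\<in>S - {k, j}. ln (real (color_count (S - {i}) w (w k))))"
    by (simp add: sum_subtractf cS insert_commute)
  also have "\<dots> = (real ?n - 2) * (2 * ln (real (?n - 1)) - ln (real ?k) - ln (real ?l))
         + real (?k - 1) * (ln (real ?k) - ln (real (?k - 1))) + real (?l - 1) * (ln (real ?l) - ln (real (?l - 1)))"
    using jk by (simp add: sum_ln_color_count_remove[OF S] right_diff_distrib)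
  finally show ?thesis using weight_recursion[OF n k1 kl] by (simp only: pair_weight_def)
qed

text \<open>
  Revealing the colour of one site, averaging over the site: the induction closes because a swap of
  two sites with distinct colours keeps both colours, so that \<open>pair_weight\<close> only has to
  satisfy \<open>sum_pair_weight_remove\<close>.
\<close>
lemma weighted_log_sobolev:
  fixes g :: "('a \<Rightarrow> 'b) \<Rightarrow> real"
  assumes "finite S" and g: "\<And>u. 0 \<le> g u"
  shows "real (card S) * sq_entropy (rearrangements S w) g
    \<le> 1 / (2 * ln 2) * (\<Sum>u\<in>rearrangements S w. \<Sum>j\<in>S. \<Sum>k\<in>S.
         pair_weight S w (u j) (u k) * (g (u \<circ> Transposition.transpose j k) - g u)\<^sup>2)"
  using assms(1)
proof (induction "card S" arbitrary: S w)
  case 0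
  hence "S = {}" by simp
  thus ?case by simp
next
  case (Suc m)
  note S = \<open>finite S\<close>
  let ?n = "real (card S)"
  let ?B = "rearrangements S w"
  have n: "?n = real m + 1" using Suc.hyps(2) by (simp flip: Suc.hyps(2))
  have finB: "finite ?B" using S by (rule finite_rearrangements)
  have Bne: "?B \<noteq> {}" using rearrangements_refl by blast
  have N: "card ?B > 0" using finB Bne by (simp add: card_gt_0_iff)
  define d where "d j k u = (g (u \<circ> Transposition.transpose j k) - g u)\<^sup>2" for j k u
  have d: "d j k u \<ge> 0" for j k u by (simp add: d_def)
  \<comment> \<open>Swaps of equal colours contribute nothing, so the recursion for the weights is
    needed for distinct colours only.\<close>
  have d0: "d j k u = 0" if "u j = u k" for j k u
  proof -
    have "u \<circ> Transposition.transpose j k = u" using that by (auto simp: fun_eq_iff Transposition.transpose_def)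
    thus ?thesis by (simp add: d_def)
  qed
  define D where "D = (\<Sum>u\<in>?B. \<Sum>j\<in>S. \<Sum>k\<in>S. pair_weight S w (u j) (u k) * d j k u)"
  have pw: "pair_weight S u = pair_weight S w" if "u \<in> ?B" for u using that by (rule pair_weight_rearrangement)
  show ?case
  \<comment> \<open>A single site admits one configuration only. It is treated apart because the
    induction hypothesis will be divided by m.\<close>
  proof (cases "m = 0")
    case True
    then obtain i where i: "S = {i}" using Suc.hyps(2) card_1_singletonE by (metis One_nat_def)
    have "?B = {w}"
    proof (intro equalityI subsetI)
      fix u assume u: "u \<in> ?B"
      hence "u i = w i" using rearrangement_image[OF S u] by (simp add: i)
      hence "u = w" using u by (auto simp: rearrangements_def i fun_eq_iff)
      thus "u \<in> {w}" by simp
    qed simp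
    thus ?thesis by (simp add: i)
  next
    case False
    hence m: "m > 0" by simp
    define C where "C = w ` S"
    define F where "F i c = {u \<in> ?B. u i = c}" for i c
    define f where "f i c = sqrt ((\<Sum>u\<in>F i c. (g u)\<^sup>2) / real (card (F i c)))" for i c
    define p where "p c = real (color_count S w c) / ?n" for c
    have finC: "finite C" using S by (simp add: C_def)
    have card_site: "real (card (F i c)) / real (card ?B) = p c" if "i \<in> S" for i c
    proof -
      have "real (card (F i c) * card S) = real (card ?B * color_count S w c)"
        unfolding F_def card_rearrangements_site[OF S that] ..
      thus ?thesis using N n by (simp add: p_def field_simps)
    qed
    have p: "p c > 0" if "c \<in> C" for c
      using that color_count_pos_iff[OF S, of w c] n by (simp add: p_def C_def)
    have onto: "(\<lambda>u. u i) ` ?B = C" if i: "i \<in> S" for i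
    proof (intro equalityI subsetI)
      fix c assume "c \<in> (\<lambda>u. u i) ` ?B"
      then obtain u where "u \<in> ?B" "c = u i" by blast
      thus "c \<in> C" using rearrangement_image[OF S] i unfolding C_def by blast
    next
      fix c assume "c \<in> C"
      hence "card (F i c) > 0" using card_site[OF i, of c] p[of c] by (metis div_0 less_irrefl neq0_conv of_nat_0)
      thus "c \<in> (\<lambda>u. u i) ` ?B" by (auto simp: card_gt_0_iff F_def)
    qed
    have lnp: "ln (1 / (p a * p b)) = pair_weight S w a b" if "a \<in> C" "b \<in> C" for a b
    proof -
      have "color_count S w a > 0" "color_count S w b > 0" using that color_count_pos_iff[OF S, of w] by (auto simp: C_def)
      thus ?thesis using n by (simp add: p_def pair_weight_def ln_div ln_mult)
    qed
    have pw_nonneg: "pair_weight S w a b \<ge> 0" if "a \<in> C" "b \<in> C" for a b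
    proof -
      have "p c \<le> 1" for c
      proof -
        have "color_count S w c \<le> card S" unfolding color_count_def using S by (intro card_mono) auto
        thus ?thesis using n by (simp add: p_def)
      qed
      hence "p a * p b \<le> 1" using p that by (intro mult_le_one) (auto simp: less_imp_le)
      thus ?thesis unfolding lnp[OF that, symmetric] using p that by (intro ln_ge_zero) (simp add: field_simps)
    qed

    \<comment> \<open>One of the two masses is \<open>p b = color_count S w b / n\<close>;
      \<open>swap_coupling\<close> contains the count, and the 1 / n is left over.\<close>
    have coup: "real (card ?B) * (p a * p b * ln (1 / (p a * p b)) * (f i a - f i b)\<^sup>2)
        \<le> pair_weight S w a b * (1 / ?n * (\<Sum>j\<in>S. \<Sum>u\<in>{u \<in> ?B. u i = a \<and> u j = b}. d i j u))"
      if i: "i \<in> S" and ab: "a \<in> C" "b \<in> C" for i a b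
    proof (cases "a = b")
      case True
      thus ?thesis using pw_nonneg[OF ab] d n
        by (auto intro!: mult_nonneg_nonneg divide_nonneg_nonneg sum_nonneg)
    next
      case False
      have "real (card ?B) * p a * real (color_count S w b) * (f i a - f i b)\<^sup>2
        \<le> (\<Sum>j\<in>S. \<Sum>u\<in>{u \<in> ?B. u i = a \<and> u j = b}. d i j u)"
        using swap_coupling[OF S i False, of w g] ab g unfolding C_def f_def F_def p_def d_def by simp
      hence "pair_weight S w a b * (1 / ?n * (real (card ?B) * p a * real (color_count S w b) * (f i a - f i b)\<^sup>2))
        \<le> pair_weight S w a b * (1 / ?n * (\<Sum>j\<in>S. \<Sum>u\<in>{u \<in> ?B. u i = a \<and> u j = b}. d i j u))"
        using pw_nonneg[OF ab] n by (intro mult_left_mono) auto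
      thus ?thesis unfolding lnp[OF ab] by (simp add: p_def mult_ac)
    qed
    \<comment> \<open>Summing over the colours a and b counts each configuration u and site j once,
      namely for a = \<open>u i\<close> and b = \<open>u j\<close>.\<close>
    have site: "real (card ?B) * (\<Sum>a\<in>C. \<Sum>b\<in>C. p a * p b * ln (1 / (p a * p b)) * (f i a - f i b)\<^sup>2)
        \<le> 1 / ?n * (\<Sum>u\<in>?B. \<Sum>j\<in>S. pair_weight S w (u i) (u j) * d i j u)" if i: "i \<in> S" for i
    proof -
      have "real (card ?B) * (\<Sum>a\<in>C. \<Sum>b\<in>C. p a * p b * ln (1 / (p a * p b)) * (f i a - f i b)\<^sup>2)
        = (\<Sum>a\<in>C. \<Sum>b\<in>C. real (card ?B) * (p a * p b * ln (1 / (p a * p b)) * (f i a - f i b)\<^sup>2))"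
        by (simp only: sum_distrib_left)
      also have "\<dots> \<le> (\<Sum>a\<in>C. \<Sum>b\<in>C. pair_weight S w a b * (1 / ?n * (\<Sum>j\<in>S. \<Sum>u\<in>{u \<in> ?B. u i = a \<and> u j = b}. d i j u)))"
        by (intro sum_mono coup i)
      also have "\<dots> = 1 / ?n * (\<Sum>j\<in>S. \<Sum>a\<in>C. \<Sum>b\<in>C. \<Sum>u\<in>{u \<in> ?B. u i = a \<and> u j = b}. pair_weight S w a b * d i j u)"
      proof -
        have "(\<Sum>a\<in>C. \<Sum>b\<in>C. \<Sum>j\<in>S. Q a b j) = (\<Sum>j\<in>S. \<Sum>a\<in>C. \<Sum>b\<in>C. Q a b j)" 
          for Q :: "'b \<Rightarrow> 'b \<Rightarrow> 'a \<Rightarrow> real"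
        proof -
          have "(\<Sum>a\<in>C. \<Sum>b\<in>C. \<Sum>j\<in>S. Q a b j) = (\<Sum>a\<in>C. \<Sum>j\<in>S. \<Sum>b\<in>C. Q a b j)"
            by (intro sum.cong refl sum.swap)
          also have "\<dots> = (\<Sum>j\<in>S. \<Sum>a\<in>C. \<Sum>b\<in>C. Q a b j)" by (rule sum.swap)
          finally show ?thesis .
        qed
        thus ?thesis by (simp add: sum_distrib_left mult_ac)
      qed
      also have "\<dots> = 1 / ?n * (\<Sum>j\<in>S. \<Sum>u\<in>?B. pair_weight S w (u i) (u j) * d i j u)"
      proof (intro arg_cong[where f = "\<lambda>x. 1 / ?n * x"] sum.cong refl)
        fix j assume j: "j \<in> S"
        have "(\<Sum>a\<in>C. \<Sum>b\<in>C. \<Sum>u\<in>{u \<in> ?B. u i = a \<and> u j = b}. pair_weight S w a b * d i j u)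
          = (\<Sum>a\<in>C. \<Sum>b\<in>C. \<Sum>u\<in>{u \<in> {u \<in> ?B. u i = a}. u j = b}. pair_weight S w (u i) (u j) * d i j u)"
          by (intro sum.cong) auto
        also have "\<dots> = (\<Sum>a\<in>C. \<Sum>u\<in>{u \<in> ?B. u i = a}. pair_weight S w (u i) (u j) * d i j u)"
          using finB finC onto[OF j] by (intro sum.cong refl sum_fibres) auto
        also have "\<dots> = (\<Sum>u\<in>?B. pair_weight S w (u i) (u j) * d i j u)"
          using finB finC onto[OF i] by (intro sum_fibres) auto
        finally show "(\<Sum>a\<in>C. \<Sum>b\<in>C. \<Sum>u\<in>{u \<in> ?B. u i = a \<and> u j = b}. pair_weight S w a b * d i j u)
          = (\<Sum>u\<in>?B. pair_weight S w (u i) (u j) * d i j u)" .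
      qed
      also have "(\<Sum>j\<in>S. \<Sum>u\<in>?B. pair_weight S w (u i) (u j) * d i j u)
          = (\<Sum>u\<in>?B. \<Sum>j\<in>S. pair_weight S w (u i) (u j) * d i j u)"
        by (rule sum.swap)
      finally show ?thesis .
    qed

    \<comment> \<open>Fixing colour c at i leaves the rearrangements of any such v on
      \<open>S - {i}\<close>. The weights depend only on this class, so they may be written with u
      itself, which removes the dependence on the choice of v.\<close>
    have cond: "real m * sq_entropy (F i c) g
        \<le> 1 / (2 * ln 2) * (\<Sum>u\<in>F i c. \<Sum>j\<in>S - {i}. \<Sum>k\<in>S - {i}. pair_weight (S - {i}) u (u j) (u k) * d j k u)"
      if i: "i \<in> S" and c: "c \<in> C" for i c
    proof -
      obtain v where v: "v \<in> ?B" "v i = c" using onto[OF i] c by blast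
      have Fv: "F i c = rearrangements (S - {i}) v"
        using rearrangements_remove[OF S i, of v] rearrangements_eq[OF v(1)] v(2) by (simp add: F_def)
      have m': "m = card (S - {i})" using Suc.hyps(2) S i by simp
      have "real m * sq_entropy (F i c) g
        \<le> 1 / (2 * ln 2) * (\<Sum>u\<in>F i c. \<Sum>j\<in>S - {i}. \<Sum>k\<in>S - {i}. pair_weight (S - {i}) v (u j) (u k) * d j k u)"
        unfolding Fv d_def using Suc.hyps(1)[OF m', of v] S m' by simp
      also have "(\<Sum>u\<in>F i c. \<Sum>j\<in>S - {i}. \<Sum>k\<in>S - {i}. pair_weight (S - {i}) v (u j) (u k) * d j k u)
          = (\<Sum>u\<in>F i c. \<Sum>j\<in>S - {i}. \<Sum>k\<in>S - {i}. pair_weight (S - {i}) u (u j) (u k) * d j k u)"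
        unfolding Fv by (intro sum.cong refl) (simp add: pair_weight_rearrangement)
      finally show ?thesis .
    qed
    have "real m * (\<Sum>i\<in>S. \<Sum>c\<in>C. sq_entropy (F i c) g)
        = (\<Sum>i\<in>S. \<Sum>c\<in>C. real m * sq_entropy (F i c) g)"
      by (simp only: sum_distrib_left)
    also have "\<dots> \<le> (\<Sum>i\<in>S. \<Sum>c\<in>C. 1 / (2 * ln 2) * (\<Sum>u\<in>F i c. \<Sum>j\<in>S - {i}. \<Sum>k\<in>S - {i}. 
             pair_weight (S - {i}) u (u j) (u k) * d j k u))"
      by (intro sum_mono cond)
    also have "\<dots> = 1 / (2 * ln 2) * (\<Sum>i\<in>S. \<Sum>u\<in>?B. \<Sum>j\<in>S - {i}. \<Sum>k\<in>S - {i}. 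
             pair_weight (S - {i}) u (u j) (u k) * d j k u)"
    proof -
      have "(\<Sum>c\<in>C. \<Sum>u\<in>F i c. H u) = (\<Sum>u\<in>?B. H u)" if "i \<in> S" for i and H :: "('a \<Rightarrow> 'b) \<Rightarrow> real"
        unfolding F_def using finB finC onto[OF that] by (intro sum_fibres) auto
      hence "(\<Sum>i\<in>S. \<Sum>c\<in>C. \<Sum>u\<in>F i c. H i u) = (\<Sum>i\<in>S. \<Sum>u\<in>?B. H i u)"
        for H :: "'a \<Rightarrow> ('a \<Rightarrow> 'b) \<Rightarrow> real"
        by (intro sum.cong[OF refl])
      thus ?thesis by (simp only: sum_distrib_left[symmetric])
    qed
    \<comment> \<open>A swap of j and k occurs in the conditional inequality of every revealed site
      outside {j, k}; collecting by pairs produces the sum of weights in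
      \<open>sum_pair_weight_remove\<close>.\<close>
    also have "(\<Sum>i\<in>S. \<Sum>u\<in>?B. \<Sum>j\<in>S - {i}. \<Sum>k\<in>S - {i}. pair_weight (S - {i}) u (u j) (u k) * d j k u)
      = (\<Sum>u\<in>?B. \<Sum>j\<in>S. \<Sum>k\<in>S. d j k u * (\<Sum>i\<in>S - {j, k}. pair_weight (S - {i}) u (u j) (u k)))"
    proof -
      have "(\<Sum>i\<in>S. \<Sum>j\<in>S - {i}. \<Sum>k\<in>S - {i}. H i j k) = (\<Sum>j\<in>S. \<Sum>k\<in>S. \<Sum>i\<in>S - {j, k}. H i j k)"
        for H :: "'a \<Rightarrow> 'a \<Rightarrow> 'a \<Rightarrow> real"
      proof -
        have "(\<Sum>i\<in>S. \<Sum>j\<in>S - {i}. \<Sum>k\<in>S - {i}. H i j k)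
            = (\<Sum>i\<in>S. \<Sum>j\<in>S. \<Sum>k\<in>S. if i \<noteq> j \<and> i \<noteq> k then H i j k else 0)"
        proof (rule sum.cong[OF refl])
          fix i assume "i \<in> S"
          have "(\<Sum>j\<in>S - {i}. \<Sum>k\<in>S - {i}. H i j k) = (\<Sum>j\<in>S. if j \<noteq> i then \<Sum>k\<in>S - {i}. H i j k else 0)"
            using S by (simp add: sum.inter_filter[symmetric] set_diff_eq)
          also have "\<dots> = (\<Sum>j\<in>S. \<Sum>k\<in>S. if i \<noteq> j \<and> i \<noteq> k then H i j k else 0)"
          proof (intro sum.cong refl)
            fix j
            have "(\<Sum>k\<in>S - {i}. H i j k) = (\<Sum>k\<in>S. if i \<noteq> k then H i j k else 0)"
              using S by (simp add: sum.inter_filter[symmetric] set_diff_eq eq_commute)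
            thus "(if j \<noteq> i then \<Sum>k\<in>S - {i}. H i j k else 0) = (\<Sum>k\<in>S. if i \<noteq> j \<and> i \<noteq> k then H i j k else 0)"
              by simp
          qed
          finally show "(\<Sum>j\<in>S - {i}. \<Sum>k\<in>S - {i}. H i j k) = (\<Sum>j\<in>S. \<Sum>k\<in>S. if i \<noteq> j \<and> i \<noteq> k then H i j k else 0)" .
        qed
        also have "\<dots> = (\<Sum>j\<in>S. \<Sum>k\<in>S. \<Sum>i\<in>S. if i \<noteq> j \<and> i \<noteq> k then H i j k else 0)"
          by (rule trans[OF sum.swap], rule sum.cong[OF refl], rule sum.swap)
        also have "\<dots> = (\<Sum>j\<in>S. \<Sum>k\<in>S. \<Sum>i\<in>S - {j, k}. H i j k)"
        proof ((rule sum.cong[OF refl])+)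
          fix j k
          have "S - {j, k} = {i \<in> S. i \<noteq> j \<and> i \<noteq> k}" by auto
          thus "(\<Sum>i\<in>S. if i \<noteq> j \<and> i \<noteq> k then H i j k else 0) = (\<Sum>i\<in>S - {j, k}. H i j k)"
            using S by (simp only: sum.inter_filter)
        qed
        finally show ?thesis .
      qed
      thus ?thesis by (subst sum.swap) (simp add: sum_distrib_left mult.commute)
    qed
    finally have condsum: "(\<Sum>i\<in>S. \<Sum>c\<in>C. sq_entropy (F i c) g) \<le> 1 / (2 * ln 2) *
       (\<Sum>u\<in>?B. \<Sum>j\<in>S. \<Sum>k\<in>S. d j k u * (\<Sum>i\<in>S - {j, k}. pair_weight (S - {i}) u (u j) (u k))) / real m"
      using m by (simp add: field_simps)

    \<comment> \<open>The chain rule is used once for each choice of the revealed site; a fixed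
      choice would not treat all swaps alike.\<close>
    have "?n * sq_entropy ?B g = (\<Sum>i\<in>S. sq_entropy ?B g)" by simp
    also have "\<dots> \<le> (\<Sum>i\<in>S. (\<Sum>c\<in>C. sq_entropy (F i c) g)
        + 1 / (2 * ln 2) * (1 / ?n * (\<Sum>u\<in>?B. \<Sum>j\<in>S. pair_weight S w (u i) (u j) * d i j u)))"
    proof (intro sum_mono)
      fix i assume i: "i \<in> S"
      have "sq_entropy ?B g \<le> (\<Sum>c\<in>C. sq_entropy (F i c) g) + real (card ?B) / (2 * ln 2) *
          (\<Sum>a\<in>C. \<Sum>b\<in>C. p a * p b * ln (1 / (p a * p b)) * (f i a - f i b)\<^sup>2)"
        using sq_entropy_chain[OF finB finC onto[OF i] Bne, of g]
        unfolding F_def[symmetric] f_def[symmetric] card_site[OF i] .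
      also have "real (card ?B) / (2 * ln 2) * (\<Sum>a\<in>C. \<Sum>b\<in>C. p a * p b * ln (1 / (p a * p b)) * (f i a - f i b)\<^sup>2)
        = 1 / (2 * ln 2) * (real (card ?B) * (\<Sum>a\<in>C. \<Sum>b\<in>C. p a * p b * ln (1 / (p a * p b)) * (f i a - f i b)\<^sup>2))"
        by simp
      also have "\<dots> \<le> 1 / (2 * ln 2) * (1 / ?n * (\<Sum>u\<in>?B. \<Sum>j\<in>S. pair_weight S w (u i) (u j) * d i j u))"
        by (intro mult_left_mono site i) simp
      finally show "sq_entropy ?B g \<le> (\<Sum>c\<in>C. sq_entropy (F i c) g)
        + 1 / (2 * ln 2) * (1 / ?n * (\<Sum>u\<in>?B. \<Sum>j\<in>S. pair_weight S w (u i) (u j) * d i j u))" by simp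
    qed
    also have "\<dots> = (\<Sum>i\<in>S. \<Sum>c\<in>C. sq_entropy (F i c) g)
        + 1 / (2 * ln 2) * (1 / ?n * (\<Sum>i\<in>S. \<Sum>u\<in>?B. \<Sum>j\<in>S. pair_weight S w (u i) (u j) * d i j u))"
      by (simp add: sum.distrib sum_distrib_left)
    also have "(\<Sum>i\<in>S. \<Sum>u\<in>?B. \<Sum>j\<in>S. pair_weight S w (u i) (u j) * d i j u) = D"
      unfolding D_def by (rule sum.swap)
    also have "(\<Sum>i\<in>S. \<Sum>c\<in>C. sq_entropy (F i c) g) + 1 / (2 * ln 2) * (1 / ?n * D)
      \<le> 1 / (2 * ln 2) * ((\<Sum>u\<in>?B. \<Sum>j\<in>S. \<Sum>k\<in>S. d j k u * (\<Sum>i\<in>S - {j, k}. 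
            pair_weight (S - {i}) u (u j) (u k))) / real m + 1 / ?n * D)"
      using condsum by (simp add: distrib_left)
    also have "(\<Sum>u\<in>?B. \<Sum>j\<in>S. \<Sum>k\<in>S. d j k u * (\<Sum>i\<in>S - {j, k}. 
            pair_weight (S - {i}) u (u j) (u k))) / real m + 1 / ?n * D
       = (\<Sum>u\<in>?B. \<Sum>j\<in>S. \<Sum>k\<in>S. d j k u * (pair_weight S w (u j) (u k) / ?n
           + (\<Sum>i\<in>S - {j, k}. pair_weight (S - {i}) u (u j) (u k)) / (?n - 1)))"
    proof -
      have "(\<Sum>u\<in>?B. \<Sum>j\<in>S. \<Sum>k\<in>S. d j k u * E j k u) / real m
          + 1 / ?n * (\<Sum>u\<in>?B. \<Sum>j\<in>S. \<Sum>k\<in>S. P j k u * d j k u)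
          = (\<Sum>u\<in>?B. \<Sum>j\<in>S. \<Sum>k\<in>S. d j k u * (P j k u / ?n + E j k u / real m))"
        for E P :: "'a \<Rightarrow> 'a \<Rightarrow> ('a \<Rightarrow> 'b) \<Rightarrow> real"
        by (simp add: sum_divide_distrib sum.distrib distrib_left mult.commute)
      moreover have "?n - 1 = real m" using n by simp
      ultimately show ?thesis unfolding D_def by presburger
    qed
    also have "1 / (2 * ln 2) * \<dots> \<le> 1 / (2 * ln 2) * D" unfolding D_def
    proof (intro mult_left_mono sum_mono)
      fix u j k assume u: "u \<in> ?B" and jk: "j \<in> S" "k \<in> S"
      show "d j k u * (pair_weight S w (u j) (u k) / ?n + (\<Sum>i\<in>S - {j, k}. pair_weight (S - {i}) u (u j) (u k)) / (?n - 1))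
        \<le> pair_weight S w (u j) (u k) * d j k u"
      proof (cases "u j = u k")
        case False
        from sum_pair_weight_remove[OF S jk False] show ?thesis
          unfolding pw[OF u] using d[of j k u] by (metis mult.commute mult_left_mono)
      qed (simp add: d0)
    qed simp
    finally show ?thesis unfolding D_def d_def .
  qed
qed

section \<open>Multislices and the comparison with the interchange process\<close>

lemma finite_multislice: "finite (multislice L \<kappa>)"
proof (rule finite_subset)
  show "multislice L \<kappa> \<subseteq> {1..num_sites L \<kappa>} \<rightarrow>\<^sub>E {1..L}" by (auto simp: multislice_def)
qed (intro finite_PiE; simp)

text \<open>Sites are matched with pairs of a colour and an index below its multiplicity.
  Nonemptiness is what makes \<open>pmf_of_set\<close> the uniform law.\<close>

lemma multislice_nonempty: "multislice L \<kappa> \<noteq> {}"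
proof -
  let ?n = "num_sites L \<kappa>"
  define T where "T = (SIGMA l:{1..L}. {..<\<kappa> l})"
  have "finite T" "card T = ?n" by (auto simp: T_def num_sites_def)
  then obtain b where b: "bij_betw b {1..?n} T"
    using finite_same_card_bij[of "{1..?n}" T] by auto
  define \<omega> where "\<omega> = restrict (fst \<circ> b) {1..?n}"
  have "\<omega> \<in> {1..?n} \<rightarrow>\<^sub>E {1..L}" using bij_betwE[OF b] by (auto simp: \<omega>_def T_def)
  moreover have "card {i \<in> {1..?n}. \<omega> i = l} = \<kappa> l" if l: "l \<in> {1..L}" for l
  proof -
    have "b ` {i \<in> {1..?n}. \<omega> i = l} = {x \<in> b ` {1..?n}. fst x = l}" by (auto simp: \<omega>_def)
    also have "\<dots> = {l} \<times> {..<\<kappa> l}" using b l by (auto simp: bij_betw_def T_def)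
    finally have "card (b ` {i \<in> {1..?n}. \<omega> i = l}) = \<kappa> l" by (simp add: card_cartesian_product)
    moreover have "inj_on b {i \<in> {1..?n}. \<omega> i = l}"
      by (rule inj_on_subset[OF bij_betw_imp_inj_on[OF b]]) auto
    ultimately show ?thesis by (simp add: card_image)
  qed
  ultimately have "\<omega> \<in> multislice L \<kappa>" by (simp add: multislice_def)
  thus ?thesis by blast
qed

lemma multislice_color_count:
  assumes "\<omega> \<in> multislice L \<kappa>"
  shows "color_count {1..num_sites L \<kappa>} \<omega> l = (if l \<in> {1..L} then \<kappa> l else 0)"
proof (cases "l \<in> {1..L}")
  case False
  hence "{i \<in> {1..num_sites L \<kappa>}. \<omega> i = l} = {}" using assms by (auto simp: multislice_def PiE_iff)
  thus ?thesis using False unfolding color_count_def by (simp only: card.empty if_False)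
qed (use assms in \<open>simp add: multislice_def color_count_def\<close>)

lemma multislice_eq_rearrangements:
  assumes "\<omega> \<in> multislice L \<kappa>"
  shows "multislice L \<kappa> = rearrangements {1..num_sites L \<kappa>} \<omega>"
proof (intro equalityI subsetI)
  fix u assume u: "u \<in> multislice L \<kappa>"
  have "u i = \<omega> i" if "i \<notin> {1..num_sites L \<kappa>}" for i
    using u assms that by (auto simp: multislice_def PiE_iff extensional_def)
  thus "u \<in> rearrangements {1..num_sites L \<kappa>} \<omega>"
    unfolding rearrangements_def using multislice_color_count[OF u] multislice_color_count[OF assms] by simp
next
  fix u assume u: "u \<in> rearrangements {1..num_sites L \<kappa>} \<omega>"
  have "u ` {1..num_sites L \<kappa>} = \<omega> ` {1..num_sites L \<kappa>}" using u by (intro rearrangement_image) auto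
  moreover have "\<omega> ` {1..num_sites L \<kappa>} \<subseteq> {1..L}" using assms by (auto simp: multislice_def)
  ultimately have "u ` {1..num_sites L \<kappa>} \<subseteq> {1..L}" by simp
  moreover have "u i = undefined" if "i \<notin> {1..num_sites L \<kappa>}" for i
    using u assms that by (auto simp: multislice_def PiE_iff extensional_def rearrangements_def)
  moreover have "card {i \<in> {1..num_sites L \<kappa>}. u i = l} = \<kappa> l" if "l \<in> {1..L}" for l
  proof -
    have "color_count {1..num_sites L \<kappa>} u l = \<kappa> l"
      using multislice_color_count[OF assms, of l] color_count_rearrangement[OF u] that by simp
    thus ?thesis by (simp only: color_count_def)
  qed
  ultimately show "u \<in> multislice L \<kappa>" by (auto simp: multislice_def PiE_iff extensional_def)
qed

lemma multislice_swap:
  assumes "\<omega> \<in> multislice L \<kappa>" "i \<in> {1..num_sites L \<kappa>}" "j \<in> {1..num_sites L \<kappa>}"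
  shows "\<omega> \<circ> Transposition.transpose i j \<in> multislice L \<kappa>"
  unfolding multislice_eq_rearrangements[OF assms(1)]
  by (intro rearrangements_permute transpose_permutes assms rearrangements_refl)

lemma expect_eq: "expect L \<kappa> f = (\<Sum>\<omega>\<in>multislice L \<kappa>. f \<omega>) / real (card (multislice L \<kappa>))"
  unfolding expect_def by (rule integral_pmf_of_set[OF multislice_nonempty finite_multislice])

lemma card_multislice_pos: "card (multislice L \<kappa>) > 0"
  by (simp add: card_gt_0_iff finite_multislice multislice_nonempty)

lemma sum_strict_upper_triangle:
  fixes F :: "nat \<Rightarrow> nat \<Rightarrow> real"
  assumes sym: "\<And>i j. i \<in> {1..n} \<Longrightarrow> j \<in> {1..n} \<Longrightarrow> F i j = F j i" and diag: "\<And>i. i \<in> {1..n} \<Longrightarrow> F i i = 0"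
  shows "(\<Sum>i = 1..n. \<Sum>j = i+1..n. F i j) = 1 / 2 * (\<Sum>i = 1..n. \<Sum>j = 1..n. F i j)"
proof -
  have up: "(\<Sum>j = i+1..n. F i j) = (\<Sum>j = 1..n. if i < j then F i j else 0)" if "i \<in> {1..n}" for i
  proof -
    have "{j \<in> {1..n}. i < j} = {i+1..n}" using that by auto
    thus ?thesis using sum.inter_filter[of "{1..n}" "F i" "\<lambda>j. i < j"] by (simp only: finite_atLeastAtMost)
  qed
  have "(\<Sum>i = 1..n. \<Sum>j = 1..n. F i j)
      = (\<Sum>i = 1..n. \<Sum>j = 1..n. (if i < j then F i j else 0) + (if j < i then F j i else 0))"
    by (rule sum.cong[OF refl], rule sum.cong[OF refl]) (use sym diag in \<open>auto simp: linorder_not_less dest: order_antisym\<close>)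
  also have "\<dots> = (\<Sum>i = 1..n. \<Sum>j = 1..n. if i < j then F i j else 0) + (\<Sum>i = 1..n. \<Sum>j = 1..n. if j < i then F j i else 0)"
    by (simp only: sum.distrib)
  also have "(\<Sum>i = 1..n. \<Sum>j = 1..n. if j < i then F j i else 0) = (\<Sum>i = 1..n. \<Sum>j = 1..n. if i < j then F i j else 0)"
    by (rule sum.swap)
  finally show ?thesis using up by simp
qed

lemma grad_refl [simp]: "grad i i f \<omega> = 0"
  by (simp add: grad_def)

lemma grad_commute: "grad i j f \<omega> = grad j i f \<omega>"
  by (simp add: grad_def transpose_commute)

lemma dirichlet_sum:
  "dirichlet L \<kappa> f f = 1 / (4 * real (num_sites L \<kappa>)) *
     (\<Sum>i = 1..num_sites L \<kappa>. \<Sum>j = 1..num_sites L \<kappa>. expect L \<kappa> (\<lambda>\<omega>. (grad i j f \<omega>)\<^sup>2))"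
  unfolding dirichlet_def power2_eq_square
  by (subst sum_strict_upper_triangle) (auto simp: grad_commute expect_eq)

lemma dirichlet_on_sum:
  assumes "\<And>i j. G i j = G j i"
  shows "dirichlet_on L \<kappa> G f f = 1 / 4 *
     (\<Sum>i = 1..num_sites L \<kappa>. \<Sum>j = 1..num_sites L \<kappa>. G i j * expect L \<kappa> (\<lambda>\<omega>. (grad i j f \<omega>)\<^sup>2))"
  unfolding dirichlet_on_def power2_eq_square
  by (subst sum_strict_upper_triangle) (auto simp: grad_commute expect_eq assms)

lemma Ent_eq_sq_entropy:
  assumes "\<And>\<omega>. \<omega> \<in> multislice L \<kappa> \<Longrightarrow> f \<omega> = (g \<omega>)\<^sup>2"
  shows "Ent L \<kappa> f = sq_entropy (multislice L \<kappa>) g / real (card (multislice L \<kappa>))"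
  unfolding Ent_def expect_eq sq_entropy_def using assms card_multislice_pos[of L \<kappa>]
  by (simp add: diff_divide_distrib)

text \<open>Each weight is at most 2 ln (n / \<kappa>min), so 1 / (2 ln 2) becomes 1 / ln 2. The 4
  comes from the normalisation 1 / (4 n) of the Dirichlet form written over ordered pairs.\<close>

lemma mean_field_log_sobolev:
  assumes L: "L \<ge> 1" and \<kappa>: "\<And>l. l \<in> {1..L} \<Longrightarrow> \<kappa> l > 0"
    and f: "\<And>\<omega>. \<omega> \<in> multislice L \<kappa> \<Longrightarrow> 0 \<le> f \<omega>"
  shows "Ent L \<kappa> f \<le> 4 / ln 2 * ln (real (num_sites L \<kappa>) / real (Min (\<kappa> ` {1..L})))
     * dirichlet L \<kappa> (\<lambda>\<omega>. sqrt (f \<omega>)) (\<lambda>\<omega>. sqrt (f \<omega>))"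
proof -
  let ?n = "num_sites L \<kappa>" and ?\<Omega> = "multislice L \<kappa>" and ?m = "Min (\<kappa> ` {1..L})"
  let ?sf = "\<lambda>\<omega>. sqrt (f \<omega>)"
  \<comment> \<open>\<open>weighted_log_sobolev\<close> asks for a function that is nonnegative
    everywhere, whereas f is so only on the multislice.\<close>
  define g where "g \<omega> = sqrt \<bar>f \<omega>\<bar>" for \<omega>
  obtain w where w: "w \<in> ?\<Omega>" using multislice_nonempty by blast
  have "?m \<in> \<kappa> ` {1..L}" using L by (intro Min_in) auto
  hence m: "?m > 0" using \<kappa> by auto
  have "\<kappa> 1 \<le> ?n" unfolding num_sites_def using L by (intro member_le_sum) auto
  hence n: "?n > 0" using \<kappa>[of 1] L by simp
  have N: "card ?\<Omega> > 0" by (rule card_multislice_pos)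
  define T where "T = (\<Sum>u\<in>?\<Omega>. \<Sum>i = 1..?n. \<Sum>j = 1..?n. (grad i j ?sf u)\<^sup>2)"
  have weight: "pair_weight {1..?n} w (u i) (u j) \<le> 2 * ln (real ?n / real ?m)"
    if "u \<in> ?\<Omega>" "i \<in> {1..?n}" "j \<in> {1..?n}" for u i j
  proof -
    have "ln (real ?m) \<le> ln (real (color_count {1..?n} w (u k)))" if k: "k \<in> {1..?n}" for k
    proof -
      have "u k \<in> {1..L}" using \<open>u \<in> ?\<Omega>\<close> k by (auto simp: multislice_def)
      moreover from this have "?m \<le> \<kappa> (u k)" by (intro Min_le) auto
      ultimately show ?thesis using m multislice_color_count[OF w, of "u k"] by (subst ln_le_cancel_iff) auto
    qed
    from this[OF that(2)] this[OF that(3)] show ?thesis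
      using n m by (simp add: pair_weight_def ln_div)
  qed
  have "real ?n * sq_entropy ?\<Omega> g \<le> 1 / (2 * ln 2) * (\<Sum>u\<in>?\<Omega>. \<Sum>i = 1..?n. \<Sum>j = 1..?n.
         pair_weight {1..?n} w (u i) (u j) * (g (u \<circ> Transposition.transpose i j) - g u)\<^sup>2)"
    using weighted_log_sobolev[of "{1..?n}" g w] unfolding multislice_eq_rearrangements[OF w]
    by (simp add: g_def)
  also have "\<dots> \<le> 1 / (2 * ln 2) * (\<Sum>u\<in>?\<Omega>. \<Sum>i = 1..?n. \<Sum>j = 1..?n.
         2 * ln (real ?n / real ?m) * (grad i j ?sf u)\<^sup>2)"
  proof (intro mult_left_mono sum_mono)
    fix u i j assume uij: "u \<in> ?\<Omega>" "i \<in> {1..?n}" "j \<in> {1..?n}"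
    have "g (u \<circ> Transposition.transpose i j) - g u = grad i j ?sf u"
      using f[OF multislice_swap[OF uij]] f[OF uij(1)] by (simp add: g_def grad_def)
    thus "pair_weight {1..?n} w (u i) (u j) * (g (u \<circ> Transposition.transpose i j) - g u)\<^sup>2
        \<le> 2 * ln (real ?n / real ?m) * (grad i j ?sf u)\<^sup>2"
      using weight[OF uij] by (simp add: mult_right_mono)
  qed simp
  also have "\<dots> = 1 / ln 2 * ln (real ?n / real ?m) * T"
    by (simp add: T_def flip: sum_distrib_left)
  finally have le: "real ?n * sq_entropy ?\<Omega> g \<le> 1 / ln 2 * ln (real ?n / real ?m) * T" .
  have dir: "dirichlet L \<kappa> ?sf ?sf = T / (4 * real ?n * real (card ?\<Omega>))"
  proof -
    have "(\<Sum>i = 1..?n. \<Sum>j = 1..?n. \<Sum>u\<in>?\<Omega>. (grad i j ?sf u)\<^sup>2) = T"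
    proof -
      have "(\<Sum>i = 1..?n. \<Sum>j = 1..?n. \<Sum>u\<in>?\<Omega>. (grad i j ?sf u)\<^sup>2)
        = (\<Sum>i = 1..?n. \<Sum>u\<in>?\<Omega>. \<Sum>j = 1..?n. (grad i j ?sf u)\<^sup>2)"
        by (rule sum.cong[OF refl], rule sum.swap)
      also have "\<dots> = T" unfolding T_def by (rule sum.swap)
      finally show ?thesis .
    qed
    thus ?thesis unfolding dirichlet_sum expect_eq by (simp flip: sum_divide_distrib)
  qed
  have "Ent L \<kappa> f = real ?n * sq_entropy ?\<Omega> g / (real ?n * real (card ?\<Omega>))"
    using n f by (subst Ent_eq_sq_entropy[of L \<kappa> f g]) (auto simp: g_def)
  also have "\<dots> \<le> 1 / ln 2 * ln (real ?n / real ?m) * T / (real ?n * real (card ?\<Omega>))"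
    using le by (intro divide_right_mono) auto
  also have "\<dots> = 4 / ln 2 * ln (real ?n / real ?m) * dirichlet L \<kappa> ?sf ?sf"
    unfolding dir using n N by simp
  finally show ?thesis .
qed

section \<open>Lifting functions from the multislice to permutations\<close>

lemma num_sites_one: "num_sites n (\<lambda>_. 1) = n"
  by (simp add: num_sites_def)

text \<open>Members of this multislice are \<open>undefined\<close> off the sites; extending by the
  identity gives a permutation that can be composed with configurations.\<close>

lemma multislice_one_permutes:
  assumes "\<sigma> \<in> multislice n (\<lambda>_. 1)"
  shows "(\<lambda>i. if i \<in> {1..n} then \<sigma> i else i) permutes {1..n}"
proof -
  have \<sigma>: "\<sigma> \<in> {1..n} \<rightarrow>\<^sub>E {1..n}" "\<And>l. l \<in> {1..n} \<Longrightarrow> card {i \<in> {1..n}. \<sigma> i = l} = 1"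
    using assms unfolding multislice_def num_sites_one by blast+
  have "\<sigma> ` {1..n} = {1..n}"
  proof (intro equalityI subsetI)
    fix l assume "l \<in> {1..n}"
    hence "{i \<in> {1..n}. \<sigma> i = l} \<noteq> {}" using \<sigma>(2)[of l] by (metis card.empty zero_neq_one)
    thus "l \<in> \<sigma> ` {1..n}" by auto
  qed (use \<sigma> in auto)
  hence "bij_betw \<sigma> {1..n} {1..n}" by (simp add: bij_betw_def eq_card_imp_inj_on)
  moreover have "bij_betw (\<lambda>i. if i \<in> {1..n} then \<sigma> i else i) {1..n} {1..n} = bij_betw \<sigma> {1..n} {1..n}"
    by (rule bij_betw_cong) simp
  ultimately have "bij_betw (\<lambda>i. if i \<in> {1..n} then \<sigma> i else i) {1..n} {1..n}" by blast
  thus ?thesis by (rule bij_imp_permutes) auto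
qed

text \<open>
  A function on the multislice is lifted to permutations through an arbitrary base configuration;
  averaging over all base configurations avoids counting the fibres of the projection.
\<close>
lemma comparison_lift:
  assumes n: "n = num_sites L \<kappa>"
    and cmp: "\<And>f. dirichlet n (\<lambda>_. 1) f f \<le> c * dirichlet_on n (\<lambda>_. 1) G f f"
  shows "dirichlet L \<kappa> F F \<le> c * dirichlet_on L \<kappa> G F F"
proof -
  let ?\<Omega> = "multislice L \<kappa>" and ?P = "multislice n (\<lambda>_. 1)"
  define pr where "pr \<sigma> i = (if i \<in> {1..n} then \<sigma> i else i)" for \<sigma> :: "nat \<Rightarrow> nat" and i
  define lift where "lift w \<sigma> = F (w \<circ> pr \<sigma>)" for w \<sigma>
  have N: "real (card ?\<Omega>) > 0" "real (card ?P) > 0" using card_multislice_pos by auto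
  have avg: "(\<Sum>w\<in>?\<Omega>. expect n (\<lambda>_. 1) (\<lambda>\<sigma>. grad i j (lift w) \<sigma> * grad i j (lift w) \<sigma>))
      = real (card ?\<Omega>) * expect L \<kappa> (\<lambda>\<omega>. grad i j F \<omega> * grad i j F \<omega>)"
    if ij: "i \<in> {1..n}" "j \<in> {1..n}" for i j
  proof -
    \<comment> \<open>Swaps act on the right and w on the left, so lifting commutes with swaps and
      the gradient of a lift is the lift of the gradient.\<close>
    have "pr (\<sigma> \<circ> Transposition.transpose i j) = pr \<sigma> \<circ> Transposition.transpose i j" for \<sigma>
      using ij by (auto simp: pr_def fun_eq_iff Transposition.transpose_def)
    hence gr: "grad i j (lift w) \<sigma> = grad i j F (w \<circ> pr \<sigma>)" for w \<sigma>
      by (simp add: grad_def lift_def comp_assoc)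
    have perm: "pr \<sigma> permutes {1..n}" if "\<sigma> \<in> ?P" for \<sigma>
      using multislice_one_permutes[OF that] by (simp add: pr_def[abs_def])
    obtain v where v: "v \<in> ?\<Omega>" using multislice_nonempty by blast
    have "(\<Sum>w\<in>?\<Omega>. \<Sum>\<sigma>\<in>?P. grad i j (lift w) \<sigma> * grad i j (lift w) \<sigma>)
        = (\<Sum>\<sigma>\<in>?P. \<Sum>w\<in>?\<Omega>. grad i j F (w \<circ> pr \<sigma>) * grad i j F (w \<circ> pr \<sigma>))"
      unfolding gr by (rule sum.swap)
    \<comment> \<open>For a fixed permutation, composition with it is a bijection of the multislice,
      so the inner sum does not depend on it.\<close>
    also have "\<dots> = (\<Sum>\<sigma>\<in>?P. \<Sum>w\<in>?\<Omega>. grad i j F w * grad i j F w)"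
      unfolding multislice_eq_rearrangements[OF v] n[symmetric]
      by (rule sum.cong[OF refl], rule sum_rearrangements_permute[where F = "\<lambda>w. grad i j F w * grad i j F w"], rule perm)
    finally have "(\<Sum>w\<in>?\<Omega>. \<Sum>\<sigma>\<in>?P. grad i j (lift w) \<sigma> * grad i j (lift w) \<sigma>)
        = real (card ?P) * (\<Sum>w\<in>?\<Omega>. grad i j F w * grad i j F w)" by simp
    thus ?thesis using N unfolding expect_eq by (simp add: sum_divide_distrib[symmetric])
  qed
  have "real (card ?\<Omega>) * dirichlet L \<kappa> F F = (\<Sum>w\<in>?\<Omega>. dirichlet n (\<lambda>_. 1) (lift w) (lift w))"
  proof -
    have "(\<Sum>w\<in>?\<Omega>. dirichlet n (\<lambda>_. 1) (lift w) (lift w)) = 1 / (2 * real n) * (\<Sum>i = 1..n. \<Sum>j = i+1..n.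
        \<Sum>w\<in>?\<Omega>. expect n (\<lambda>_. 1) (\<lambda>\<sigma>. grad i j (lift w) \<sigma> * grad i j (lift w) \<sigma>))"
      unfolding dirichlet_def num_sites_one sum_distrib_left[symmetric]
      by (simp only: sum.swap[of _ _ ?\<Omega>])
    also have "\<dots> = 1 / (2 * real n) * (\<Sum>i = 1..n. \<Sum>j = i+1..n.
        real (card ?\<Omega>) * expect L \<kappa> (\<lambda>\<omega>. grad i j F \<omega> * grad i j F \<omega>))"
      by (intro arg_cong[where f = "\<lambda>x. _ * x"] sum.cong refl avg) auto
    also have "\<dots> = real (card ?\<Omega>) * dirichlet L \<kappa> F F"
      unfolding dirichlet_def n[symmetric] by (simp add: sum_distrib_left mult_ac)
    finally show ?thesis ..
  qed
  also have "\<dots> \<le> (\<Sum>w\<in>?\<Omega>. c * dirichlet_on n (\<lambda>_. 1) G (lift w) (lift w))"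
    by (intro sum_mono cmp)
  also have "\<dots> = real (card ?\<Omega>) * (c * dirichlet_on L \<kappa> G F F)"
  proof -
    have "(\<Sum>w\<in>?\<Omega>. dirichlet_on n (\<lambda>_. 1) G (lift w) (lift w)) = 1 / 2 * (\<Sum>i = 1..n. \<Sum>j = i+1..n.
        G i j * (\<Sum>w\<in>?\<Omega>. expect n (\<lambda>_. 1) (\<lambda>\<sigma>. grad i j (lift w) \<sigma> * grad i j (lift w) \<sigma>)))"
      unfolding dirichlet_on_def num_sites_one sum_distrib_left[symmetric]
      by (simp only: sum.swap[of _ _ ?\<Omega>] sum_distrib_left[symmetric])
    also have "\<dots> = 1 / 2 * (\<Sum>i = 1..n. \<Sum>j = i+1..n.
        G i j * (real (card ?\<Omega>) * expect L \<kappa> (\<lambda>\<omega>. grad i j F \<omega> * grad i j F \<omega>)))"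
      by (intro arg_cong2[where f = "(*)"] sum.cong refl avg) auto
    also have "\<dots> = real (card ?\<Omega>) * dirichlet_on L \<kappa> G F F"
      unfolding dirichlet_on_def n[symmetric] by (simp add: sum_distrib_left mult_ac)
    finally show ?thesis by (simp add: sum_distrib_left[symmetric])
  qed
  finally show ?thesis using N by simp
qed

section \<open>Lower bounds\<close>

lemma real_card_filter: "finite B \<Longrightarrow> real (card {u \<in> B. P u}) = (\<Sum>u\<in>B. if P u then 1 else 0)"
  by (simp flip: sum.inter_filter)

lemma sum_occupancy:
  assumes S: "finite S" "i \<in> S"
  shows "(\<Sum>u\<in>rearrangements S w. if u i = c then 1 else 0 :: real)
    = real (card (rearrangements S w)) * real (color_count S w c) / real (card S)"
proof -
  let ?B = "rearrangements S w"
  have fin: "finite ?B" using S(1) by (rule finite_rearrangements)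
  have "real (card {u \<in> ?B. u i = c} * card S) = real (card ?B * color_count S w c)"
    unfolding card_rearrangements_site[OF S] ..
  moreover have "card S > 0" using S by (auto simp: card_gt_0_iff)
  moreover have "(\<Sum>u\<in>?B. if u i = c then 1 else 0 :: real) = real (card {u \<in> ?B. u i = c})"
    by (simp only: real_card_filter[OF fin])
  ultimately show ?thesis by (simp add: field_simps)
qed

text \<open>By exchangeability the joint moment is the same for every second site different from i.
  Summing over all second sites gives the constant number of sites of colour c, hence one linear
  equation for this moment.\<close>

lemma sum_pair_occupancy:
  fixes X :: "'a \<Rightarrow> ('a \<Rightarrow> 'b) \<Rightarrow> real" and c :: 'b
  assumes S: "finite S" and i: "i \<in> S" and j: "j \<in> S" and "i \<noteq> j"
  defines "X \<equiv> \<lambda>i u. if u i = c then 1 else 0"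
  shows "(\<Sum>u\<in>rearrangements S w. X i u * X j u)
    = real (card (rearrangements S w)) * real (color_count S w c) * (real (color_count S w c) - 1)
        / (real (card S) * (real (card S) - 1))"
proof -
  let ?B = "rearrangements S w" and ?k = "real (color_count S w c)" and ?n = "real (card S)"
  define Q where "Q k = (\<Sum>u\<in>?B. X i u * X k u)" for k
  have "card S \<ge> 2" using card_mono[of S "{i, j}"] assms by simp
  hence n: "?n \<ge> 2" by simp
  have Qk: "Q k = Q j" if k: "k \<in> S - {i}" for k
  proof -
    have "(\<Sum>u\<in>?B. (\<lambda>v. X i v * X k v) (u \<circ> Transposition.transpose j k)) = Q k"
      unfolding Q_def using k j by (intro sum_rearrangements_permute transpose_permutes) auto
    moreover have "Transposition.transpose j k i = i" using k \<open>i \<noteq> j\<close> by (auto simp: Transposition.transpose_def)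
    hence "X i (u \<circ> Transposition.transpose j k) * X k (u \<circ> Transposition.transpose j k) = X i u * X j u" for u
      by (simp add: X_def)
    ultimately show ?thesis by (simp add: Q_def)
  qed
  have Qi: "Q i = real (card ?B) * ?k / ?n"
  proof -
    have "Q i = (\<Sum>u\<in>?B. X i u)" unfolding Q_def by (rule sum.cong[OF refl]) (simp add: X_def)
    thus ?thesis using sum_occupancy[OF S i, where w = w and c = c] by (simp only: X_def)
  qed
  have "(\<Sum>k\<in>S. Q k) = (\<Sum>u\<in>?B. \<Sum>k\<in>S. X i u * X k u)" unfolding Q_def by (rule sum.swap)
  also have "\<dots> = (\<Sum>u\<in>?B. X i u * ?k)"
  proof (rule sum.cong[OF refl])
    fix u assume u: "u \<in> ?B"
    have "(\<Sum>k\<in>S. X k u) = real (color_count S u c)"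
      by (simp only: X_def color_count_def real_card_filter[OF S])
    also have "\<dots> = ?k" by (simp only: color_count_rearrangement[OF u])
    finally show "(\<Sum>k\<in>S. X i u * X k u) = X i u * ?k" by (simp flip: sum_distrib_left)
  qed
  also have "\<dots> = real (card ?B) * ?k / ?n * ?k"
    using sum_occupancy[OF S i, where w = w and c = c] by (simp add: X_def flip: sum_distrib_right)
  finally have "(\<Sum>k\<in>S. Q k) = real (card ?B) * ?k / ?n * ?k" .
  moreover have "(\<Sum>k\<in>S. Q k) = Q i + (?n - 1) * Q j"
  proof -
    have "(\<Sum>k\<in>S. Q k) = Q i + (\<Sum>k\<in>S - {i}. Q k)" using S i by (rule sum.remove)
    also have "(\<Sum>k\<in>S - {i}. Q k) = real (card (S - {i})) * Q j" using Qk by simp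
    also have "real (card (S - {i})) = ?n - 1" using S i n by (simp add: of_nat_diff)
    finally show ?thesis .
  qed
  ultimately have "(?n - 1) * Q j = real (card ?B) * ?k / ?n * (?k - 1)"
    unfolding Qi right_diff_distrib mult_1_right by linarith
  hence "Q j = real (card ?B) * ?k / ?n * (?k - 1) / (?n - 1)" using n by (simp add: eq_divide_eq mult_ac)
  thus ?thesis using n by (simp add: Q_def)
qed

definition occupation :: "nat \<Rightarrow> (nat \<Rightarrow> real) \<Rightarrow> nat \<Rightarrow> (nat \<Rightarrow> nat) \<Rightarrow> real" where
  "occupation n \<phi> l \<omega> = (\<Sum>i = 1..n. \<phi> i * (if \<omega> i = l then 1 else 0))"

text \<open>The probability of a colour of multiplicity k at one site minus its probability at two
  distinct sites. On vectors of sum zero the covariance matrix of the occupation variables is this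
  multiple of the identity.\<close>

definition pair_var :: "nat \<Rightarrow> nat \<Rightarrow> real" where
  "pair_var n k = real k * (real n - real k) / (real n * (real n - 1))"

lemma expect_sum: "expect L \<kappa> (\<lambda>\<omega>. \<Sum>i\<in>I. F i \<omega>) = (\<Sum>i\<in>I. expect L \<kappa> (F i))"
  unfolding expect_eq sum_divide_distrib[symmetric] by (rule arg_cong[where f = "\<lambda>x. x / _"], rule sum.swap)

lemma expect_cmult: "expect L \<kappa> (\<lambda>\<omega>. c * F \<omega>) = c * expect L \<kappa> F"
  unfolding expect_eq by (simp flip: sum_distrib_left)

context
  fixes L n l :: nat and \<kappa> :: "nat \<Rightarrow> nat"
  assumes n: "n = num_sites L \<kappa>" "n \<ge> 2" and l: "l \<in> {1..L}"
begin

lemma expect_site: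
  assumes "i \<in> {1..n}"
  shows "expect L \<kappa> (\<lambda>\<omega>. if \<omega> i = l then 1 else 0) = real (\<kappa> l) / real n"
proof -
  obtain w where w: "w \<in> multislice L \<kappa>" using multislice_nonempty by blast
  show ?thesis
    using sum_occupancy[where S = "{1..n}" and i = i and w = w and c = l] assms l card_multislice_pos[of L \<kappa>] multislice_color_count[OF w, of l]
    unfolding expect_eq multislice_eq_rearrangements[OF w] n(1)[symmetric] by simp
qed

lemma expect_pair:
  assumes "i \<in> {1..n}" "j \<in> {1..n}"
  shows "expect L \<kappa> (\<lambda>\<omega>. (if \<omega> i = l then 1 else 0) * (if \<omega> j = l then 1 else 0))
    = (if i = j then real (\<kappa> l) / real n else real (\<kappa> l) * (real (\<kappa> l) - 1) / (real n * (real n - 1)))"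
proof (cases "i = j")
  case True
  have "(\<lambda>\<omega>. (if \<omega> i = l then 1 else 0) * (if \<omega> i = l then 1 else 0)) = (\<lambda>\<omega>. if \<omega> i = l then 1 else 0 :: real)"
    by (simp add: fun_eq_iff)
  thus ?thesis unfolding True[symmetric] using expect_site[OF assms(1)] by (simp only: if_True simp_thms)
next
  case False
  obtain w where w: "w \<in> multislice L \<kappa>" using multislice_nonempty by blast
  show ?thesis
    using sum_pair_occupancy[where S = "{1..n}" and i = i and j = j and w = w and c = l] assms False l card_multislice_pos[of L \<kappa>] multislice_color_count[OF w, of l]
    unfolding expect_eq multislice_eq_rearrangements[OF w] n(1)[symmetric] by simp
qed

lemma expect_occupation: "expect L \<kappa> (occupation n \<phi> l) = real (\<kappa> l) / real n * (\<Sum>i = 1..n. \<phi> i)"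
proof -
  have "expect L \<kappa> (occupation n \<phi> l) = (\<Sum>i = 1..n. \<phi> i * expect L \<kappa> (\<lambda>\<omega>. if \<omega> i = l then 1 else 0))"
    unfolding occupation_def[abs_def] expect_sum expect_cmult ..
  also have "\<dots> = (\<Sum>i = 1..n. \<phi> i * (real (\<kappa> l) / real n))"
    by (rule sum.cong[OF refl]) (simp only: expect_site)
  also have "\<dots> = real (\<kappa> l) / real n * (\<Sum>i = 1..n. \<phi> i)"
    unfolding sum_distrib_right[symmetric] by (rule mult.commute)
  finally show ?thesis .
qed

lemma pair_var_eq: 
  "real (\<kappa> l) / real n - real (\<kappa> l) * (real (\<kappa> l) - 1) / (real n * (real n - 1)) = pair_var n (\<kappa> l)"
proof -
  have "real n > 0" "real n - 1 > 0" using n(2) by auto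
  thus ?thesis unfolding pair_var_def by (simp add: divide_simps) (simp add: algebra_simps)
qed

text \<open>The second moments are a constant q plus \<open>pair_var\<close> on the diagonal; the
  constant part vanishes on coefficients of sum zero.\<close>

lemma expect_occupation_sq:
  assumes "(\<Sum>i = 1..n. \<phi> i) = 0"
  shows "expect L \<kappa> (\<lambda>\<omega>. (occupation n \<phi> l \<omega>)\<^sup>2) = pair_var n (\<kappa> l) * (\<Sum>i = 1..n. (\<phi> i)\<^sup>2)"
proof -
  define q where "q = real (\<kappa> l) * (real (\<kappa> l) - 1) / (real n * (real n - 1))"
  define X where "X i \<omega> = (if \<omega> i = l then 1 else 0 :: real)" for i and \<omega> :: "nat \<Rightarrow> nat"
  have EX: "expect L \<kappa> (\<lambda>\<omega>. X i \<omega> * X j \<omega>) = q + (if i = j then pair_var n (\<kappa> l) else 0)"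
    if "i \<in> {1..n}" "j \<in> {1..n}" for i j
    using expect_pair[OF that] pair_var_eq by (simp add: X_def q_def)
  have "expect L \<kappa> (\<lambda>\<omega>. (occupation n \<phi> l \<omega>)\<^sup>2)
      = expect L \<kappa> (\<lambda>\<omega>. \<Sum>i = 1..n. \<Sum>j = 1..n. (\<phi> i * \<phi> j) * (X i \<omega> * X j \<omega>))"
    unfolding occupation_def power2_eq_square sum_product X_def[symmetric] by (simp only: mult_ac)
  also have "\<dots> = (\<Sum>i = 1..n. \<Sum>j = 1..n. (\<phi> i * \<phi> j) * expect L \<kappa> (\<lambda>\<omega>. X i \<omega> * X j \<omega>))"
    unfolding expect_sum expect_cmult ..
  also have "\<dots> = (\<Sum>i = 1..n. \<Sum>j = 1..n. q * (\<phi> i * \<phi> j) + (if i = j then pair_var n (\<kappa> l) * (\<phi> i)\<^sup>2 else 0))"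
    by (rule sum.cong[OF refl], rule sum.cong[OF refl]) (simp add: EX algebra_simps power2_eq_square)
  also have "\<dots> = q * ((\<Sum>i = 1..n. \<phi> i) * (\<Sum>i = 1..n. \<phi> i)) + pair_var n (\<kappa> l) * (\<Sum>i = 1..n. (\<phi> i)\<^sup>2)"
  proof -
    have "(\<Sum>i = 1..n. \<Sum>j = 1..n. q * (\<phi> i * \<phi> j)) = q * ((\<Sum>i = 1..n. \<phi> i) * (\<Sum>i = 1..n. \<phi> i))"
      unfolding sum_product by (simp only: sum_distrib_left)
    moreover have "(\<Sum>i = 1..n. \<Sum>j = 1..n. if i = j then pair_var n (\<kappa> l) * (\<phi> i)\<^sup>2 else 0) = pair_var n (\<kappa> l) * (\<Sum>i = 1..n. (\<phi> i)\<^sup>2)"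
      by (simp add: sum_distrib_left)
    ultimately show ?thesis by (simp only: sum.distrib)
  qed
  finally show ?thesis using assms by simp
qed

text \<open>The swap changes the statistic by the difference of the two coefficients times the
  difference of the two occupation variables. Its size is again governed by \<open>pair_var\<close>,
  which therefore cancels between variance and energy.\<close>

lemma expect_grad_occupation:
  assumes ij: "i \<in> {1..n}" "j \<in> {1..n}"
  shows "expect L \<kappa> (\<lambda>\<omega>. (grad i j (occupation n \<phi> l) \<omega>)\<^sup>2) = 2 * pair_var n (\<kappa> l) * (\<phi> i - \<phi> j)\<^sup>2"
proof (cases "i = j")
  case True
  thus ?thesis by (simp add: expect_eq)
next
  case False
  define X where "X i \<omega> = (if \<omega> i = l then 1 else 0 :: real)" for i and \<omega> :: "nat \<Rightarrow> nat"
  let ?t = "Transposition.transpose i j"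
  have "grad i j (occupation n \<phi> l) \<omega> = (\<phi> j - \<phi> i) * (X i \<omega> - X j \<omega>)" for \<omega>
  proof -
    have "occupation n \<phi> l (\<omega> \<circ> ?t) = (\<Sum>k = 1..n. (\<lambda>k. \<phi> (?t k) * X k \<omega>) (?t k))"
      by (simp add: occupation_def X_def)
    also have "\<dots> = (\<Sum>k = 1..n. \<phi> (?t k) * X k \<omega>)"
      using permutes_imp_bij[OF transpose_permutes[OF ij]] by (rule sum.reindex_bij_betw)
    finally have "grad i j (occupation n \<phi> l) \<omega> = (\<Sum>k = 1..n. (\<phi> (?t k) - \<phi> k) * X k \<omega>)"
      by (simp add: grad_def occupation_def X_def sum_subtractf left_diff_distrib)
    also have "\<dots> = (\<Sum>k\<in>{i, j}. (\<phi> (?t k) - \<phi> k) * X k \<omega>)"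
      using ij by (intro sum.mono_neutral_right) auto
    also have "\<dots> = (\<phi> j - \<phi> i) * (X i \<omega> - X j \<omega>)" using False by (simp add: algebra_simps)
    finally show ?thesis .
  qed
  hence "expect L \<kappa> (\<lambda>\<omega>. (grad i j (occupation n \<phi> l) \<omega>)\<^sup>2)
      = (\<phi> j - \<phi> i)\<^sup>2 * expect L \<kappa> (\<lambda>\<omega>. (X i \<omega> - X j \<omega>)\<^sup>2)"
    by (simp add: power_mult_distrib expect_cmult)
  also have "expect L \<kappa> (\<lambda>\<omega>. (X i \<omega> - X j \<omega>)\<^sup>2)
      = expect L \<kappa> (\<lambda>\<omega>. X i \<omega> * X i \<omega>) + expect L \<kappa> (\<lambda>\<omega>. X j \<omega> * X j \<omega>) - 2 * expect L \<kappa> (\<lambda>\<omega>. X i \<omega> * X j \<omega>)"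
  proof -
    have "(X i \<omega> - X j \<omega>)\<^sup>2 = X i \<omega> * X i \<omega> + X j \<omega> * X j \<omega> - 2 * (X i \<omega> * X j \<omega>)" for \<omega>
      by (simp add: power2_eq_square algebra_simps)
    thus ?thesis unfolding expect_eq
      by (simp only: sum.distrib sum_subtractf add_divide_distrib diff_divide_distrib
            sum_distrib_left[symmetric] times_divide_eq_right)
  qed
  also have "\<dots> = 2 * pair_var n (\<kappa> l)"
    unfolding X_def expect_pair[OF ij] expect_pair[OF ij(1) ij(1)] expect_pair[OF ij(2) ij(2)]
    using False pair_var_eq by simp
  finally show ?thesis by (simp add: power2_commute[of "\<phi> j"])
qed

lemma dirichlet_on_occupation:
  assumes "\<And>i j. G i j = G j i"
  shows "dirichlet_on L \<kappa> G (occupation n \<phi> l) (occupation n \<phi> l)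
    = pair_var n (\<kappa> l) / 2 * (\<Sum>i = 1..n. \<Sum>j = 1..n. G i j * (\<phi> i - \<phi> j)\<^sup>2)"
proof -
  have "dirichlet_on L \<kappa> G (occupation n \<phi> l) (occupation n \<phi> l)
     = 1 / 4 * (\<Sum>i = 1..n. \<Sum>j = 1..n. G i j * (2 * pair_var n (\<kappa> l) * (\<phi> i - \<phi> j)\<^sup>2))"
    unfolding dirichlet_on_sum[of G, OF assms] n(1)[symmetric]
    by (rule arg_cong[where f = "\<lambda>x. 1 / 4 * x"], rule sum.cong[OF refl], rule sum.cong[OF refl])
       (simp add: expect_grad_occupation)
  also have "\<dots> = 1 / 4 * (\<Sum>i = 1..n. \<Sum>j = 1..n. (2 * pair_var n (\<kappa> l)) * (G i j * (\<phi> i - \<phi> j)\<^sup>2))"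
    by (simp only: mult_ac)
  also have "\<dots> = pair_var n (\<kappa> l) / 2 * (\<Sum>i = 1..n. \<Sum>j = 1..n. G i j * (\<phi> i - \<phi> j)\<^sup>2)"
    unfolding sum_distrib_left[symmetric] by simp
  finally show ?thesis .
qed

end

section \<open>Linearisation of the log-Sobolev inequality\<close>

lemma dirichlet_on_cong:
  assumes "\<And>\<omega>. \<omega> \<in> multislice L \<kappa> \<Longrightarrow> f \<omega> = g \<omega>"
  shows "dirichlet_on L \<kappa> G f f = dirichlet_on L \<kappa> G g g"
  unfolding dirichlet_on_def expect_eq grad_def
  by (intro arg_cong2[where f = "(*)"] arg_cong2[where f = "(/)"] sum.cong refl) (auto simp: assms multislice_swap)

lemma dirichlet_on_affine: "dirichlet_on L \<kappa> G (\<lambda>\<omega>. 1 + \<epsilon> * h \<omega>) (\<lambda>\<omega>. 1 + \<epsilon> * h \<omega>) = \<epsilon>\<^sup>2 * dirichlet_on L \<kappa> G h h"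
proof -
  have "grad i j (\<lambda>\<omega>. 1 + \<epsilon> * h \<omega>) \<omega> * grad i j (\<lambda>\<omega>. 1 + \<epsilon> * h \<omega>) \<omega> = \<epsilon>\<^sup>2 * (grad i j h \<omega> * grad i j h \<omega>)" for i j \<omega>
    by (simp add: grad_def power2_eq_square algebra_simps)
  thus ?thesis unfolding dirichlet_on_def expect_eq
    by (simp add: sum_distrib_left[symmetric] times_divide_eq_right[symmetric] mult.left_commute[of _ "\<epsilon>\<^sup>2"] del: times_divide_eq_right)
qed

text \<open>Insert the square of 1 + \<epsilon> h. Its terms x^2 ln (x^2) are 2 \<epsilon> h + 3
  \<epsilon>^2 h^2 to second order, and the normalising term subtracts one second moment of h times
  \<epsilon>^2, which leaves the factor 2.\<close>

lemma log_sobolev_imp_poincare: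
  assumes ls: "\<And>f. (\<forall>\<omega>\<in>multislice L \<kappa>. 0 \<le> f \<omega>) \<Longrightarrow>
      Ent L \<kappa> f \<le> \<tau> * dirichlet_on L \<kappa> G (\<lambda>\<omega>. sqrt (f \<omega>)) (\<lambda>\<omega>. sqrt (f \<omega>))"
    and h: "expect L \<kappa> h = 0"
  shows "2 * expect L \<kappa> (\<lambda>\<omega>. (h \<omega>)\<^sup>2) \<le> \<tau> * dirichlet_on L \<kappa> G h h"
proof -
  let ?\<Omega> = "multislice L \<kappa>"
  let ?N = "real (card ?\<Omega>)"
  have N: "?N > 0" using card_multislice_pos by simp
  define v where "v = expect L \<kappa> (\<lambda>\<omega>. (h \<omega>)\<^sup>2)"
  have v: "v \<ge> 0" unfolding v_def expect_eq by (simp add: sum_nonneg)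
  have sums: "(\<Sum>\<omega>\<in>?\<Omega>. h \<omega>) = 0" "(\<Sum>\<omega>\<in>?\<Omega>. (h \<omega>)\<^sup>2) = ?N * v"
    using h N by (simp_all add: expect_eq v_def)
  define k where "k x = x\<^sup>2 * ln (x\<^sup>2)" for x :: real
  \<comment> \<open>Subtracting the linear term is free, as h has mean zero, and makes each summand
    converge separately.\<close>
  define R where "R \<epsilon> = (\<Sum>\<omega>\<in>?\<Omega>. (k (1 + \<epsilon> * h \<omega>) - 2 * (\<epsilon> * h \<omega>)) / \<epsilon>\<^sup>2) / ?N
      - (1 + \<epsilon>\<^sup>2 * v) * ln (1 + \<epsilon>\<^sup>2 * v) / \<epsilon>\<^sup>2" for \<epsilon>
  have k_lim: "((\<lambda>\<epsilon>. (k (1 + \<epsilon> * a) - 2 * (\<epsilon> * a)) / \<epsilon>\<^sup>2) \<longlongrightarrow> 3 * a\<^sup>2) (at_right 0)" for a :: real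
  proof (cases "a = 0")
    case False
    have "((\<lambda>u::real. (k (1 + u) - 2 * u) / u\<^sup>2) \<longlongrightarrow> 3) (at 0)"
      unfolding k_def by real_asymp
    moreover have "filterlim (\<lambda>\<epsilon>. \<epsilon> * a) (at 0) (at_right 0)"
      using False by real_asymp
    ultimately have "((\<lambda>\<epsilon>. (k (1 + \<epsilon> * a) - 2 * (\<epsilon> * a)) / (\<epsilon> * a)\<^sup>2) \<longlongrightarrow> 3) (at_right 0)"
      by (rule filterlim_compose)
    hence "((\<lambda>\<epsilon>. (k (1 + \<epsilon> * a) - 2 * (\<epsilon> * a)) / (\<epsilon> * a)\<^sup>2 * a\<^sup>2) \<longlongrightarrow> 3 * a\<^sup>2) (at_right 0)"
      by (intro tendsto_mult tendsto_const)
    thus ?thesis using False by (simp add: power_mult_distrib)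
  qed (simp add: k_def)
  have v_lim: "((\<lambda>\<epsilon>. (1 + \<epsilon>\<^sup>2 * v) * ln (1 + \<epsilon>\<^sup>2 * v) / \<epsilon>\<^sup>2) \<longlongrightarrow> v) (at_right 0)"
  proof (cases "v = 0")
    case False
    hence "v > 0" using v by simp
    thus ?thesis by real_asymp
  qed simp
  have "(R \<longlongrightarrow> (\<Sum>\<omega>\<in>?\<Omega>. 3 * (h \<omega>)\<^sup>2) / ?N - v) (at_right 0)"
    unfolding R_def using N by (intro tendsto_diff tendsto_divide tendsto_sum k_lim v_lim tendsto_const) auto
  moreover have "(\<Sum>\<omega>\<in>?\<Omega>. 3 * (h \<omega>)\<^sup>2) / ?N - v = 2 * v"
    using N by (simp add: sum_distrib_left[symmetric] sums)
  ultimately have lim: "(R \<longlongrightarrow> 2 * v) (at_right 0)" by simp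
  \<comment> \<open>Positivity makes the square root of the test function equal to 1 + \<epsilon> h,
    whose energy is exactly \<epsilon>^2 times that of h.\<close>
  have "eventually (\<lambda>\<epsilon>. \<forall>\<omega>\<in>?\<Omega>. 0 < 1 + \<epsilon> * h \<omega>) (at_right 0)"
  proof (rule eventually_ball_finite[OF finite_multislice], rule ballI)
    fix \<omega>
    have "((\<lambda>\<epsilon>. 1 + \<epsilon> * h \<omega>) \<longlongrightarrow> 1 + 0 * h \<omega>) (at_right 0)" by (intro tendsto_intros)
    thus "eventually (\<lambda>\<epsilon>. 0 < 1 + \<epsilon> * h \<omega>) (at_right 0)" by (rule order_tendstoD) simp
  qed
  moreover have "eventually (\<lambda>\<epsilon>::real. 0 < \<epsilon>) (at_right 0)" by (simp add: eventually_at_right_less)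
  ultimately have "eventually (\<lambda>\<epsilon>. R \<epsilon> \<le> \<tau> * dirichlet_on L \<kappa> G h h) (at_right 0)"
  proof eventually_elim
    case (elim \<epsilon>)
    define f where "f \<omega> = (1 + \<epsilon> * h \<omega>)\<^sup>2" for \<omega>
    have "f \<omega> = 1 + 2 * \<epsilon> * h \<omega> + \<epsilon>\<^sup>2 * (h \<omega>)\<^sup>2" for \<omega>
      by (simp add: f_def power2_eq_square algebra_simps)
    hence "expect L \<kappa> f = (\<Sum>\<omega>\<in>?\<Omega>. 1 + 2 * \<epsilon> * h \<omega> + \<epsilon>\<^sup>2 * (h \<omega>)\<^sup>2) / ?N"
      by (simp only: expect_eq)
    also have "\<dots> = 1 + \<epsilon>\<^sup>2 * v"
      using N by (simp add: sum.distrib sum_distrib_left[symmetric] sums add_divide_distrib)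
    finally have Ef: "expect L \<kappa> f = 1 + \<epsilon>\<^sup>2 * v" .
    have "(\<Sum>\<omega>\<in>?\<Omega>. (k (1 + \<epsilon> * h \<omega>) - 2 * (\<epsilon> * h \<omega>)) / \<epsilon>\<^sup>2) = (\<Sum>\<omega>\<in>?\<Omega>. f \<omega> * ln (f \<omega>)) / \<epsilon>\<^sup>2"
      by (simp add: sum_divide_distrib[symmetric] sum_subtractf sum_distrib_left[symmetric] sums k_def f_def)
    hence "R \<epsilon> = Ent L \<kappa> f / \<epsilon>\<^sup>2" unfolding R_def Ent_def Ef
      by (simp add: expect_eq diff_divide_distrib)
    also have "Ent L \<kappa> f \<le> \<tau> * dirichlet_on L \<kappa> G (\<lambda>\<omega>. sqrt (f \<omega>)) (\<lambda>\<omega>. sqrt (f \<omega>))"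
      by (rule ls) (simp add: f_def)
    also have "dirichlet_on L \<kappa> G (\<lambda>\<omega>. sqrt (f \<omega>)) (\<lambda>\<omega>. sqrt (f \<omega>)) = \<epsilon>\<^sup>2 * dirichlet_on L \<kappa> G h h"
      unfolding dirichlet_on_affine[symmetric] by (rule dirichlet_on_cong) (use elim in \<open>simp add: f_def less_imp_le\<close>)
    finally show ?case using elim by (simp add: divide_right_mono)
  qed
  with lim show ?thesis unfolding v_def[symmetric] by (intro tendsto_upperbound) auto
qed

lemma log_sobolev_lower_bounds:
  fixes G :: "nat \<Rightarrow> nat \<Rightarrow> real"
  assumes n: "n = num_sites L \<kappa>" "n \<ge> 2" and l: "l \<in> {1..L}" "0 < \<kappa> l" "\<kappa> l < n"
    and G: "\<And>i j. G i j = G j i" "\<And>i. G i i = 0" "\<And>i. i \<in> {1..n} \<Longrightarrow> (\<Sum>j = 1..n. G i j) = 1"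
    and ls: "\<And>f. (\<forall>\<omega>\<in>multislice L \<kappa>. 0 \<le> f \<omega>) \<Longrightarrow>
      Ent L \<kappa> f \<le> \<tau> * dirichlet_on L \<kappa> G (\<lambda>\<omega>. sqrt (f \<omega>)) (\<lambda>\<omega>. sqrt (f \<omega>))"
    and \<tau>: "0 \<le> \<tau>"
  shows "ln (real n / real (\<kappa> l)) \<le> \<tau>"
    and "measure_pmf.variance (pmf_of_set {1..n}) \<phi>
      \<le> \<tau> / 2 * (1 / (2 * real n) * (\<Sum>i = 1..n. \<Sum>j = 1..n. G i j * (\<phi> i - \<phi> j)\<^sup>2))"
proof -
  let ?A = "pair_var n (\<kappa> l)"
  note occ = n l(1)
  define p where "p = real (\<kappa> l) / real n"
  have p: "p > 0" using l n by (simp add: p_def)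
  have A: "?A = p * ((real n - real (\<kappa> l)) / (real n - 1))" by (simp add: pair_var_def p_def)
  have A_pos: "?A > 0" using p l n unfolding A by (intro mult_pos_pos divide_pos_pos) auto
  show "ln (real n / real (\<kappa> l)) \<le> \<tau>"
  proof -
    \<comment> \<open>The resulting f is an indicator: it equals its square root, and f ln f
      vanishes identically.\<close>
    define \<phi> where "\<phi> i = (if i = 1 then 1 else 0 :: real)" for i :: nat
    define f where "f = occupation n \<phi> l"
    have f: "f \<omega> = (if \<omega> 1 = l then 1 else 0)" for \<omega>
    proof -
      have "f \<omega> = (\<Sum>i = 1..n. if i = 1 then (if \<omega> 1 = l then 1 else 0) else 0)"
        unfolding f_def occupation_def \<phi>_def by (intro sum.cong) auto
      thus ?thesis using n by simp
    qed
    have "(\<Sum>i = 1..n. \<phi> i) = 1" using n by (simp add: \<phi>_def)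
    hence Ef: "expect L \<kappa> f = p" unfolding f_def by (simp add: expect_occupation[OF occ] p_def)
    have "(\<lambda>\<omega>. f \<omega> * ln (f \<omega>)) = (\<lambda>\<omega>. 0)" by (simp add: f fun_eq_iff)
    hence "Ent L \<kappa> f = - p * ln p" unfolding Ent_def Ef by (simp add: expect_eq)
    moreover have "Ent L \<kappa> f \<le> \<tau> * dirichlet_on L \<kappa> G f f"
    proof -
      have "(\<lambda>\<omega>. sqrt (f \<omega>)) = f" by (simp add: f fun_eq_iff)
      thus ?thesis using ls[of f] by (simp add: f)
    qed
    \<comment> \<open>Only the row and the column of site 1 contribute, and each has sum 1.\<close>
    moreover have "dirichlet_on L \<kappa> G f f = ?A"
    proof -
      have "(\<Sum>i = 1..n. \<Sum>j = 1..n. G i j * (\<phi> i - \<phi> j)\<^sup>2)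
        = (\<Sum>i = 1..n. \<Sum>j = 1..n. (if i = 1 then G 1 j else 0) + (if j = 1 then G 1 i else 0))"
        by (rule sum.cong[OF refl], rule sum.cong[OF refl]) (auto simp: \<phi>_def G)
      also have "\<dots> = (\<Sum>i = 1..n. \<Sum>j = 1..n. if i = 1 then G 1 j else 0) + (\<Sum>i = 1..n. \<Sum>j = 1..n. if j = 1 then G 1 i else 0)"
        by (simp only: sum.distrib)
      also have "(\<Sum>i = 1..n. \<Sum>j = 1..n. if j = 1 then G 1 i else 0) = (\<Sum>i = 1..n. \<Sum>j = 1..n. if i = 1 then G 1 j else 0)"
        by (rule sum.swap)
      also have "(\<Sum>i = 1..n. \<Sum>j = 1..n. if i = 1 then G 1 j else 0) = (\<Sum>i = 1..n. if i = 1 then 1 else 0)"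
        using G(3)[of 1] n by (intro sum.cong) auto
      finally have "(\<Sum>i = 1..n. \<Sum>j = 1..n. G i j * (\<phi> i - \<phi> j)\<^sup>2) = 2" using n by simp
      thus ?thesis unfolding f_def by (simp add: dirichlet_on_occupation[OF occ G(1)])
    qed
    ultimately have "- p * ln p \<le> \<tau> * ?A" by simp
    \<comment> \<open>Here \<open>\<kappa> l \<ge> 1\<close> enters, through n - \<kappa> l \<le> n
      - 1.\<close>
    also have "\<dots> \<le> \<tau> * p"
    proof -
      have "(real n - real (\<kappa> l)) / (real n - 1) \<le> 1" using l n by simp
      hence "p * ((real n - real (\<kappa> l)) / (real n - 1)) \<le> p * 1" using p by (intro mult_left_mono) auto
      hence "?A \<le> p" unfolding A by simp
      thus ?thesis using \<tau> by (rule mult_left_mono)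
    qed
    finally have "p * (- ln p) \<le> p * \<tau>" by (simp add: mult.commute)
    hence "- ln p \<le> \<tau>" using p by (simp only: mult_le_cancel_left_pos)
    thus ?thesis using l n by (simp add: p_def ln_div)
  qed
  \<comment> \<open>Centring changes neither the variance nor the energy, and it gives the
    occupation statistic mean zero. The positive factor \<open>?A\<close> then cancels, whatever the
    colour.\<close>
  define m where "m = (\<Sum>i = 1..n. \<phi> i) / real n"
  define \<psi> where "\<psi> i = \<phi> i - m" for i
  have \<psi>0: "(\<Sum>i = 1..n. \<psi> i) = 0" using n by (simp add: \<psi>_def sum_subtractf m_def)
  have "2 * expect L \<kappa> (\<lambda>\<omega>. (occupation n \<psi> l \<omega>)\<^sup>2) \<le> \<tau> * dirichlet_on L \<kappa> G (occupation n \<psi> l) (occupation n \<psi> l)"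
    by (rule log_sobolev_imp_poincare, erule ls, simp only: expect_occupation[OF occ] \<psi>0 mult_zero_right)
  hence "?A * (2 * (\<Sum>i = 1..n. (\<psi> i)\<^sup>2)) \<le> ?A * (\<tau> / 2 * (\<Sum>i = 1..n. \<Sum>j = 1..n. G i j * (\<psi> i - \<psi> j)\<^sup>2))"
    unfolding expect_occupation_sq[OF occ \<psi>0] dirichlet_on_occupation[OF occ G(1)] by (simp add: mult_ac)
  hence le: "2 * (\<Sum>i = 1..n. (\<psi> i)\<^sup>2) \<le> \<tau> / 2 * (\<Sum>i = 1..n. \<Sum>j = 1..n. G i j * (\<psi> i - \<psi> j)\<^sup>2)"
    using A_pos by (simp only: mult_le_cancel_left_pos)
  have ne: "{1..n} \<noteq> {}" "finite {1..n}" using n by auto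
  have "measure_pmf.variance (pmf_of_set {1..n}) \<phi> = (\<Sum>i = 1..n. (\<psi> i)\<^sup>2) / real n"
    unfolding integral_pmf_of_set[OF ne] by (simp add: \<psi>_def m_def)
  also have "\<dots> \<le> (\<tau> / 2 * (\<Sum>i = 1..n. \<Sum>j = 1..n. G i j * (\<psi> i - \<psi> j)\<^sup>2)) / 2 / real n"
    using le by (intro divide_right_mono) auto
  also have "\<dots> = \<tau> / 2 * (1 / (2 * real n) * (\<Sum>i = 1..n. \<Sum>j = 1..n. G i j * (\<phi> i - \<phi> j)\<^sup>2))"
    by (simp add: \<psi>_def)
  finally show "measure_pmf.variance (pmf_of_set {1..n}) \<phi>
      \<le> \<tau> / 2 * (1 / (2 * real n) * (\<Sum>i = 1..n. \<Sum>j = 1..n. G i j * (\<phi> i - \<phi> j)\<^sup>2))" .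
qed

section \<open>Simple random walk on a regular graph and assembly of the bounds\<close>

lemma walk_matrix_regular:
  assumes "regular_graph n d adj" "d \<ge> 1"
  shows "walk_matrix d adj i j = walk_matrix d adj j i" "walk_matrix d adj i i = 0"
    "walk_matrix d adj i j \<ge> 0"
    "i \<in> {1..n} \<Longrightarrow> (\<Sum>j = 1..n. walk_matrix d adj i j) = 1"
proof -
  have g: "{(i, j). adj i j} \<subseteq> {1..n} \<times> {1..n}" "symp adj" "irreflp adj" "\<And>i. i \<in> {1..n} \<Longrightarrow> card {j. adj i j} = d"
    using assms(1) unfolding regular_graph_def by auto
  show "walk_matrix d adj i j = walk_matrix d adj j i" using g(2) by (auto simp: walk_matrix_def dest: sympD)
  show "walk_matrix d adj i i = 0" using g(3) by (auto simp: walk_matrix_def dest: irreflpD)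
  show "walk_matrix d adj i j \<ge> 0" by (simp add: walk_matrix_def)
  assume i: "i \<in> {1..n}"
  have "(\<Sum>j = 1..n. walk_matrix d adj i j) = (\<Sum>j\<in>{j \<in> {1..n}. adj i j}. 1 / real d)"
    unfolding walk_matrix_def by (subst sum.inter_filter) auto
  also have "{j \<in> {1..n}. adj i j} = {j. adj i j}" using g(1) by auto
  finally show "(\<Sum>j = 1..n. walk_matrix d adj i j) = 1" using g(4)[OF i] assms(2) by simp
qed

theorem corollary2:
  fixes L n \<kappa>min d :: nat and \<kappa> :: "nat \<Rightarrow> nat" and adj :: "nat \<Rightarrow> nat \<Rightarrow> bool"
  assumes "L \<ge> 2"
    and "\<And>l. l \<in> {1..L} \<Longrightarrow> \<kappa> l > 0"
    and "n = (\<Sum>l = 1..L. \<kappa> l)"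
    and "\<kappa>min = Min (\<kappa> ` {1..L})"
    and "d \<ge> 1"
    and "regular_graph n d adj"
  shows "max (2 * tau_REL n (walk_matrix d adj)) (ereal (ln (real n / real \<kappa>min)))
           \<le> tau_LS L \<kappa> (walk_matrix d adj)
       \<and> tau_LS L \<kappa> (walk_matrix d adj)
           \<le> ereal (4 / ln 2) * comparison_const n (walk_matrix d adj)
              * ereal (ln (real n / real \<kappa>min))"
proof -
  define G where "G = walk_matrix d adj"
  note G = walk_matrix_regular[OF assms(6,5), folded G_def]
  have n: "n = num_sites L \<kappa>" using assms(3) by (simp add: num_sites_def)
  have L: "L \<ge> 1" using assms(1) by simp
  have "\<kappa>min \<in> \<kappa> ` {1..L}" unfolding assms(4) using L by (intro Min_in) auto
  then obtain l where l: "l \<in> {1..L}" "\<kappa>min = \<kappa> l" by blast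
  have l0: "\<kappa> l > 0" using l assms(2) by blast
  \<comment> \<open>A second colour is present, so the rarest one does not fill all sites; this
    makes both \<open>\<Lambda>\<close> and the factor \<open>pair_var\<close> positive.\<close>
  have ln_lt: "\<kappa> l < n"
  proof -
    obtain l' where l': "l' \<in> {1..L}" "l' \<noteq> l" using assms(1) by (metis atLeastAtMost_iff l(1) le_refl not_less_eq_eq numeral_2_eq_2 one_le_numeral order_trans One_nat_def)
    have "(\<Sum>i\<in>{l, l'}. \<kappa> i) \<le> (\<Sum>i = 1..L. \<kappa> i)" using l(1) l' by (intro sum_mono2) auto
    thus ?thesis using l' assms(2)[OF l'(1)] unfolding assms(3) by simp
  qed
  have n2: "n \<ge> 2" using l0 ln_lt by simp
  define \<Lambda> where "\<Lambda> = ln (real n / real \<kappa>min)"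
  have \<Lambda>: "\<Lambda> > 0" using l0 ln_lt by (simp add: \<Lambda>_def l(2))
  define LS where "LS \<tau> \<longleftrightarrow> (\<forall>f. (\<forall>\<omega>\<in>multislice L \<kappa>. 0 \<le> f \<omega>) \<longrightarrow>
      Ent L \<kappa> f \<le> \<tau> * dirichlet_on L \<kappa> G (\<lambda>\<omega>. sqrt (f \<omega>)) (\<lambda>\<omega>. sqrt (f \<omega>)))" for \<tau>
  have tau: "tau_LS L \<kappa> G = Inf {ereal \<tau> |\<tau>. 0 \<le> \<tau> \<and> LS \<tau>}" by (simp add: tau_LS_def LS_def)
  have lower: "\<Lambda> \<le> \<tau>" "2 * tau_REL n G \<le> ereal \<tau>" if "0 \<le> \<tau>" "LS \<tau>" for \<tau>
  proof -
    note lb = log_sobolev_lower_bounds[OF n n2 l(1) l0 ln_lt G(1,2,4) _ that(1)]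
    have ls: "Ent L \<kappa> f \<le> \<tau> * dirichlet_on L \<kappa> G (\<lambda>\<omega>. sqrt (f \<omega>)) (\<lambda>\<omega>. sqrt (f \<omega>))"
      if "\<forall>\<omega>\<in>multislice L \<kappa>. 0 \<le> f \<omega>" for f using \<open>LS \<tau>\<close> that unfolding LS_def by blast
    show "\<Lambda> \<le> \<tau>" unfolding \<Lambda>_def l(2) by (rule lb(1)[OF _ ls])
    have "tau_REL n G \<le> ereal (\<tau> / 2)" unfolding tau_REL_def
    proof (rule Inf_lower, rule CollectI, intro exI conjI allI)
      fix h :: "nat \<Rightarrow> real"
      show "measure_pmf.variance (pmf_of_set {1..n}) h
        \<le> \<tau> / 2 * (1 / (2 * real n) * (\<Sum>i = 1..n. \<Sum>j = 1..n. G i j * (h i - h j)\<^sup>2))"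
        by (rule lb(2)[OF _ ls])
    qed (use that in auto)
    hence "2 * tau_REL n G \<le> 2 * ereal (\<tau> / 2)" by (intro ereal_mult_left_mono) auto
    thus "2 * tau_REL n G \<le> ereal \<tau>" by simp
  qed
  have part1: "max (2 * tau_REL n G) (ereal \<Lambda>) \<le> tau_LS L \<kappa> G"
    unfolding tau using lower by (intro Inf_greatest) auto
  have LS_upper: "LS (4 / ln 2 * c * \<Lambda>)"
    if c: "\<And>f. dirichlet n (\<lambda>_. 1) f f \<le> c * dirichlet_on n (\<lambda>_. 1) G f f" for c
    unfolding LS_def
  proof (intro allI impI)
    fix f :: "(nat \<Rightarrow> nat) \<Rightarrow> real" assume f: "\<forall>\<omega>\<in>multislice L \<kappa>. 0 \<le> f \<omega>"
    let ?s = "\<lambda>\<omega>. sqrt (f \<omega>)"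
    have "Ent L \<kappa> f \<le> 4 / ln 2 * \<Lambda> * dirichlet L \<kappa> ?s ?s"
      using mean_field_log_sobolev[of L \<kappa> f, OF L assms(2)] f unfolding \<Lambda>_def assms(4) n by blast
    also have "\<dots> \<le> 4 / ln 2 * \<Lambda> * (c * dirichlet_on L \<kappa> G ?s ?s)"
      using \<Lambda> by (intro mult_left_mono comparison_lift[OF n c]) auto
    finally show "Ent L \<kappa> f \<le> 4 / ln 2 * c * \<Lambda> * dirichlet_on L \<kappa> G ?s ?s" by (simp add: mult_ac)
  qed
  have dir_nonneg: "0 \<le> dirichlet_on L \<kappa> G f f" for f
  proof -
    have "0 \<le> expect L \<kappa> (\<lambda>\<omega>. grad i j f \<omega> * grad i j f \<omega>)" for i j
      by (simp add: expect_eq sum_nonneg)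
    thus ?thesis unfolding dirichlet_on_def by (intro mult_nonneg_nonneg sum_nonneg G(3)) auto
  qed
  have upper: "tau_LS L \<kappa> G \<le> ereal (4 / ln 2 * \<Lambda>) * ereal c"
    if c: "\<And>f. dirichlet n (\<lambda>_. 1) f f \<le> c * dirichlet_on n (\<lambda>_. 1) G f f" for c
  proof -
    \<comment> \<open>The comparison constant is defined without a sign condition, while admissible
      values for \<open>tau_LS\<close> must be nonnegative. A negative c would make 0 admissible,
      against the lower bound \<open>\<Lambda> > 0\<close>.\<close>
    have "c \<ge> 0"
    proof (rule ccontr)
      assume "\<not> c \<ge> 0"
      hence "4 / ln 2 * c * \<Lambda> \<le> 0" using \<Lambda> by (intro mult_nonpos_nonneg mult_nonneg_nonpos) auto
      hence "LS 0" using LS_upper[OF c] dir_nonneg mult_right_mono[of "4 / ln 2 * c * \<Lambda>" 0]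
        unfolding LS_def by (meson order_trans)
      thus False using lower(1)[of 0] \<Lambda> by simp
    qed
    hence "tau_LS L \<kappa> G \<le> ereal (4 / ln 2 * c * \<Lambda>)"
      unfolding tau using LS_upper[OF c] \<Lambda> by (intro Inf_lower) auto
    thus ?thesis by (simp add: mult_ac)
  qed
  have K: "4 / ln 2 * \<Lambda> > 0" using \<Lambda> by simp
  \<comment> \<open>Moving the positive finite factor to the left allows the infimum to be treated
    by its greatest-lower-bound property, including the case of an empty set with infimum
    \<infinity>.\<close>
  have "tau_LS L \<kappa> G / ereal (4 / ln 2 * \<Lambda>) \<le> comparison_const n G"
    unfolding comparison_const_def
  proof (rule Inf_greatest)
    fix x assume "x \<in> {ereal c |c. \<forall>f. dirichlet n (\<lambda>_. 1) f f \<le> c * dirichlet_on n (\<lambda>_. 1) G f f}"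
    then obtain c where "x = ereal c" "\<And>f. dirichlet n (\<lambda>_. 1) f f \<le> c * dirichlet_on n (\<lambda>_. 1) G f f" by blast
    thus "tau_LS L \<kappa> G / ereal (4 / ln 2 * \<Lambda>) \<le> x"
      using upper[of c] K by (subst ereal_divide_le_pos) auto
  qed
  hence "tau_LS L \<kappa> G \<le> ereal (4 / ln 2 * \<Lambda>) * comparison_const n G"
    using K by (subst (asm) ereal_divide_le_pos) auto
  also have "\<dots> = ereal (4 / ln 2) * comparison_const n G * ereal \<Lambda>"
    by (simp only: times_ereal.simps(1)[symmetric] mult_ac)
  finally show ?thesis using part1 unfolding G_def \<Lambda>_def by blast
qed

end
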